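(* Let $k\ge 3$ and $n>2k$ be integers, and let $$\beta=\begin{cases}-1 & \text{if } k \text{ is even and } 4\mid n,\\ 1 & \text{if } k \text{ is odd and } 4\mid n-2,\\ 0 & \text{otherwise.}\end{cases}$$ Then $$\nu_k(K_n)\ \ge\ \begin{cases} L_{k,n}(1)=\frac12(n-3)(n-2k) & \text{if } 2k<n\le 3k,\\[2pt] L_{k,n}(2)=(n-3)\left(n-\frac52k\right)-k\,\delta_1(n) & \text{if } 3k<n\le 4k,\\[2pt] L_{k,n}(3)=\frac32(n-3)(n-3k)-k\left(\delta_1(n)+\delta_2(n)\right) & \text{if } 4k<n\le \lfloor 4.5k\rfloor+\beta,\\[2pt] L_{k,n}(4)=2(n-3)\left(n-\frac{27}{8}k\right)-k\left(\delta_1(n)+\delta_2(n)+\delta_3(n)\right) & \text{if } \lfloor 4.5k\rfloor+\beta<n\le 5k,\\[2pt] L_{k,n}(5)=\frac52(n-3)\left(n-\frac{37}{10}k\right)-k\left(\delta_1(n)+\delta_2(n)+\delta_3(n)+\delta_4(n)\right) & \text{otherwise.} \end{cases}$$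
   Context: A $k$-page book consists of $k$ halfplanes (pages) with a common boundary line (the spine). A $k$-page book drawing of a graph $G$ is a drawing of $G$ in a $k$-page book in which all vertices lie on the spine and edges do not cross the spine (each edge lies in one page). The $k$-page book crossing number $\nu_k(G)$ is the minimum number of edge-crossings over all $k$-page book drawings of $G$. Equivalently (convex model), $\nu_k(K_n)$ is the minimum, over all colorings of the edges of the complete geometric graph on the $n$ vertices of a convex polygon with $k$ colors, of the number of monochromatic crossings, i.e. pairs of edges of the same color that cross in their interiors. $K_n$ is the complete graph on $n$ vertices. $D_n$ denotes the complete convex graph on $n$ vertices minus the sides of the polygon: its vertices are the vertices of a convex $n$-gon and its edges are all the diagonals (straight segments) of the polygon. For an integer $\ell\ge 0$, $e_\ell(n)$ is the maximum number of edges over all subgraphs of $D_n$ in which each edge is crossed at most $\ell$ times by other edges of the subgraph. For integers $k\ge1$, $n\ge 3$, $m\ge 0$, $$L_{k,n}(m):=\frac m2 n(n-3)-k\sum_{\ell=0}^{m-1}e_\ell(n).$$ The functions $\delta_i$ are: $\delta_1(n)=\tfrac12$ if $n$ is even and $0$ otherwise; $\delta_2(n)=1$ if $n\equiv 2\pmod 3$ and $0$ otherwise; $\delta_3(n)=-\tfrac14,\tfrac12,\tfrac54,0$ if $n\equiv 0,1,2,3\pmod 4$, respectively; $\delta_4(n)=\tfrac12,0,\tfrac32,1$ if $n\equiv 0,1,2,3\pmod 4$, respectively. *)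

theory Defs
  imports "HOL-Analysis.Analysis"
begin

text \<open>
  Book crossing numbers are taken in the convex model. An edge is the two-element set of its
  endpoints; the corresponding straight segment is the convex hull of the edge.
\<close>

definition convex_polygon :: "nat \<Rightarrow> (real^2) set \<Rightarrow> bool" where
  "convex_polygon n P \<longleftrightarrow> finite P \<and> card P = n \<and> (\<forall>p\<in>P. p \<notin> convex hull (P - {p}))"

definition complete_edges :: "'a set \<Rightarrow> 'a set set" where
  "complete_edges P = {e. e \<subseteq> P \<and> card e = 2}"

text \<open>
  Two edges with a common endpoint never cross in this sense, since a convex polygon has no three
  collinear vertices.
\<close>

definition crosses :: "(real^2) set \<Rightarrow> (real^2) set \<Rightarrow> bool" where
  "crosses e f \<longleftrightarrow> e \<noteq> f \<and> rel_interior (convex hull e) \<inter> rel_interior (convex hull f) \<noteq> {}"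

definition monochromatic_crossings :: "(real^2) set \<Rightarrow> ((real^2) set \<Rightarrow> nat) \<Rightarrow> nat" where
  "monochromatic_crossings P c =
     card {{e, f} | e f. e \<in> complete_edges P \<and> f \<in> complete_edges P \<and> crosses e f \<and> c e = c f}"

text \<open>
  The crossing pattern depends only on the cyclic order of the vertices, so minimizing over the
  polygon as well as over the coloring does not change the value. The same applies to the
  maximum in \<open>max_edges\<close> below.
\<close>

definition book_crossing_number_complete :: "nat \<Rightarrow> nat \<Rightarrow> nat" where
  "book_crossing_number_complete k n =
     Inf {monochromatic_crossings P c | P c.
            convex_polygon n P \<and> c ` complete_edges P \<subseteq> {..<k}}"

definition diagonals :: "(real^2) set \<Rightarrow> (real^2) set set" where
  "diagonals P = {e \<in> complete_edges P. \<not> (convex hull e) edge_of (convex hull P)}"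

definition max_edges :: "nat \<Rightarrow> nat \<Rightarrow> nat" where
  "max_edges l n =
     Max {card G | G P. convex_polygon n P \<and> G \<subseteq> diagonals P \<and>
            (\<forall>e\<in>G. card {f \<in> G. crosses e f} \<le> l)}"

definition L :: "nat \<Rightarrow> nat \<Rightarrow> nat \<Rightarrow> real" where
  "L k n m = real m / 2 * real n * (real n - 3) - real k * (\<Sum>l<m. real (max_edges l n))"

definition \<delta>\<^sub>1 :: "nat \<Rightarrow> real" where
  "\<delta>\<^sub>1 n = (if even n then 1/2 else 0)"

definition \<delta>\<^sub>2 :: "nat \<Rightarrow> real" where
  "\<delta>\<^sub>2 n = (if n mod 3 = 2 then 1 else 0)"

definition \<delta>\<^sub>3 :: "nat \<Rightarrow> real" where
  "\<delta>\<^sub>3 n = (if n mod 4 = 0 then -1/4 else if n mod 4 = 1 then 1/2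
           else if n mod 4 = 2 then 5/4 else 0)"

definition \<delta>\<^sub>4 :: "nat \<Rightarrow> real" where
  "\<delta>\<^sub>4 n = (if n mod 4 = 0 then 1/2 else if n mod 4 = 1 then 0
           else if n mod 4 = 2 then 3/2 else 1)"

definition \<beta> :: "nat \<Rightarrow> nat \<Rightarrow> int" where
  "\<beta> k n = (if even k \<and> 4 dvd int n then -1
            else if odd k \<and> 4 dvd (int n - 2) then 1 else 0)"

end

theory Submission
  imports Defs
begin

text \<open>
  Removing edges one at a time shows that a set of \<open>d\<close> diagonals has at least
  \<open>m d - (\<Sum>l<m. e\<^sub>l(n))\<close> crossings; applied to every colour class this bounds the
  book crossing number by \<open>L\<^bsub>k,n\<^esub>(m)\<close>. So everything rests on the exact
  values of \<open>e\<^sub>l(n)\<close> for \<open>l \<le> 4\<close>. The lower bounds glue small polygons along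
  sides. For the upper bounds, a polygon in which every edge is crossed at most \<open>l\<close> times has a
  triangulation all of whose chords are crossed at most \<open>l\<close> times. The part cut off by such a
  chord is seen from outside only through the edges leaving it: at each vertex, their number and the number
  of further crossings they can still take. A finite table bounds the number of edges of
  the part in terms of this state and of the number of its vertices modulo \<open>M\<close>; that the table is
  consistent under gluing two parts to a triangle is verified by evaluation.
\<close>

section \<open>Potential tables\<close>

text \<open>The potential of a part is four times its inner edges plus twice its leaving edges minus
  \<open>C\<close> per inner vertex. An edge between two glued parts leaves both of them, so its two
  halves make one inner edge and gluing neither gains nor loses on it. \<open>C / 4\<close> is the
  number of edges per vertex in the long run: 1, 3/2, 2, 9/4 and 5/2; the factor 4 makes everything
  integral. The exact maximum oscillates around this line, which forces the residues modulo
  \<open>M\<close>. At most \<open>l\<close> edges leave a part and capacities are at most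
  \<open>l\<close>, so there are only finitely many states; potentials that do not exceed a floor
  \<open>K\<close> are caught by entries of full capacity, and the rest of a table treats the
  others. One gluing is a search over all ways to match leaving edges of the two parts. The obstacle
  is to run this search inside the simplifier: hence unary numbers, early pruning, and the value
  \<open>True\<close> for branches that belong to no drawing.\<close>

text \<open>
  A state lists, for the vertices of a part that have edges leaving it, the number of these edges and the
  capacity, which is the number of further crossings each of them may take. One capacity per vertex suffices:
  inside the part, all edges leaving from a vertex cross the same edges. An entry adds a vector, indexed by
  the number of vertices modulo \<open>M\<close>, of upper bounds (shifted to be nonnegative) for the potential, see
  \<open>val\<close> below. In a table group \<open>(hi, k, es)\<close>, the states have \<open>k\<close> leaving edges and the bounds are
  at most \<open>hi\<close>. All programs use nested conditionals and continuations, so that the simplifier visits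
  only the branches that are needed.
\<close>

type_synonym state = "(nat \<times> nat) list"
type_synonym entry = "state \<times> nat list"
type_synonym table = "(nat \<times> nat \<times> entry list) list"
type_synonym column = "nat \<times> nat option \<times> nat \<times> nat"
type_synonym continuation = "column list \<Rightarrow> nat \<Rightarrow> nat \<Rightarrow> state \<Rightarrow> bool"

text \<open>Larger capacities are weaker constraints, so an entry also bounds every state with the
  same leaving edges and smaller capacities.\<close>

fun below :: "state \<Rightarrow> state \<Rightarrow> bool" where
  "below [] [] = True"
| "below [] (_ # _) = False"
| "below (_ # _) [] = False"
| "below ((k, c) # s) ((k', c') # s') = (if k = k' then if c \<le> c' then below s s' else False else False)"

fun found :: "entry list \<Rightarrow> state \<Rightarrow> nat \<Rightarrow> nat \<Rightarrow> bool" where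
  "found [] s k w = False"
| "found ((s', v) # T) s k w =
    (if below s s' then if w \<le> v ! k then True else found T s k w else found T s k w)"

fun found_in :: "table \<Rightarrow> state \<Rightarrow> nat \<Rightarrow> nat \<Rightarrow> bool" where
  "found_in [] s k w = False"
| "found_in ((hi, sz, es) # T) s k w =
    (if w \<le> hi then if found es s k w then True else found_in T s k w else found_in T s k w)"

text \<open>Different residues may be covered by different entries. A residue with value 0 asks for
  nothing: there the potential is at most the floor, where a default entry suffices.\<close>

fun covered :: "nat list \<Rightarrow> table \<Rightarrow> state \<Rightarrow> nat \<Rightarrow> bool" where
  "covered [] T s k = True"
| "covered (0 # ws) T s k = covered ws T s (Suc k)"
| "covered (Suc w # ws) T s k = (if found_in T s k (Suc w) then covered ws T s (Suc k) else False)"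

fun add_max :: "nat list \<Rightarrow> nat \<Rightarrow> nat list \<Rightarrow> nat list" where
  "add_max (x # xs) a (w # ws) = (if a + w \<le> x then x else a + w) # add_max xs a ws"
| "add_max _ a _ = []"

fun shift :: "nat list \<Rightarrow> nat list" where "shift w = last w # butlast w"

text \<open>Max-plus convolution over residues: \<open>shift\<close> rotates \<open>w\<close> by one
  place for each entry of \<open>v\<close>, so position \<open>k\<close> collects the sums of
  \<open>v\<close> at \<open>i\<close> and \<open>w\<close> at \<open>k - i\<close>.\<close>

primrec conv :: "nat list \<Rightarrow> nat list \<Rightarrow> nat list \<Rightarrow> nat list" where
  "conv [] w acc = acc"
| "conv (a # v) w acc = conv v (shift w) (add_max acc a w)"

primrec zeros :: "nat list \<Rightarrow> nat list" where
  "zeros [] = []"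
| "zeros (_ # xs) = 0 # zeros xs"

primrec excess :: "nat list \<Rightarrow> nat \<Rightarrow> nat \<Rightarrow> nat list" where
  "excess [] g c = []"
| "excess (w # ws) g c = (w + g - c) # excess ws g c"

text \<open>The additional \<open>shift\<close> accounts for the shared vertex, which becomes an
  inner vertex: \<open>i\<close> and \<open>j\<close> inner vertices give \<open>i + j + 1\<close>.
  Both potentials are shifted by the floor \<open>K\<close>, the result only once, so
  \<open>c\<close> is \<open>C - K\<close>; \<open>g\<close> is what the gluing gains.\<close>

definition accept :: "table \<Rightarrow> nat \<Rightarrow> nat list \<Rightarrow> nat list \<Rightarrow> nat \<Rightarrow> state \<Rightarrow> bool" where
  "accept T c v w g s = covered (excess (conv v (shift w) (zeros w)) g c) T s 0"

section \<open>Search through the gluings of two parts\<close>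

fun fits :: "nat \<Rightarrow> nat option \<Rightarrow> bool" where
  "fits d None = True"
| "fits d (Some b) = (d \<le> b)"

fun lower :: "nat \<Rightarrow> nat option \<Rightarrow> nat option" where
  "lower d None = None"
| "lower d (Some b) = Some (b - d)"

text \<open>An edge considered later crosses either all or none of the earlier edges that end at a
  given right vertex, so only the smallest remaining budget has to be kept.\<close>

fun cut :: "nat \<Rightarrow> nat option \<Rightarrow> nat option" where
  "cut d None = Some d"
| "cut d (Some b) = (if b \<le> d then Some b else Some d)"

text \<open>
  A column \<open>(P, B, q, c)\<close> is a vertex of the right part: \<open>P\<close> edges from the left part already end there
  and can be crossed by at most \<open>B\<close> later edges (\<open>None\<close> if \<open>P = 0\<close>), \<open>q\<close> leaving edges are not
  yet assigned, and \<open>c\<close> is their capacity.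
\<close>

fun place :: "column list \<Rightarrow> nat \<Rightarrow> nat \<Rightarrow> nat \<Rightarrow> continuation \<Rightarrow> nat \<Rightarrow> nat \<Rightarrow> state \<Rightarrow>
    nat \<Rightarrow> nat \<Rightarrow> column list \<Rightarrow> bool" where
  "place [] x need cp k tot xs acc 0 pp done = k (rev done) tot xs acc"
| "place [] x need cp k tot xs acc (Suc n) pp done = True"
| "place ((P, B, q, c) # cs) x need cp k tot xs acc n pp done =
    (if (if fits (x + n) B then
          place cs x need cp k tot xs acc n (pp + P) ((P, lower (x + n) B, q, c) # done) else True) then
       (case n of 0 \<Rightarrow> True | Suc n' \<Rightarrow> (case q of 0 \<Rightarrow> True | Suc q' \<Rightarrow>
         if fits (x + n') B then if need + pp \<le> cp + c then
           place cs x need cp k tot xs acc n' (pp + P)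
             ((Suc P, cut (cp + c - (need + pp)) (lower (x + n') B), q', c) # done)
         else True else True))
     else False)"

text \<open>A second name for \<open>place\<close> with its own congruence rule: the arguments that
  stay fixed during the recursion are normalized once at entry, and afterwards only
  \<open>pp\<close> and \<open>done\<close> are rewritten.\<close>

definition place_from where "place_from = place"

text \<open>An edge leaving from a right vertex crosses the joining edges that end beyond it
  (\<open>suf - P\<close>) and the base edge (\<open>e\<close>). It also uses up the budget of the
  joining edges that end at later vertices, which is why \<open>pre\<close> is compared with
  \<open>B\<close>. \<open>None\<close> signals an edge with too many crossings.\<close>

fun exits :: "column list \<Rightarrow> nat \<Rightarrow> nat \<Rightarrow> nat \<Rightarrow> state option" where
  "exits [] e pre suf = Some []"
| "exits ((P, B, q, c) # cs) e pre suf =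
    (if fits pre B then
       (case q of 0 \<Rightarrow> exits cs e pre (suf - P) | Suc _ \<Rightarrow>
         if suf - P + e \<le> c then
           (case exits cs e (pre + q) (suf - P) of None \<Rightarrow> None
            | Some s \<Rightarrow> Some ((q, c - (suf - P + e)) # s))
         else None)
     else None)"

fun remaining :: "column list \<Rightarrow> nat" where
  "remaining [] = 0"
| "remaining ((P, B, q, c) # cs) = q + remaining cs"

text \<open>The last column is the far end of the new chord. It is not an inner vertex, so nothing
  leaves from it and all its edges must have been used up.\<close>

fun last_free :: "column list \<Rightarrow> nat" where
  "last_free [(P, B, q, c)] = q"
| "last_free (_ # c # cs) = last_free (c # cs)"
| "last_free [] = 0"

text \<open>Prunes the search: a left vertex sends at most one edge to each column, and only to
  columns where the crossings known in advance leave enough capacity.\<close>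

fun room :: "column list \<Rightarrow> nat \<Rightarrow> nat \<Rightarrow> nat" where
  "room [] need cp = 0"
| "room ((P, B, q, c) # cs) need cp = (case q of 0 \<Rightarrow> room cs need cp
    | Suc _ \<Rightarrow> if need \<le> cp + c then Suc (room cs need cp) else room cs need cp)"

primrec stubs :: "state \<Rightarrow> nat" where
  "stubs [] = 0"
| "stubs (g # s) = fst g + stubs s"

text \<open>The first argument is the number of edges of the current left vertex that end in the
  right part; the other ones leave the glued part. Those cross the \<open>tot\<close> joining edges
  of earlier left vertices and the base edge, whereas the \<open>r\<close> edges leaving from the
  shared vertex cross all joining edges.\<close>

primrec attempts :: "nat \<Rightarrow> nat \<Rightarrow> nat \<Rightarrow> nat \<Rightarrow> nat \<Rightarrow> nat \<Rightarrow> nat \<Rightarrow> nat \<Rightarrow> continuation \<Rightarrow> continuation" where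
  "attempts 0 l e r nA free kg cp k cols tot xs acc =
    (if nA \<le> tot then if xs + kg \<le> l then if tot + e \<le> cp then
       place_from cols kg (l + r) cp k tot (xs + kg) ((kg, cp - (tot + e)) # acc) 0 0 []
     else True else True else True)"
| "attempts (Suc n) l e r nA free kg cp k cols tot xs acc =
    (if (if n < free then if nA \<le> tot + Suc n then
         if (case r of 0 \<Rightarrow> True | Suc _ \<Rightarrow> tot + Suc n + e \<le> l) then
           (case kg - Suc n of
             0 \<Rightarrow> place_from cols 0 (l + r) cp k (tot + Suc n) xs acc (Suc n) 0 []
           | Suc x \<Rightarrow> if xs + Suc x \<le> l then if tot + e \<le> cp then
               place_from cols (Suc x) (l + r) cp k (tot + Suc n) (xs + Suc x)
                 ((Suc x, cp - (tot + e)) # acc) (Suc n) 0 []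
               else True else True)
         else True else True else True)
     then attempts n l e r nA free kg cp k cols tot xs acc else False)"

text \<open>\<open>nA\<close> is a lower bound for the number of joining edges. The vertices still
  to come contribute at most \<open>stubs s\<close> of them, so \<open>nA - stubs s\<close> must be
  reached before.\<close>

primrec walk :: "state \<Rightarrow> nat \<Rightarrow> nat \<Rightarrow> nat \<Rightarrow> nat \<Rightarrow> (state \<Rightarrow> bool) \<Rightarrow> continuation" where
  "walk [] l e r nA good cols tot xs acc =
    (case last_free cols of
       0 \<Rightarrow> if xs + remaining cols \<le> l then
         (case exits cols e 0 tot of None \<Rightarrow> True
          | Some s \<Rightarrow> good (rev acc @ (case r of 0 \<Rightarrow> s | Suc _ \<Rightarrow> (r, l - (tot + e)) # s)))
         else True
     | Suc _ \<Rightarrow> True)"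
| "walk (g # s) l e r nA good cols tot xs acc =
    attempts (fst g) l e r (nA - stubs s) (room cols (l + r) (snd g)) (fst g) (snd g)
      (walk s l e r nA good) cols tot xs acc"

text \<open>The added column is the far end, where \<open>b\<close> edges from the left part end. No
  inner edge passes over it, so its capacity is the full \<open>l\<close>.\<close>

fun columns :: "state \<Rightarrow> nat \<Rightarrow> nat \<Rightarrow> column list" where
  "columns [] b l = [(0, None, b, l)]"
| "columns ((k, c) # s) b l = (0, None, k, c) # columns s b l"

text \<open>Limits the number of joining edges that end at the far end: at most one starts from each
  left vertex, and it crosses all \<open>r\<close> edges leaving from the shared vertex.\<close>

fun capable :: "state \<Rightarrow> nat \<Rightarrow> nat" where
  "capable [] r = 0"
| "capable ((k, c) # s) r = (if r \<le> c then Suc (capable s r) else capable s r)"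

text \<open>Division by two, in a form that unary evaluation handles with \<open>Suc\<close> and
  subtraction only.\<close>

primrec half :: "nat \<Rightarrow> nat" where
  "half 0 = 0"
| "half (Suc n) = n - half n"

type_synonym acceptor = "nat list \<Rightarrow> nat list \<Rightarrow> nat \<Rightarrow> state \<Rightarrow> bool"

fun right_entries :: "entry list \<Rightarrow> nat \<Rightarrow> nat \<Rightarrow> nat \<Rightarrow> nat \<Rightarrow> nat \<Rightarrow> entry \<Rightarrow> nat \<Rightarrow> acceptor \<Rightarrow> bool" where
  "right_entries [] nA l e r b lt g good = True"
| "right_entries ((sR, w) # Rs) nA l e r b (sL, v) g good =
    (if walk sL l e r nA (good v w g) (columns sR b l) 0 r [] then
       right_entries Rs nA l e r b (sL, v) g good else False)"

fun right_group :: "nat \<Rightarrow> nat \<Rightarrow> nat \<Rightarrow> nat \<Rightarrow> nat \<Rightarrow> nat \<Rightarrow> nat \<Rightarrow> entry list \<Rightarrow> entry \<Rightarrow> nat \<Rightarrow> acceptor \<Rightarrow> bool" where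
  "right_group nA kL kR l e r b es lt g good =
    (if nA \<le> kL then if nA \<le> kR then if (case r of 0 \<Rightarrow> True | Suc _ \<Rightarrow> nA + e \<le> l) then
       right_entries es nA l e r b lt g good else True else True else True)"

text \<open>A group is skipped if even its largest bound leaves the glued potential at the floor.
  Otherwise, of the \<open>kL + kR + b + r\<close> edge ends at most \<open>l\<close> belong to
  edges leaving the glued part and the others pair up; rounding up half of the difference gives the
  required number of joining edges.\<close>

fun right_table :: "table \<Rightarrow> nat \<Rightarrow> nat \<Rightarrow> nat \<Rightarrow> nat \<Rightarrow> nat \<Rightarrow> nat \<Rightarrow> entry \<Rightarrow> nat \<Rightarrow> acceptor \<Rightarrow> bool" where
  "right_table [] d kL l e r b lt g good = True"
| "right_table ((hi, kR, es) # T) d kL l e r b lt g good =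
    (if (if Suc hi \<le> d then True else
         right_group (half (kL + kR + b + r + 1 - l)) kL (kR + b) l e r b es lt g good) then
       right_table T d kL l e r b lt g good else False)"

text \<open>A joining edge that ends at the far end was a leaving edge of the left part only, so
  turning it into an inner edge gains 2. A new edge leaving from the shared vertex gains 2 as well,
  and a base edge gains 4.\<close>

primrec loop_b :: "nat \<Rightarrow> nat \<Rightarrow> nat \<Rightarrow> nat \<Rightarrow> nat \<Rightarrow> nat \<Rightarrow> entry \<Rightarrow> nat \<Rightarrow> nat \<Rightarrow> acceptor \<Rightarrow> table \<Rightarrow> bool" where
  "loop_b 0 hi kL l e r lt g c good T = right_table T (Suc c - (hi + g)) kL l e r 0 lt g good"
| "loop_b (Suc b) hi kL l e r lt g c good T =
    (if right_table T (Suc c - (hi + (b + b + Suc (Suc g)))) kL l e r (Suc b) lt (b + b + Suc (Suc g)) good then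
       loop_b b hi kL l e r lt g c good T else False)"

primrec loop_r :: "nat \<Rightarrow> nat \<Rightarrow> nat \<Rightarrow> nat \<Rightarrow> nat \<Rightarrow> entry \<Rightarrow> nat \<Rightarrow> nat \<Rightarrow> acceptor \<Rightarrow> table \<Rightarrow> bool" where
  "loop_r 0 hi kL l e lt g c good T = loop_b (capable (fst lt) 0) hi kL l e 0 lt g c good T"
| "loop_r (Suc r) hi kL l e lt g c good T =
    (if loop_b (capable (fst lt) (Suc r)) hi kL l e (Suc r) lt (r + r + Suc (Suc g)) c good T then
       loop_r r hi kL l e lt g c good T else False)"

primrec left_entries :: "entry list \<Rightarrow> nat \<Rightarrow> nat \<Rightarrow> nat \<Rightarrow> nat \<Rightarrow> acceptor \<Rightarrow> table \<Rightarrow> bool" where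
  "left_entries [] hi kL l c good T = True"
| "left_entries (lt # Ls) hi kL l c good T =
    (if loop_r l hi kL l 0 lt 0 c good T then
     if loop_r l hi kL l (Suc 0) lt (Suc (Suc (Suc (Suc 0)))) c good T then
       left_entries Ls hi kL l c good T else False else False)"

fun check :: "table \<Rightarrow> nat \<Rightarrow> nat \<Rightarrow> acceptor \<Rightarrow> table \<Rightarrow> bool" where
  "check [] l c good T = True"
| "check ((hi, kL, es) # Ts) l c good T =
    (if left_entries es hi kL l c good T then check Ts l c good T else False)"

text \<open>
  These rules keep the simplifier from rewriting unevaluated continuations, tables and loop bodies.
\<close>

lemma evaluation_congs:
  "pp = pp' \<Longrightarrow> done = done' \<Longrightarrow>
   place cs x need cp k tot xs acc n pp done = place cs x need cp k tot xs acc n pp' done'"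
  "x = x' \<Longrightarrow> need = need' \<Longrightarrow> tot = tot' \<Longrightarrow> xs = xs' \<Longrightarrow> acc = acc' \<Longrightarrow>
   place_from cs x need cp k tot xs acc n pp done = place_from cs x' need' cp k tot' xs' acc' n pp done"
  "n = n' \<Longrightarrow> nA = nA' \<Longrightarrow> free = free' \<Longrightarrow> kg = kg' \<Longrightarrow> cp = cp' \<Longrightarrow>
   attempts n l e r nA free kg cp k cols tot xs acc = attempts n' l e r nA' free' kg' cp' k cols tot xs acc"
  "cols = cols' \<Longrightarrow> walk s l e r nA ok cols tot xs acc = walk s l e r nA ok cols' tot xs acc"
  "right_entries Rs nA l e r b lt g good = right_entries Rs nA l e r b lt g good"
  "nA = nA' \<Longrightarrow> kR = kR' \<Longrightarrow> right_group nA kL kR l e r b es lt g good = right_group nA' kL kR' l e r b es lt g good"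
  "d = d' \<Longrightarrow> g = g' \<Longrightarrow> right_table T d kL l e r b lt g good = right_table T d' kL l e r b lt g' good"
  "b = b' \<Longrightarrow> g = g' \<Longrightarrow> loop_b b hi kL l e r lt g c good T = loop_b b' hi kL l e r lt g' c good T"
  "loop_r r hi kL l e lt g c good T = loop_r r hi kL l e lt g c good T"
  "left_entries Ls hi kL l c good T = left_entries Ls hi kL l c good T"
  "check Ts l c good T = check Ts l c good T"
  "ws = ws' \<Longrightarrow> covered ws T s j = covered ws' T s j"
  "found_in T s j w = found_in T s j w"
  "found es s j w = found es s j w"
  by simp_all

lemmas evaluation_weak_congs =
  if_weak_cong nat.case_cong_weak option.case_cong_weak evaluation_congs

section \<open>Rules for evaluation with unary numbers\<close>

lemma evaluation_arith:
  "((0::nat) \<le> n) = True" "(Suc m \<le> 0) = False" "(Suc m \<le> Suc n) = (m \<le> n)"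
  "(m < Suc n) = (m \<le> n)" "(m < (0::nat)) = False"
  "((0::nat) = 0) = True" "(Suc m = 0) = False" "(0 = Suc m) = False" "(Suc m = Suc n) = (m = n)"
  "m - 0 = (m::nat)" "0 - m = (0::nat)" "Suc m - Suc n = m - n"
  "(x # xs) ! 0 = x" "(x # xs) ! Suc n = xs ! n"
  "last [x] = x" "last (x # y # xs) = last (y # xs)"
  "butlast [x] = []" "butlast (x # y # xs) = x # butlast (y # xs)"
  by auto

lemmas evaluation_rules = evaluation_arith One_nat_def if_True if_False nat.case option.case fst_conv snd_conv
  add_0 add_Suc rev.simps append.simps below.simps found.simps found_in.simps covered.simps
  add_max.simps shift.simps conv.simps zeros.simps excess.simps fits.simps lower.simps cut.simps
  place.simps place_from_def exits.simps remaining.simps last_free.simps room.simps stubs.simps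
  attempts.simps walk.simps columns.simps capable.simps half.simps right_entries.simps
  right_group.simps right_table.simps loop_b.simps loop_r.simps left_entries.simps check.simps

lemmas unary = eval_nat_numeral BitM.simps One_nat_def

section \<open>Tables for one to four crossings per edge\<close>

definition table1 :: table where
  "table1 = [(2, 0, [([], [2, 0])]),
   (2, 1, [([(1,0)], [0, 2])]),
   (0, 1, [([(1,1)], [0, 0])])]"

definition table2 :: table where
  "table2 = [(4, 0, [([], [4, 0, 0])]),
   (4, 2, [([(1,0), (1,0)], [0, 0, 4]),
    ([(2,0)], [2, 4, 2]),
    ([(2,1)], [0, 4, 0])]),
   (2, 1, [([(1,0)], [0, 2, 2]),
    ([(1,1)], [0, 2, 0])]),
   (0, 1, [([(1,2)], [0, 0, 0])]),
   (0, 2, [([(1,2), (1,2)], [0, 0, 0]),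
    ([(2,2)], [0, 0, 0])])]"

definition table3 :: table where
  "table3 = [(6, 2, [([(1,0), (1,0)], [2, 2, 3, 6])]),
   (6, 3, [([(3,0)], [5, 6, 5, 5]),
    ([(3,1)], [3, 6, 3, 3]),
    ([(3,2)], [3, 6, 2, 2])]),
   (5, 0, [([], [5, 1, 1, 2])]),
   (5, 3, [([(1,1), (2,0)], [3, 3, 5, 4]),
    ([(1,1), (2,1)], [1, 2, 5, 1]),
    ([(2,0), (1,1)], [3, 3, 5, 4]),
    ([(2,1), (1,1)], [1, 2, 5, 1])]),
   (4, 1, [([(1,0)], [3, 2, 1, 4])]),
   (4, 2, [([(2,0)], [3, 4, 3, 3]),
    ([(2,1)], [1, 4, 3, 1]),
    ([(2,2)], [1, 4, 0, 0])]),
   (4, 3, [([(1,0), (1,0), (1,1)], [0, 0, 1, 4]),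
    ([(1,1), (1,0), (1,0)], [0, 0, 1, 4])]),
   (3, 2, [([(1,1), (1,1)], [0, 0, 3, 2])]),
   (3, 3, [([(1,2), (2,0)], [3, 3, 3, 3]),
    ([(2,0), (1,2)], [3, 3, 3, 3])]),
   (2, 1, [([(1,1)], [0, 2, 1, 0]),
    ([(1,2)], [0, 2, 0, 0])]),
   (2, 3, [([(3,3)], [0, 2, 0, 0])]),
   (1, 2, [([(1,0), (1,2)], [1, 1, 1, 1]),
    ([(1,2), (1,0)], [1, 1, 1, 1])]),
   (1, 3, [([(1,2), (2,1)], [1, 1, 1, 1]),
    ([(1,2), (2,2)], [0, 0, 1, 0]),
    ([(2,1), (1,2)], [1, 1, 1, 1]),
    ([(2,2), (1,2)], [0, 0, 1, 0])]),
   (0, 1, [([(1,3)], [0, 0, 0, 0])]),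
   (0, 2, [([(1,3), (1,3)], [0, 0, 0, 0]),
    ([(2,3)], [0, 0, 0, 0])]),
   (0, 3, [([(1,3), (1,3), (1,3)], [0, 0, 0, 0]),
    ([(1,3), (2,3)], [0, 0, 0, 0]),
    ([(2,3), (1,3)], [0, 0, 0, 0])])]"

definition table4 :: table where
  "table4 = [(8, 4, [([(2,1), (2,1)], [6, 4, 6, 8]),
    ([(4,0)], [8, 8, 8, 8]),
    ([(4,1)], [6, 8, 6, 6]),
    ([(4,3)], [4, 8, 6, 4])]),
   (6, 0, [([], [6, 4, 2, 2])]),
   (6, 2, [([(1,0), (1,0)], [6, 4, 4, 4]),
    ([(1,0), (1,1)], [6, 4, 2, 4]),
    ([(1,1), (1,0)], [6, 4, 2, 4])]),
   (6, 3, [([(1,1), (1,0), (1,1)], [4, 2, 2, 6]),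
    ([(1,1), (2,1)], [4, 2, 4, 6]),
    ([(2,1), (1,1)], [4, 2, 4, 6]),
    ([(3,0)], [6, 6, 6, 6]),
    ([(3,1)], [4, 6, 4, 4]),
    ([(3,3)], [2, 6, 4, 2])]),
   (6, 4, [([(1,2), (1,0), (2,0)], [6, 4, 2, 4]),
    ([(1,2), (3,2)], [2, 2, 6, 4]),
    ([(1,3), (3,0)], [6, 6, 6, 6]),
    ([(2,0), (1,0), (1,2)], [6, 4, 2, 4]),
    ([(2,2), (2,2)], [2, 2, 6, 4]),
    ([(3,0), (1,3)], [6, 6, 6, 6]),
    ([(3,2), (1,2)], [2, 2, 6, 4])]),
   (4, 1, [([(1,0)], [4, 2, 2, 2]),
    ([(1,1)], [4, 2, 0, 2])]),
   (4, 2, [([(1,1), (1,1)], [2, 0, 2, 4]),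
    ([(2,0)], [4, 4, 4, 4]),
    ([(2,1)], [2, 4, 2, 4]),
    ([(2,3)], [0, 4, 2, 0])]),
   (4, 3, [([(1,0), (1,0), (1,2)], [4, 2, 0, 2]),
    ([(1,2), (1,0), (1,0)], [4, 2, 0, 2]),
    ([(1,2), (2,2)], [0, 0, 4, 2]),
    ([(1,3), (2,0)], [4, 4, 4, 4]),
    ([(2,0), (1,3)], [4, 4, 4, 4]),
    ([(2,2), (1,2)], [0, 0, 4, 2])]),
   (4, 4, [([(1,0), (3,3)], [2, 4, 2, 0]),
    ([(1,1), (1,1), (2,2)], [2, 0, 0, 4]),
    ([(1,1), (2,1), (1,2)], [2, 0, 0, 4]),
    ([(1,2), (1,1), (2,1)], [2, 2, 2, 4]),
    ([(1,2), (2,1), (1,1)], [2, 0, 0, 4]),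
    ([(1,3), (3,1)], [4, 4, 4, 4]),
    ([(2,1), (1,1), (1,2)], [2, 2, 2, 4]),
    ([(2,2), (1,1), (1,1)], [2, 0, 0, 4]),
    ([(3,1), (1,3)], [4, 4, 4, 4]),
    ([(3,3), (1,0)], [2, 4, 2, 0]),
    ([(4,4)], [0, 4, 2, 0])]),
   (2, 1, [([(1,3)], [0, 2, 0, 0])]),
   (2, 2, [([(1,0), (1,3)], [2, 2, 2, 2]),
    ([(1,1), (1,2)], [2, 0, 2, 0]),
    ([(1,2), (1,1)], [2, 0, 2, 0]),
    ([(1,2), (1,2)], [0, 0, 2, 0]),
    ([(1,3), (1,0)], [2, 2, 2, 2])]),
   (2, 3, [([(1,0), (2,3)], [0, 2, 0, 0]),
    ([(1,2), (1,1), (1,2)], [0, 0, 0, 2]),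
    ([(1,3), (2,1)], [2, 2, 2, 2]),
    ([(2,1), (1,3)], [2, 2, 2, 2]),
    ([(2,3), (1,0)], [0, 2, 0, 0]),
    ([(3,4)], [0, 2, 0, 0])]),
   (2, 4, [([(1,0), (1,0), (1,1), (1,2)], [2, 0, 0, 0]),
    ([(1,0), (1,0), (2,3)], [2, 0, 0, 0]),
    ([(1,0), (2,0), (1,3)], [2, 0, 0, 0]),
    ([(1,1), (1,0), (1,0), (1,2)], [2, 0, 0, 0]),
    ([(1,1), (1,1), (1,1), (1,1)], [2, 0, 0, 0]),
    ([(1,2), (1,0), (1,0), (1,1)], [2, 0, 0, 0]),
    ([(1,2), (1,1), (1,0), (1,0)], [2, 0, 0, 0]),
    ([(1,2), (2,0), (1,2)], [2, 2, 2, 2]),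
    ([(1,3), (1,3), (2,1)], [2, 2, 2, 2]),
    ([(1,3), (2,0), (1,0)], [2, 0, 0, 0]),
    ([(1,3), (3,2)], [2, 2, 2, 2]),
    ([(1,3), (3,3)], [0, 0, 2, 0]),
    ([(1,4), (3,1)], [2, 2, 2, 2]),
    ([(2,1), (1,3), (1,3)], [2, 2, 2, 2]),
    ([(2,1), (2,3)], [2, 2, 2, 2]),
    ([(2,3), (1,0), (1,0)], [2, 0, 0, 0]),
    ([(2,3), (2,1)], [2, 2, 2, 2]),
    ([(2,3), (2,3)], [0, 0, 2, 0]),
    ([(3,1), (1,4)], [2, 2, 2, 2]),
    ([(3,2), (1,3)], [2, 2, 2, 2]),
    ([(3,3), (1,3)], [0, 0, 2, 0])]),
   (0, 1, [([(1,4)], [0, 0, 0, 0])]),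
   (0, 2, [([(1,4), (1,4)], [0, 0, 0, 0]),
    ([(2,4)], [0, 0, 0, 0])]),
   (0, 3, [([(1,4), (1,4), (1,4)], [0, 0, 0, 0]),
    ([(1,4), (2,4)], [0, 0, 0, 0]),
    ([(2,4), (1,4)], [0, 0, 0, 0])]),
   (0, 4, [([(1,4), (1,4), (1,4), (1,4)], [0, 0, 0, 0]),
    ([(1,4), (1,4), (2,4)], [0, 0, 0, 0]),
    ([(1,4), (2,4), (1,4)], [0, 0, 0, 0]),
    ([(1,4), (3,4)], [0, 0, 0, 0]),
    ([(2,4), (1,4), (1,4)], [0, 0, 0, 0]),
    ([(2,4), (2,4)], [0, 0, 0, 0]),
    ([(3,4), (1,4)], [0, 0, 0, 0])])]"

text \<open>The constants are \<open>C - K\<close> for the pairs (6, -2), (8, -4), (9, -5) and (10,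
  -6). Named acceptors keep the tables out of the terms carried through the search.\<close>

definition accept1 :: acceptor where "accept1 = accept table1 8"
definition accept2 :: acceptor where "accept2 = accept table2 12"
definition accept3 :: acceptor where "accept3 = accept table3 14"
definition accept4 :: acceptor where "accept4 = accept table4 16"

text \<open>Stated for four arguments, so that an acceptor unfolds only when it has received a
  completed glued state, not while it travels as a partially applied continuation.\<close>

lemma accept_apply:
  "accept1 v w g s = accept table1 8 v w g s"
  "accept2 v w g s = accept table2 12 v w g s"
  "accept3 v w g s = accept table3 14 v w g s"
  "accept4 v w g s = accept table4 16 v w g s"
  by (simp_all only: accept1_def accept2_def accept3_def accept4_def)

lemma check_table1: "check table1 1 8 accept1 table1"
  unfolding table1_def unary
  by (simp only: evaluation_rules accept_apply(1)[unfolded table1_def unary accept_def] cong: evaluation_weak_congs)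

lemma check_table2: "check table2 2 12 accept2 table2"
  unfolding table2_def unary
  by (simp only: evaluation_rules accept_apply(2)[unfolded table2_def unary accept_def] cong: evaluation_weak_congs)

lemma check_table3: "check table3 3 14 accept3 table3"
  unfolding table3_def unary
  by (simp only: evaluation_rules accept_apply(3)[unfolded table3_def unary accept_def] cong: evaluation_weak_congs)

lemma check_table4: "check table4 4 16 accept4 table4"
  unfolding table4_def unary
  by (simp only: evaluation_rules accept_apply(4)[unfolded table4_def unary accept_def] cong: evaluation_weak_congs)

section \<open>Soundness of the table check\<close>

definition above :: "int list \<Rightarrow> int \<Rightarrow> (int \<Rightarrow> nat) \<Rightarrow> nat" where
  "above ws w f = (\<Sum>v\<in>{v\<in>set ws. w < v}. f v)"

definition beneath :: "int list \<Rightarrow> int \<Rightarrow> (int \<Rightarrow> nat) \<Rightarrow> nat" where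
  "beneath ws w f = (\<Sum>v\<in>{v\<in>set ws. v < w}. f v)"

lemma above_Nil [simp]: "above [] w f = 0" and beneath_Nil [simp]: "beneath [] w f = 0"
  by (simp_all add: above_def beneath_def)

lemma above_Cons:
  assumes "sorted_wrt (<) (w # ws)"
  shows "above (w # ws) w f = sum f (set ws)" "v \<in> set ws \<Longrightarrow> above (w # ws) v f = above ws v f"
proof -
  have "{v \<in> set (w # ws). w < v} = set ws" using assms by auto
  then show "above (w # ws) w f = sum f (set ws)" by (simp add: above_def)
  assume "v \<in> set ws"
  then have "{u \<in> set (w # ws). v < u} = {u \<in> set ws. v < u}" using assms by auto
  then show "above (w # ws) v f = above ws v f" by (simp add: above_def)
qed

lemma beneath_Cons:
  assumes "sorted_wrt (<) (w # ws)"
  shows "beneath (w # ws) w f = 0" "v \<in> set ws \<Longrightarrow> beneath (w # ws) v f = f w + beneath ws v f"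
proof -
  have "{v \<in> set (w # ws). v < w} = {}" using assms by auto
  then show "beneath (w # ws) w f = 0" by (simp only: beneath_def sum.empty)
  assume "v \<in> set ws"
  then have "{u \<in> set (w # ws). u < v} = insert w {u \<in> set ws. u < v}" "w \<notin> {u \<in> set ws. u < v}"
    using assms by auto
  then show "beneath (w # ws) v f = f w + beneath ws v f" by (simp add: beneath_def)
qed

lemma sum_Cons:
  assumes "sorted_wrt (<) (w # ws :: 'a :: linorder list)"
  shows "sum f (set (w # ws)) = f w + sum f (set ws)"
proof -
  have "w \<notin> set ws" using assms by force
  then show ?thesis by simp
qed

text \<open>What \<open>place\<close> does to the budget of one column; \<open>b\<close> is 1 if the
  column receives an edge from the current left vertex and 0 otherwise.\<close>

definition new_budget :: "nat \<Rightarrow> nat \<Rightarrow> nat \<Rightarrow> nat \<Rightarrow> nat option \<Rightarrow> nat option" where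
  "new_budget d b m need B = (if b = 1 then cut (m - need) (lower d B) else lower d B)"

lemma new_budget_simps [simp]:
  "new_budget d 0 m need B = lower d B" "new_budget d (Suc 0) m need B = cut (m - need) (lower d B)"
  by (simp_all add: new_budget_def)

text \<open>\<open>a\<close> marks the columns in which the edges of one left vertex really end. As
  \<open>place\<close> tries every choice, its success includes success of the continuation on this
  one. An older edge ending at \<open>w\<close> is crossed by the \<open>x\<close> leaving edges of
  this vertex and by its edges that end beyond \<open>w\<close>.\<close>

lemma place_sound:
  assumes "place (map (\<lambda>w. (P w, B w, q w, c w)) ws) x need cp k tot xs acc n pp done"
    and "sorted_wrt (<) ws"
    and "\<And>w. w \<in> set ws \<Longrightarrow> a w \<le> 1" and "n = sum a (set ws)"
    and "\<And>w. w \<in> set ws \<Longrightarrow> fits (x + above ws w a) (B w)"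
    and "\<And>w. w \<in> set ws \<Longrightarrow> a w = 1 \<Longrightarrow> 0 < q w \<and> need + (pp + beneath ws w P) \<le> cp + c w"
  shows "k (rev done @ map (\<lambda>w. (P w + a w,
    new_budget (x + above ws w a) (a w) (cp + c w) (need + (pp + beneath ws w P)) (B w), q w - a w, c w)) ws) tot xs acc"
  using assms
proof (induction ws arbitrary: n pp "done")
  case Nil
  then show ?case by simp
next
  case (Cons w ws)
  note sorted = Cons.prems(2)
  have sorted': "sorted_wrt (<) ws" using sorted by simp
  note ab = above_Cons[OF sorted] and be = beneath_Cons[OF sorted]
  have n: "n = a w + sum a (set ws)" using Cons.prems(4) sum_Cons[OF sorted] by simp
  have a: "a v \<le> 1" if "v \<in> set ws" for v using Cons.prems(3) that by simp
  have fit: "fits (x + above ws v a) (B v)" if "v \<in> set ws" for v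
    using Cons.prems(5)[of v] that ab(2) by simp
  have cond: "0 < q v \<and> need + (pp + P w + beneath ws v P) \<le> cp + c v" if "v \<in> set ws" "a v = 1" for v
    using Cons.prems(6)[of v] that be(2)[of v P] by (simp add: add.assoc)
  have fit_w: "fits (x + sum a (set ws)) (B w)" using Cons.prems(5)[of w] ab(1) by simp
  have cong: "map (\<lambda>v. (P v + a v, new_budget (x + above ws v a) (a v) (cp + c v) (need + (pp + P w + beneath ws v P)) (B v), q v - a v, c v)) ws
    = map (\<lambda>v. (P v + a v, new_budget (x + above (w # ws) v a) (a v) (cp + c v) (need + (pp + beneath (w # ws) v P)) (B v), q v - a v, c v)) ws"
    using ab(2) be(2) by (intro map_cong) (auto simp: add.assoc)
  consider "a w = 0" | "a w = 1" using Cons.prems(3)[of w] by fastforce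
  then show ?case
  proof cases
    case 1
    have "place (map (\<lambda>w. (P w, B w, q w, c w)) ws) x need cp k tot xs acc n (pp + P w)
       ((P w, lower (x + n) (B w), q w, c w) # done)"
      using Cons.prems(1) fit_w n 1 by (simp split: if_splits)
    from Cons.IH[OF this sorted' a _ fit cond, unfolded cong] n 1
    show ?thesis using ab(1) by simp
  next
    case 2
    obtain n' where n': "n = Suc n'" "n' = sum a (set ws)" using n 2 by simp
    obtain q' where q': "q w = Suc q'" using Cons.prems(6)[of w] 2 by (auto simp: gr0_conv_Suc)
    have need: "need + pp \<le> cp + c w" using Cons.prems(6)[of w] 2 be(1) by simp
    have "place (map (\<lambda>w. (P w, B w, q w, c w)) ws) x need cp k tot xs acc n' (pp + P w)
       ((Suc (P w), cut (cp + c w - (need + pp)) (lower (x + n') (B w)), q', c w) # done)"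
      using Cons.prems(1) fit_w n' q' need by (simp split: if_splits)
    from Cons.IH[OF this sorted' a _ fit cond, unfolded cong] n'
    show ?thesis using ab(1) be(1) 2 q' by simp
  qed
qed

lemma fits_lower: "fits (d + m) B \<Longrightarrow> fits m (lower d B)"
  by (cases B) auto

lemma fits_cut: "fits m B \<Longrightarrow> m \<le> d \<Longrightarrow> fits m (cut d B)"
  by (cases B) auto

lemma exits_sound:
  assumes "sorted_wrt (<) ws" and "suf = sum P (set ws)"
    and "\<And>w. w \<in> set ws \<Longrightarrow> fits (pre + beneath ws w q) (B w)"
    and "\<And>w. w \<in> set ws \<Longrightarrow> 0 < q w \<Longrightarrow> above ws w P + e \<le> c w"
  shows "exits (map (\<lambda>w. (P w, B w, q w, c w)) ws) e pre suf =
    Some (map (\<lambda>w. (q w, c w - (above ws w P + e))) (filter (\<lambda>w. q w \<noteq> 0) ws))"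
  using assms
proof (induction ws arbitrary: pre suf)
  case Nil
  then show ?case by simp
next
  case (Cons w ws)
  note sorted = Cons.prems(1)
  note ab = above_Cons[OF sorted] and be = beneath_Cons[OF sorted]
  have suf: "suf - P w = sum P (set ws)" using Cons.prems(2) sum_Cons[OF sorted, of P] by simp
  have IH: "exits (map (\<lambda>w. (P w, B w, q w, c w)) ws) e (pre + q w) (suf - P w) =
    Some (map (\<lambda>w. (q w, c w - (above ws w P + e))) (filter (\<lambda>w. q w \<noteq> 0) ws))"
  proof (rule Cons.IH)
    show "sorted_wrt (<) ws" using sorted by simp
    show "fits (pre + q w + beneath ws v q) (B v)" if "v \<in> set ws" for v
      using Cons.prems(3)[of v] that be(2)[of v q] by (simp add: add.assoc)
    show "above ws v P + e \<le> c v" if "v \<in> set ws" "0 < q v" for v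
      using Cons.prems(4)[of v] that ab(2)[of v P] by simp
  qed (rule suf)
  have fit: "fits pre (B w)" using Cons.prems(3)[of w] be(1)[of q] by simp
  have cap: "q w = 0 \<or> sum P (set ws) + e \<le> c w" using Cons.prems(4)[of w] ab(1)[of P] by auto
  have cong: "map (\<lambda>v. (q v, c v - (above ws v P + e))) (filter (\<lambda>v. q v \<noteq> 0) ws)
    = map (\<lambda>v. (q v, c v - (above (w # ws) v P + e))) (filter (\<lambda>v. q v \<noteq> 0) ws)"
    using ab(2)[of _ P] by (intro map_cong) auto
  show ?case
    using IH fit cap suf ab(1)[of P] unfolding cong by (auto split: nat.split)
qed

lemma remaining_map:
  "sorted_wrt (<) (ws :: int list) \<Longrightarrow> remaining (map (\<lambda>w. (P w, B w, q w, c w)) ws) = sum q (set ws)"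
proof (induction ws)
  case (Cons w ws)
  then show ?case using sum_Cons[OF Cons.prems, of q] by simp
qed simp

lemma last_free_map:
  "ws \<noteq> [] \<Longrightarrow> last_free (map (\<lambda>w. (P w, B w, q w, c w)) ws) = q (last ws)"
proof (induction ws)
  case (Cons w ws)
  then show ?case by (cases ws) auto
qed simp

lemma room_bound:
  assumes "sorted_wrt (<) (ws :: int list)" "\<And>w. w \<in> set ws \<Longrightarrow> a w \<le> (1::nat)"
    "\<And>w. w \<in> set ws \<Longrightarrow> a w = 1 \<Longrightarrow> 0 < q w \<and> need \<le> cp + c w"
  shows "sum a (set ws) \<le> room (map (\<lambda>w. (P w, B w, q w, c w)) ws) need cp"
  using assms
proof (induction ws)
  case (Cons w ws)
  have "sum a (set ws) \<le> room (map (\<lambda>w. (P w, B w, q w, c w)) ws) need cp"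
    using Cons by simp
  moreover have "a w = 0 \<or> a w = 1" using Cons.prems(2)[of w] by force
  ultimately show ?case using Cons.prems(3)[OF list.set_intros(1)] sum_Cons[OF Cons.prems(1), of a]
    by (auto split: nat.split simp del: list.set)
qed simp

lemma attempts_sound:
  assumes "attempts m l e r nA free kg cp k cols tot xs acc"
    and "n \<le> m" "n \<le> free" "nA \<le> tot + n" "r = 0 \<or> tot + n + e \<le> l" "xs + (kg - n) \<le> l"
    and "kg - n = 0 \<or> tot + e \<le> cp" "0 < kg"
  shows "place cols (kg - n) (l + r) cp k (tot + n) (xs + (kg - n))
    (if kg - n = 0 then acc else (kg - n, cp - (tot + e)) # acc) n 0 []"
  using assms
proof (induction m)
  case 0
  then show ?case by (simp add: place_from_def)
next
  case (Suc m)
  show ?case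
  proof (cases "n = Suc m")
    case True
    obtain d where d: "kg - n = d" by simp
    show ?thesis using Suc.prems d[unfolded True] unfolding d unfolding True
      by (cases d) (auto simp: place_from_def split: if_splits nat.splits)
  next
    case False
    then show ?thesis using Suc by (simp split: if_splits)
  qed
qed

lemma stubs_map: "sorted_wrt (<) (us :: int list) \<Longrightarrow> stubs (map (\<lambda>u. (k u, c u)) us) = sum k (set us)"
proof (induction us)
  case (Cons u us)
  then show ?case using sum_Cons[OF Cons.prems, of k] by simp
qed simp

text \<open>\<open>A\<close> is the actual matrix of joining edges, and \<open>x\<close> and
  \<open>f\<close> count the edges leaving from left and right vertices. For the induction,
  \<open>P\<close>, \<open>B\<close>, \<open>tot\<close>, \<open>xs\<close> and \<open>acc\<close>
  summarize the left vertices already treated, and \<open>A\<close> describes only the remaining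
  ones; \<open>cross\<close> therefore adds \<open>P\<close> to the joining edges of earlier
  vertices.\<close>

lemma walk_sound:
  fixes A :: "int \<Rightarrow> int \<Rightarrow> nat"
  assumes "walk (map (\<lambda>u. (k u, cu u)) us) l e r nA good (map (\<lambda>w. (P w, B w, q w, c w)) ws) tot xs acc"
    and us: "sorted_wrt (<) us" and ws: "sorted_wrt (<) ws" "ws \<noteq> []" "f (last ws) = 0"
    and A: "\<And>u w. u \<in> set us \<Longrightarrow> w \<in> set ws \<Longrightarrow> A u w \<le> 1"
    and k: "\<And>u. u \<in> set us \<Longrightarrow> 0 < k u \<and> k u = x u + sum (A u) (set ws)"
    and q: "\<And>w. w \<in> set ws \<Longrightarrow> q w = f w + (\<Sum>u\<in>set us. A u w)"
    and B: "\<And>w. w \<in> set ws \<Longrightarrow> fits ((\<Sum>u\<in>set us. x u + above ws w (A u)) + beneath ws w f) (B w)"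
    and x: "\<And>u. u \<in> set us \<Longrightarrow> 0 < x u \<Longrightarrow> tot + beneath us u (\<lambda>v. sum (A v) (set ws)) + e \<le> cu u"
    and r: "r = 0 \<or> tot + (\<Sum>u\<in>set us. sum (A u) (set ws)) + e \<le> l"
    and cross: "\<And>u w. u \<in> set us \<Longrightarrow> w \<in> set ws \<Longrightarrow> A u w = 1 \<Longrightarrow>
       l + r + beneath ws w (\<lambda>v. P v + beneath us u (\<lambda>u'. A u' v)) +
       above us u (\<lambda>u'. x u' + above ws w (A u')) + beneath ws w f \<le> cu u + c w"
    and t: "xs + sum x (set us) + sum f (set ws) \<le> l"
    and f: "\<And>w. w \<in> set ws \<Longrightarrow> 0 < f w \<Longrightarrow> above ws w (\<lambda>v. P v + (\<Sum>u\<in>set us. A u v)) + e \<le> c w"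
    and nA: "nA \<le> tot + (\<Sum>u\<in>set us. sum (A u) (set ws))"
    and tot: "tot = sum P (set ws)"
  shows "good (rev acc @
    map (\<lambda>u. (x u, cu u - (tot + beneath us u (\<lambda>v. sum (A v) (set ws)) + e))) (filter (\<lambda>u. x u \<noteq> 0) us) @
    (if r = 0 then [] else [(r, l - (tot + (\<Sum>u\<in>set us. sum (A u) (set ws)) + e))]) @
    map (\<lambda>w. (f w, c w - (above ws w (\<lambda>v. P v + (\<Sum>u\<in>set us. A u v)) + e))) (filter (\<lambda>w. f w \<noteq> 0) ws))"
  using assms
proof (induction us arbitrary: P B q tot xs acc)
  case Nil
  have q: "map (\<lambda>w. (P w, B w, q w, c w)) ws = map (\<lambda>w. (P w, B w, f w, c w)) ws"
    using Nil.prems(8) by simp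
  have ex: "exits (map (\<lambda>w. (P w, B w, f w, c w)) ws) e 0 tot =
    Some (map (\<lambda>w. (f w, c w - (above ws w P + e))) (filter (\<lambda>w. f w \<noteq> 0) ws))"
    by (rule exits_sound) (use Nil.prems in auto)
  show ?case
    using Nil.prems(1) ex Nil.prems(5,13) last_free_map[OF Nil.prems(4)] remaining_map[OF Nil.prems(3)]
    unfolding q by (auto split: nat.splits)
next
  case (Cons u us)
  note sorted = Cons.prems(2)
  note ab = above_Cons[OF sorted] and be = beneath_Cons[OF sorted] and sm = sum_Cons[OF sorted]
  have sorted': "sorted_wrt (<) us" using sorted by simp
  define n where "n = sum (A u) (set ws)"
  have ku: "k u = x u + n" "0 < k u" using Cons.prems(7)[of u] by (auto simp: n_def)
  then have x_eq: "k u - n = x u" by simp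
  have cross_u: "l + r + beneath ws w P + (\<Sum>v\<in>set us. x v + above ws w (A v)) + beneath ws w f \<le> cu u + c w"
    if "w \<in> set ws" "A u w = 1" for w
    using Cons.prems(12)[of u w] that ab(1) be(1) by simp
  have pos: "0 < q w" if "w \<in> set ws" "A u w = 1" for w
    using Cons.prems(8)[of w] that sm[of "\<lambda>u. A u w"] by (simp del: list.set)
  have "attempts (k u) l e r (nA - stubs (map (\<lambda>u. (k u, cu u)) us))
      (room (map (\<lambda>w. (P w, B w, q w, c w)) ws) (l + r) (cu u)) (k u) (cu u)
      (walk (map (\<lambda>u. (k u, cu u)) us) l e r nA good) (map (\<lambda>w. (P w, B w, q w, c w)) ws) tot xs acc"
    using Cons.prems(1) by simp
  then have "place (map (\<lambda>w. (P w, B w, q w, c w)) ws) (k u - n) (l + r) (cu u)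
     (walk (map (\<lambda>u. (k u, cu u)) us) l e r nA good) (tot + n) (xs + (k u - n))
    (if k u - n = 0 then acc else (k u - n, cu u - (tot + e)) # acc) n 0 []"
  proof (rule attempts_sound)
    show "n \<le> k u" "0 < k u" using ku by auto
    show "n \<le> room (map (\<lambda>w. (P w, B w, q w, c w)) ws) (l + r) (cu u)"
      unfolding n_def using Cons.prems(3) Cons.prems(6)[of u] pos
      by (intro room_bound) (auto dest: cross_u)
    have "(\<Sum>v\<in>set us. sum (A v) (set ws)) \<le> stubs (map (\<lambda>u. (k u, cu u)) us)"
      unfolding stubs_map[OF sorted'] using Cons.prems(7) by (intro sum_mono) simp
    then show "nA - stubs (map (\<lambda>u. (k u, cu u)) us) \<le> tot + n"
      using Cons.prems(15) sm[of "\<lambda>u. sum (A u) (set ws)"] unfolding n_def by (simp del: list.set)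
    show "r = 0 \<or> tot + n + e \<le> l"
      using Cons.prems(11) sm[of "\<lambda>u. sum (A u) (set ws)"] unfolding n_def by (auto simp del: list.set)
    show "xs + (k u - n) \<le> l" using Cons.prems(13) sm[of x] x_eq by (simp del: list.set)
    show "k u - n = 0 \<or> tot + e \<le> cu u" using Cons.prems(10)[of u] be(1) x_eq by auto
  qed
  then have "walk (map (\<lambda>u. (k u, cu u)) us) l e r nA good
    (rev [] @ map (\<lambda>w. (P w + A u w, new_budget (x u + above ws w (A u)) (A u w) (cu u + c w)
      (l + r + (0 + beneath ws w P)) (B w), q w - A u w, c w)) ws) (tot + n) (xs + x u)
    (if x u = 0 then acc else (x u, cu u - (tot + e)) # acc)"
    unfolding x_eq
  proof (rule place_sound)
    show "n = sum (A u) (set ws)" by (rule n_def)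
    show "fits (x u + above ws w (A u)) (B w)" if "w \<in> set ws" for w
      using Cons.prems(9)[OF that] sm[of "\<lambda>u. x u + above ws w (A u)"]
      by (cases "B w") (auto simp del: list.set)
    show "0 < q w \<and> l + r + (0 + beneath ws w P) \<le> cu u + c w" if "w \<in> set ws" "A u w = 1" for w
      using pos cross_u that by fastforce
  qed (use Cons.prems in auto)
  then have walk: "walk (map (\<lambda>u. (k u, cu u)) us) l e r nA good
    (map (\<lambda>w. (P w + A u w, new_budget (x u + above ws w (A u)) (A u w) (cu u + c w)
      (l + r + beneath ws w P) (B w), q w - A u w, c w)) ws) (tot + n) (xs + x u)
    (if x u = 0 then acc else (x u, cu u - (tot + e)) # acc)" by simp
  \<comment> \<open>For older edges ending at \<open>w\<close> the budget was only lowered by the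
    crossings with edges of \<open>u\<close>; for a new edge from \<open>u\<close> to
    \<open>w\<close> the budget is its remaining capacity, which \<open>cross_u\<close> compares
    with all crossings still to come.\<close>
  have fits': "fits ((\<Sum>v\<in>set us. x v + above ws w (A v)) + beneath ws w f)
     (new_budget (x u + above ws w (A u)) (A u w) (cu u + c w) (l + r + beneath ws w P) (B w))"
    if w: "w \<in> set ws" for w
  proof -
    have *: "fits ((\<Sum>v\<in>set us. x v + above ws w (A v)) + beneath ws w f) (lower (x u + above ws w (A u)) (B w))"
      using Cons.prems(9)[OF w] sm[of "\<lambda>u. x u + above ws w (A u)"]
      by (intro fits_lower) (simp add: add.assoc del: list.set)
    show ?thesis
      using * cross_u[OF w] by (auto simp: new_budget_def intro!: fits_cut)
  qed
  have cong: "P v + (\<Sum>u\<in>set (u # us). A u v) = P v + A u v + (\<Sum>u\<in>set us. A u v)" for v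
    using sm[of "\<lambda>u. A u v"] by (simp del: list.set)
  have res: "good (rev (if x u = 0 then acc else (x u, cu u - (tot + e)) # acc) @
    map (\<lambda>v. (x v, cu v - (tot + n + beneath us v (\<lambda>v. sum (A v) (set ws)) + e))) (filter (\<lambda>u. x u \<noteq> 0) us) @
    (if r = 0 then [] else [(r, l - (tot + n + (\<Sum>u\<in>set us. sum (A u) (set ws)) + e))]) @
    map (\<lambda>w. (f w, c w - (above ws w (\<lambda>v. P v + A u v + (\<Sum>u\<in>set us. A u v)) + e))) (filter (\<lambda>w. f w \<noteq> 0) ws))"
  proof (rule Cons.IH[OF walk sorted' Cons.prems(3) Cons.prems(4) Cons.prems(5) _ _ _ fits'])
    show "A v w \<le> 1" if "v \<in> set us" "w \<in> set ws" for v w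
      using Cons.prems(6)[of v w] that by simp
    show "0 < k v \<and> k v = x v + sum (A v) (set ws)" if "v \<in> set us" for v
      using Cons.prems(7)[OF list.set_intros(2)[OF that]] .
    show "q w - A u w = f w + (\<Sum>u\<in>set us. A u w)" if "w \<in> set ws" for w
      using Cons.prems(8)[OF that] sm[of "\<lambda>u. A u w"] by (simp del: list.set)
    show "tot + n + beneath us v (\<lambda>v. sum (A v) (set ws)) + e \<le> cu v" if "v \<in> set us" "0 < x v" for v
      using Cons.prems(10)[of v] that be(2)[of v "\<lambda>v. sum (A v) (set ws)"] by (simp add: n_def)
    show "r = 0 \<or> tot + n + (\<Sum>u\<in>set us. sum (A u) (set ws)) + e \<le> l"
      using Cons.prems(11) sm[of "\<lambda>u. sum (A u) (set ws)"] unfolding n_def by (auto simp del: list.set)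
    show "l + r + beneath ws w (\<lambda>va. P va + A u va + beneath us v (\<lambda>u'. A u' va)) +
       above us v (\<lambda>u'. x u' + above ws w (A u')) + beneath ws w f \<le> cu v + c w"
      if "v \<in> set us" "w \<in> set ws" "A v w = 1" for v w
      using Cons.prems(12)[of v w] that be(2)[of v] ab(2)[of v] by (simp add: add.assoc)
    show "xs + x u + sum x (set us) + sum f (set ws) \<le> l"
      using Cons.prems(13) sm[of x] by (simp del: list.set)
    show "above ws w (\<lambda>v. P v + A u v + (\<Sum>u\<in>set us. A u v)) + e \<le> c w" if "w \<in> set ws" "0 < f w" for w
      using Cons.prems(14)[OF that] unfolding cong .
    show "nA \<le> tot + n + (\<Sum>u\<in>set us. sum (A u) (set ws))"
      using Cons.prems(15) sm[of "\<lambda>u. sum (A u) (set ws)"] unfolding n_def by (simp del: list.set)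
    show "tot + n = (\<Sum>v\<in>set ws. P v + A u v)"
      using Cons.prems(16) by (simp add: n_def sum.distrib)
  qed
  have m: "map (\<lambda>v. (x v, cu v - (tot + n + beneath us v (\<lambda>v. sum (A v) (set ws)) + e))) (filter (\<lambda>u. x u \<noteq> 0) us)
     = map (\<lambda>v. (x v, cu v - (tot + beneath (u # us) v (\<lambda>v. sum (A v) (set ws)) + e))) (filter (\<lambda>u. x u \<noteq> 0) us)"
    using be(2)[of _ "\<lambda>v. sum (A v) (set ws)"] by (intro map_cong) (auto simp: n_def add.assoc)
  have tot_n: "tot + n + (\<Sum>u\<in>set us. sum (A u) (set ws)) = tot + (\<Sum>u\<in>set (u # us). sum (A u) (set ws))"
    using sm[of "\<lambda>u. sum (A u) (set ws)"] by (simp add: n_def del: list.set)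
  show ?case
    using res be(1)[of "\<lambda>v. sum (A v) (set ws)"] unfolding m tot_n cong by (auto simp del: list.set)
qed

lemma half_eq: "half n = n div 2"
  by (induction n) auto

lemma right_entries_sound:
  "right_entries Rs nA l e r b (sL, v) g good \<Longrightarrow> (sR, w) \<in> set Rs \<Longrightarrow>
    walk sL l e r nA (good v w g) (columns sR b l) 0 r []"
  by (induction Rs) (auto split: if_splits)

lemma right_table_sound:
  assumes "right_table T d kL l e r b (sL, v) g good" "(hi, kR, es) \<in> set T" "(sR, w) \<in> set es"
    and "d \<le> hi" and nA: "nA = (kL + kR + b + r + 1 - l) div 2"
    and "nA \<le> kL" "nA \<le> kR + b" "r = 0 \<or> nA + e \<le> l"
  shows "walk sL l e r nA (good v w g) (columns sR b l) 0 r []"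
  using assms(1-4)
proof (induction T)
  case (Cons t T)
  obtain hi' kR' es' where t: "t = (hi', kR', es')" by (cases t)
  show ?case
  proof (cases "t = (hi, kR, es)")
    case True
    then have "right_group nA kL (kR + b) l e r b es (sL, v) g good"
      using Cons.prems t by (auto simp: half_eq nA split: if_splits)
    then have "right_entries es nA l e r b (sL, v) g good"
      using assms(6-8) by (auto split: if_splits nat.splits)
    then show ?thesis using right_entries_sound Cons.prems(3) by blast
  next
    case False
    then show ?thesis using Cons t by (auto split: if_splits)
  qed
qed simp

lemma loop_b_sound:
  "loop_b b' hi kL l e r lt g c good T \<Longrightarrow> b \<le> b' \<Longrightarrow>
    right_table T (Suc c - (hi + (2 * b + g))) kL l e r b lt (2 * b + g) good"
proof (induction b')
  case (Suc b')
  have eq: "b' + b' + Suc (Suc g) = 2 * Suc b' + g" by simp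
  have "right_table T (Suc c - (hi + (2 * Suc b' + g))) kL l e r (Suc b') lt (2 * Suc b' + g) good \<and>
      loop_b b' hi kL l e r lt g c good T"
    using Suc.prems(1) unfolding loop_b.simps eq by (simp split: if_splits)
  then show ?case
    using Suc by (cases "b = Suc b'") auto
qed simp

lemma loop_r_sound:
  "loop_r r' hi kL l e (sL, v) g c good T \<Longrightarrow> r \<le> r' \<Longrightarrow> b \<le> capable sL r \<Longrightarrow>
    right_table T (Suc c - (hi + (2 * b + 2 * r + g))) kL l e r b (sL, v) (2 * b + 2 * r + g) good"
proof (induction r')
  case 0
  then show ?case using loop_b_sound[of "capable sL 0" hi kL l e 0 "(sL, v)" g c good T b] by simp
next
  case (Suc r')
  show ?case
  proof (cases "r = Suc r'")
    case True
    have eq: "r' + r' + Suc (Suc g) = 2 * r + g" using True by simp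
    have "loop_b (capable sL r) hi kL l e r (sL, v) (2 * r + g) c good T"
      using Suc.prems(1) unfolding loop_r.simps eq True fst_conv by (simp split: if_splits)
    from loop_b_sound[OF this Suc.prems(3)] show ?thesis by (simp add: algebra_simps)
  next
    case False
    then show ?thesis using Suc by (simp split: if_splits)
  qed
qed

lemma left_entries_sound:
  assumes "left_entries Ls hi kL l c good T" "(sL, v) \<in> set Ls" "e \<le> 1"
  shows "loop_r l hi kL l e (sL, v) (4 * e) c good T"
proof -
  have "e = 0 \<or> e = 1" using assms(3) by auto
  with assms(1,2) show ?thesis
    by (induction Ls) (auto split: if_splits simp: eval_nat_numeral)
qed

lemma check_left: "check Ts l c good T \<Longrightarrow> (hi, kL, es) \<in> set Ts \<Longrightarrow> left_entries es hi kL l c good T"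
  by (induction Ts) (auto split: if_splits)

lemma check_sound:
  assumes "check Ts l c good T" "(hiL, kL, esL) \<in> set Ts" "(sL, v) \<in> set esL" "e \<le> 1"
    and "r \<le> l" "b \<le> capable sL r"
    and "(hiR, kR, esR) \<in> set T" "(sR, w) \<in> set esR" "c < hiL + hiR + (2 * b + 2 * r + 4 * e)"
    and "nA = (kL + kR + b + r + 1 - l) div 2" "nA \<le> kL" "nA \<le> kR + b" "r = 0 \<or> nA + e \<le> l"
  shows "walk sL l e r nA (good v w (2 * b + 2 * r + 4 * e)) (columns sR b l) 0 r []"
proof (rule right_table_sound)
  show "right_table T (Suc c - (hiL + (2 * b + 2 * r + 4 * e))) kL l e r b (sL, v) (2 * b + 2 * r + 4 * e) good"
    using loop_r_sound[OF left_entries_sound[OF check_left[OF assms(1,2)] assms(3,4)] assms(5,6)] .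
qed (use assms in auto)

section \<open>Meaning of a successful lookup\<close>

definition entries :: "table \<Rightarrow> entry set" where
  "entries T = (\<Union>(hi, k, es)\<in>set T. set es)"

lemma entriesI: "(hi, k, es) \<in> set T \<Longrightarrow> t \<in> set es \<Longrightarrow> t \<in> entries T"
  unfolding entries_def by force

lemma found_sound: "found es s k w \<Longrightarrow> \<exists>(s', v)\<in>set es. below s s' \<and> w \<le> v ! k"
  by (induction es) (auto split: if_splits)

lemma found_in_sound:
  "found_in T s k w \<Longrightarrow> \<exists>(hi, sz, es)\<in>set T. \<exists>(s', v)\<in>set es. below s s' \<and> w \<le> v ! k"
proof (induction T)
  case (Cons t T)
  obtain hi sz es where t: "t = (hi, sz, es)" by (cases t)
  show ?case
  proof (cases "w \<le> hi \<and> found es s k w")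
    case True
    then show ?thesis using t found_sound by fastforce
  next
    case False
    then have "found_in T s k w" using Cons.prems t by (auto split: if_splits)
    then show ?thesis using Cons.IH by auto
  qed
qed simp

lemma covered_sound:
  "covered ws T s k \<Longrightarrow> i < length ws \<Longrightarrow> 0 < ws ! i \<Longrightarrow>
    \<exists>(hi, sz, es)\<in>set T. \<exists>(s', v)\<in>set es. below s s' \<and> ws ! i \<le> v ! (k + i)"
proof (induction ws T s k arbitrary: i rule: covered.induct)
  case (2 ws T s k)
  then obtain j where "i = Suc j" by (cases i) auto
  then show ?case using 2 by (auto dest!: "2.IH"[of j])
next
  case (3 w ws T s k)
  show ?case
  proof (cases i)
    case 0
    then show ?thesis using 3 found_in_sound[of T s k "Suc w"] by (auto split: if_splits)
  next
    case (Suc j)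
    then show ?thesis using 3 by (auto split: if_splits)
  qed
qed simp

lemma length_add_max: "length (add_max acc a w) = min (length acc) (length w)"
  by (induction acc a w rule: add_max.induct) auto

lemma nth_add_max: "k < length acc \<Longrightarrow> k < length w \<Longrightarrow> add_max acc a w ! k = max (acc ! k) (a + w ! k)"
proof (induction acc a w arbitrary: k rule: add_max.induct)
  case (1 x xs a w ws)
  then show ?case by (cases k) (auto simp: max_def)
qed auto

lemma length_shift: "w \<noteq> [] \<Longrightarrow> length (shift w) = length w"
  by simp

lemma nth_shift:
  assumes "k < length w"
  shows "shift w ! k = w ! ((k + (length w - 1)) mod length w)"
proof (cases k)
  case 0
  then show ?thesis using assms by (auto simp: last_conv_nth)
next
  case (Suc j)
  then have "k + (length w - 1) = j + length w" using assms by linarith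
  then have "(k + (length w - 1)) mod length w = (j + length w) mod length w" by simp
  also have "\<dots> = j" using assms Suc by simp
  finally show ?thesis using assms Suc by (simp add: nth_butlast)
qed

text \<open>Modulo \<open>M\<close>, the summand \<open>i * (M - 1)\<close> stands for
  \<open>- i\<close> without leaving the natural numbers.\<close>

lemma conv_bounds:
  assumes "length acc = M" "length w = M" "k < M"
  shows "length (conv v w acc) = M" "acc ! k \<le> conv v w acc ! k"
    "i < length v \<Longrightarrow> v ! i + w ! ((k + i * (M - 1)) mod M) \<le> conv v w acc ! k"
proof -
  have "length (conv v w acc) = M \<and> acc ! k \<le> conv v w acc ! k \<and>
    (\<forall>i<length v. v ! i + w ! ((k + i * (M - 1)) mod M) \<le> conv v w acc ! k)"
    using assms
  proof (induction v arbitrary: w acc)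
    case Nil
    then show ?case by simp
  next
    case (Cons a v)
    let ?acc = "add_max acc a w"
    have len: "length ?acc = M" "length (shift w) = M"
      using Cons.prems length_shift[of w] by (auto simp: length_add_max)
    note IH = Cons.IH[OF len Cons.prems(3)]
    have acc: "?acc ! k = max (acc ! k) (a + w ! k)" using Cons.prems by (simp add: nth_add_max)
    have "(a # v) ! i + w ! ((k + i * (M - 1)) mod M) \<le> conv (a # v) w acc ! k" if "i < length (a # v)" for i
    proof (cases i)
      case 0
      then show ?thesis using IH acc Cons.prems by simp
    next
      case (Suc j)
      have "(k + j * (M - 1)) mod M < M" using Cons.prems by simp
      then have "shift w ! ((k + j * (M - 1)) mod M) = w ! (((k + j * (M - 1)) mod M + (M - 1)) mod M)"
        using nth_shift[of _ w] Cons.prems by simp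
      also have "((k + j * (M - 1)) mod M + (M - 1)) mod M = (k + j * (M - 1) + (M - 1)) mod M"
        by (rule mod_add_left_eq)
      also have "k + j * (M - 1) + (M - 1) = k + i * (M - 1)" by (simp add: Suc)
      finally have eq: "shift w ! ((k + j * (M - 1)) mod M) = w ! ((k + i * (M - 1)) mod M)" .
      have "v ! j + shift w ! ((k + j * (M - 1)) mod M) \<le> conv (a # v) w acc ! k"
        using IH that Suc by (simp del: shift.simps One_nat_def)
      then show ?thesis unfolding eq by (simp only: Suc nth_Cons_Suc)
    qed
    then show ?case using IH acc by auto
  qed
  then show "length (conv v w acc) = M" "acc ! k \<le> conv v w acc ! k"
    "i < length v \<Longrightarrow> v ! i + w ! ((k + i * (M - 1)) mod M) \<le> conv v w acc ! k" by auto
qed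

lemma zeros_eq: "zeros xs = replicate (length xs) 0"
  by (induction xs) auto

lemma excess_eq: "excess ws g c = map (\<lambda>w. w + g - c) ws"
  by (induction ws) auto

text \<open>The strict inequality makes the truncated difference in \<open>excess\<close> positive
  and exact at the residue in question, so \<open>covered\<close> must supply an entry
  there.\<close>

lemma accept_sound:
  assumes "accept T c v w g s" "length v = M" "length w = M" "c < v ! (i mod M) + w ! (j mod M) + g" "0 < M"
  shows "\<exists>s' u. (s', u) \<in> entries T \<and> below s s' \<and>
    v ! (i mod M) + w ! (j mod M) + g \<le> c + u ! ((i + j + 1) mod M)"
proof -
  let ?k = "(i + j + 1) mod M"
  let ?i = "i mod M"
  have len: "length (zeros w) = M" "length (shift w) = M" "?k < M" using assms by (auto simp: zeros_eq)
  note cb = conv_bounds[OF len, where v = v]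
  have M: "Suc (M - 1) = M" using assms(5) by simp
  have "(?k + ?i * (M - 1)) mod M < M" using assms(5) by simp
  then have "shift w ! ((?k + ?i * (M - 1)) mod M) = w ! (((?k + ?i * (M - 1)) mod M + (M - 1)) mod M)"
    using nth_shift[of _ w] assms(3) by simp
  also have "((?k + ?i * (M - 1)) mod M + (M - 1)) mod M = (i + j + 1 + i * (M - 1) + (M - 1)) mod M"
    by (metis mod_add_left_eq mod_add_right_eq mod_mult_left_eq)
  also have "i + j + 1 + i * (M - 1) + (M - 1) = j + Suc i * Suc (M - 1)"
    using assms(5) by (cases M) simp_all
  also have "\<dots> mod M = j mod M" unfolding M by (rule mod_mult_self1)
  finally have conv: "v ! ?i + w ! (j mod M) \<le> conv v (shift w) (zeros w) ! ?k"
    using cb(3)[of ?i] assms(2,5) by simp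
  let ?ws = "excess (conv v (shift w) (zeros w)) g c"
  have "?k < length ?ws" "?ws ! ?k = conv v (shift w) (zeros w) ! ?k + g - c"
    using cb(1) len by (auto simp: excess_eq)
  then have "0 < ?ws ! ?k" using conv assms(4) by linarith
  from covered_sound[OF assms(1)[unfolded accept_def] \<open>?k < length ?ws\<close> this]
  obtain hi k es s' u where "(hi, k, es) \<in> set T" "(s', u) \<in> set es"
    and u: "below s s'" "?ws ! ?k \<le> u ! ?k" by auto
  then have "(s', u) \<in> entries T" by (blast intro: entriesI)
  moreover have "v ! ?i + w ! (j mod M) + g \<le> c + u ! ?k"
    using u conv \<open>?ws ! ?k = _\<close> by linarith
  ultimately show ?thesis using u by blast
qed

section \<open>Comparing and encoding states\<close>

lemma below_map:
  assumes "below (map (\<lambda>u. (k u, c u)) us) s'" "distinct us"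
  shows "\<exists>c'. s' = map (\<lambda>u. (k u, c' u)) us \<and> (\<forall>u\<in>set us. c u \<le> c' u)"
  using assms
proof (induction us arbitrary: s')
  case Nil
  then show ?case by (cases s') auto
next
  case (Cons u us)
  then obtain k' d s'' where s': "s' = (k', d) # s''" by (cases s') auto
  then have d: "k' = k u" "c u \<le> d" "below (map (\<lambda>u. (k u, c u)) us) s''"
    using Cons.prems by (auto split: if_splits)
  with Cons obtain c' where c': "s'' = map (\<lambda>u. (k u, c' u)) us" "\<forall>u\<in>set us. c u \<le> c' u" by auto
  have "s' = map (\<lambda>v. (k v, (c'(u := d)) v)) (u # us)" using s' d c' Cons.prems(2) by auto
  then show ?case using d c' Cons.prems(2) by (intro exI[of _ "c'(u := d)"]) auto
qed

lemma below_refl: "below s s"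
  by (induction s) auto

lemma below_append: "below s s' \<Longrightarrow> below t t' \<Longrightarrow> below (s @ t) (s' @ t')"
  by (induction s s' rule: below.induct) (auto split: if_splits)

lemma below_trans: "below s s' \<Longrightarrow> below s' s'' \<Longrightarrow> below s s''"
proof (induction s s' arbitrary: s'' rule: below.induct)
  case (4 k c s k' c' s')
  then show ?case by (cases "(((k', c') # s'), s'')" rule: below.cases) (auto split: if_splits)
qed auto

lemma below_mapI: "(\<And>u. u \<in> set us \<Longrightarrow> c u \<le> c' u) \<Longrightarrow> below (map (\<lambda>u. (k u, c u)) us) (map (\<lambda>u. (k u, c' u)) us)"
  by (induction us) auto

lemma below_rev: "below s s' \<Longrightarrow> below (rev s) (rev s')"
  by (induction s s' rule: below.induct) (auto split: if_splits intro!: below_append)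

lemma columns_map:
  "b0 \<notin> set ws \<Longrightarrow> columns (map (\<lambda>w. (k w, c w)) ws) b l =
    map (\<lambda>w. (0, None, (k(b0 := b)) w, (c(b0 := l)) w)) (ws @ [b0])"
  by (induction ws) auto

lemma capable_bound:
  assumes "sorted_wrt (<) (us :: int list)" "\<And>u. u \<in> set us \<Longrightarrow> a u \<le> (1::nat)"
    "\<And>u. u \<in> set us \<Longrightarrow> a u = 1 \<Longrightarrow> r \<le> c u"
  shows "sum a (set us) \<le> capable (map (\<lambda>u. (k u, c u)) us) r"
  using assms
proof (induction us)
  case (Cons u us)
  have "sum a (set us) \<le> capable (map (\<lambda>u. (k u, c u)) us) r" using Cons by simp
  moreover have "a u = 0 \<or> a u = 1" using Cons.prems(2)[of u] by force
  ultimately show ?case using Cons.prems(3)[OF list.set_intros(1)] sum_Cons[OF Cons.prems(1), of a]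
    by (auto simp del: list.set)
qed simp

lemma sum_list_filter:
  "sorted_wrt (<) (us :: int list) \<Longrightarrow> sum_list (map x (filter (\<lambda>u. x u \<noteq> (0::nat)) us)) = sum x (set us)"
proof (induction us)
  case (Cons u us)
  then show ?case using sum_Cons[OF Cons.prems, of x] by (auto simp del: list.set)
qed simp

text \<open>Table values are natural numbers, so the entries required by \<open>default\<close>
  bound every state with potential at most \<open>K\<close>. Reversal is needed when a chord is
  treated in the mirror image, and \<open>side\<close> starts the induction with the part behind a
  single side.\<close>

locale potential_table =
  fixes l M c :: nat and C K :: int and T :: table
  assumes c: "int c = C - K" and M: "0 < M"
    and check: "check T l c (accept T c) T"
    and wf: "\<And>hi k es s v. (hi, k, es) \<in> set T \<Longrightarrow> (s, v) \<in> set es \<Longrightarrow>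
      k = stubs s \<and> length v = M \<and> (\<forall>x\<in>set v. x \<le> hi)"
    and default: "\<And>ks. \<forall>k\<in>set ks. 0 < k \<Longrightarrow> sum_list ks \<le> l \<Longrightarrow> map (\<lambda>k. (k, l)) ks \<in> fst ` entries T"
    and rev_closed: "\<And>s v. (s, v) \<in> entries T \<Longrightarrow> (rev s, v) \<in> entries T"
    and side: "\<exists>v. ([], v) \<in> entries T \<and> 0 \<le> K + int (v ! 0)"
begin

definition bounded :: "state \<Rightarrow> nat \<Rightarrow> int \<Rightarrow> bool" where
  "bounded s m V \<longleftrightarrow> (\<exists>(s', v)\<in>entries T. below s s' \<and> V \<le> K + int (v ! (m mod M)))"

lemma bounded_default:
  assumes "V \<le> K" "\<forall>(k, d)\<in>set s. 0 < k \<and> d \<le> l" "sum_list (map fst s) \<le> l"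
  shows "bounded s m V"
proof -
  have "map (\<lambda>k. (k, l)) (map fst s) \<in> fst ` entries T" using assms by (intro default) auto
  then obtain v where v: "(map (\<lambda>k. (k, l)) (map fst s), v) \<in> entries T" by auto
  have "below s (map (\<lambda>k. (k, l)) (map fst s))" using assms(2) by (induction s) auto
  then show ?thesis using v assms(1) unfolding bounded_def by force
qed

lemma bounded_rev: "bounded s m V \<Longrightarrow> bounded (rev s) m V"
  unfolding bounded_def using rev_closed below_rev by fast

lemma bounded_side: "bounded [] 0 0"
  using side unfolding bounded_def by force

text \<open>One gluing step freed from geometry. \<open>us\<close> and \<open>ws\<close> are the
  vertices of the two parts that have leaving edges, \<open>b0\<close> is the far end,
  \<open>A\<close> the joining edges, \<open>r\<close> the number of edges leaving from the shared
  vertex and \<open>e\<close> that of base edges. The shared vertex becomes an inner one and costs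
  \<open>C\<close>.\<close>

lemma combine:
  fixes A :: "int \<Rightarrow> int \<Rightarrow> nat"
  assumes us: "sorted_wrt (<) us" and ws: "sorted_wrt (<) (ws @ [b0])" and f0: "f b0 = 0" and e: "e \<le> 1"
    and L: "bounded (map (\<lambda>u. (kU u, cU u)) us) m VL" and R: "bounded (map (\<lambda>w. (kW w, cW w)) ws) m' VR"
    and A: "\<And>u w. u \<in> set us \<Longrightarrow> w \<in> set (ws @ [b0]) \<Longrightarrow> A u w \<le> 1"
    and kU: "\<And>u. u \<in> set us \<Longrightarrow> 0 < kU u \<and> kU u = x u + sum (A u) (set (ws @ [b0]))"
    and kW: "\<And>w. w \<in> set ws \<Longrightarrow> kW w = f w + (\<Sum>u\<in>set us. A u w)"
    and caps: "\<And>u. u \<in> set us \<Longrightarrow> cU u \<le> l" "\<And>w. w \<in> set ws \<Longrightarrow> cW w \<le> l" "cW b0 = l"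
    and x: "\<And>u. u \<in> set us \<Longrightarrow> 0 < x u \<Longrightarrow> beneath us u (\<lambda>v. sum (A v) (set (ws @ [b0]))) + e \<le> cU u"
    and r: "r = 0 \<or> (\<Sum>u\<in>set us. sum (A u) (set (ws @ [b0]))) + e \<le> l"
    and cross: "\<And>u w. u \<in> set us \<Longrightarrow> w \<in> set (ws @ [b0]) \<Longrightarrow> A u w = 1 \<Longrightarrow>
       l + r + beneath (ws @ [b0]) w (\<lambda>v. beneath us u (\<lambda>u'. A u' v)) +
       above us u (\<lambda>u'. x u' + above (ws @ [b0]) w (A u')) + beneath (ws @ [b0]) w f \<le> cU u + cW w"
    and t: "r + sum x (set us) + sum f (set ws) \<le> l"
    and f: "\<And>w. w \<in> set ws \<Longrightarrow> 0 < f w \<Longrightarrow> above (ws @ [b0]) w (\<lambda>v. \<Sum>u\<in>set us. A u v) + e \<le> cW w"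
  shows "bounded (
      map (\<lambda>u. (x u, cU u - (beneath us u (\<lambda>v. sum (A v) (set (ws @ [b0]))) + e))) (filter (\<lambda>u. x u \<noteq> 0) us) @
      (if r = 0 then [] else [(r, l - ((\<Sum>u\<in>set us. sum (A u) (set (ws @ [b0]))) + e))]) @
      map (\<lambda>w. (f w, cW w - (above (ws @ [b0]) w (\<lambda>v. \<Sum>u\<in>set us. A u v) + e))) (filter (\<lambda>w. f w \<noteq> 0) ws))
    (m + m' + 1) (VL + VR + int (2 * (\<Sum>u\<in>set us. A u b0) + 2 * r + 4 * e) - C)"
    (is "bounded ?s _ ?V")
proof -
  let ?ws = "ws @ [b0]"
  define b where "b = (\<Sum>u\<in>set us. A u b0)"
  define N where "N = (\<Sum>u\<in>set us. sum (A u) (set ?ws))"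
  let ?g = "2 * b + 2 * r + 4 * e"
  have dist: "distinct us" "distinct ws" "b0 \<notin> set ws" "sorted_wrt (<) ws"
    using us ws strict_sorted_iff sorted_wrt_append[of "(<)" ws "[b0]"] by (auto simp: strict_sorted_iff)
  obtain sL v where sL: "(sL, v) \<in> entries T" "below (map (\<lambda>u. (kU u, cU u)) us) sL" "VL \<le> K + int (v ! (m mod M))"
    using L unfolding bounded_def by auto
  obtain sR w where sR: "(sR, w) \<in> entries T" "below (map (\<lambda>w. (kW w, cW w)) ws) sR" "VR \<le> K + int (w ! (m' mod M))"
    using R unfolding bounded_def by auto
  obtain hiL kL esL where eL: "(hiL, kL, esL) \<in> set T" "(sL, v) \<in> set esL"
    using sL(1) unfolding entries_def by auto
  obtain hiR kR esR where eR: "(hiR, kR, esR) \<in> set T" "(sR, w) \<in> set esR"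
    using sR(1) unfolding entries_def by auto
  note wfL = wf[OF eL] and wfR = wf[OF eR]
  obtain cU' where cU': "sL = map (\<lambda>u. (kU u, cU' u)) us" "\<And>u. u \<in> set us \<Longrightarrow> cU u \<le> cU' u"
    using below_map[OF sL(2) dist(1)] by auto
  obtain cW1 where cW1: "sR = map (\<lambda>w. (kW w, cW1 w)) ws" "\<And>w. w \<in> set ws \<Longrightarrow> cW w \<le> cW1 w"
    using below_map[OF sR(2) dist(2)] by auto
  define cW' where "cW' = cW1(b0 := l)"
  have cW': "cW w \<le> cW' w" if "w \<in> set ?ws" for w
    using that cW1(2) caps(3) by (auto simp: cW'_def)
  show ?thesis
  \<comment> \<open>Up to this threshold the glued potential does not exceed the floor, and the
    default entries apply to whatever state results.\<close>
  proof (cases "v ! (m mod M) + w ! (m' mod M) + ?g \<le> c")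
    case True
    then have "?V \<le> K" using sL(3) sR(3) c unfolding b_def by linarith
    moreover have "\<forall>(k, d)\<in>set ?s. 0 < k \<and> d \<le> l" using caps by (auto intro: le_trans[OF diff_le_self])
    moreover have "sum_list (map fst ?s) \<le> l"
      using t sum_list_filter[OF us, of x] sum_list_filter[OF dist(4), of f] by (simp add: comp_def)
    ultimately show ?thesis by (rule bounded_default)
  next
    case False
    have "v ! (m mod M) \<le> hiL" "w ! (m' mod M) \<le> hiR" using wfL wfR M by auto
    then have big: "c < hiL + hiR + ?g" using False by linarith
    have kL: "kL = sum x (set us) + N"
      using wfL cU'(1) stubs_map[OF us, of kU cU'] kU by (simp add: N_def sum.distrib cong: sum.cong)
    have "(\<Sum>w\<in>set ?ws. \<Sum>u\<in>set us. A u w) = N" unfolding N_def by (rule sum.swap)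
    moreover have "(\<Sum>w\<in>set ?ws. \<Sum>u\<in>set us. A u w) = b + (\<Sum>w\<in>set ws. \<Sum>u\<in>set us. A u w)"
      using dist(3) by (simp add: b_def)
    ultimately have kR: "kR + b = sum f (set ws) + N"
      using wfR cW1(1) stubs_map[OF dist(4), of kW cW1] kW by (simp add: sum.distrib cong: sum.cong)
    define nA where "nA = (kL + kR + b + r + 1 - l) div 2"
    \<comment> \<open>Every joining edge uses one end in each part, so all ends together number
      \<open>2 * N\<close> plus the leaving edges, of which there are at most
      \<open>l\<close>.\<close>
    have nA: "nA \<le> N" using kL kR t unfolding nA_def by linarith
    have "b \<le> capable sL r"
      unfolding b_def cU'(1)
    proof (rule capable_bound[OF us])
      show "r \<le> cU' u" if "u \<in> set us" "A u b0 = 1" for u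
        using cross[of u b0] that caps(3) cU'(2)[of u] by simp
    qed (use A in auto)
    then have walk: "walk sL l e r nA (accept T c v w ?g) (columns sR b l) 0 r []"
      using check_sound[OF check eL e _ _ eR big nA_def] nA kL kR t r unfolding N_def[symmetric] by auto
    have cols: "columns sR b l = map (\<lambda>w. (0, None, (kW(b0 := b)) w, cW' w)) ?ws"
      unfolding cW1(1) cW'_def by (rule columns_map[OF dist(3)])
    have acc: "accept T c v w ?g (rev [] @
      map (\<lambda>u. (x u, cU' u - (0 + beneath us u (\<lambda>v. sum (A v) (set ?ws)) + e))) (filter (\<lambda>u. x u \<noteq> 0) us) @
      (if r = 0 then [] else [(r, l - (0 + (\<Sum>u\<in>set us. sum (A u) (set ?ws)) + e))]) @
      map (\<lambda>w. (f w, cW' w - (above ?ws w (\<lambda>v. 0 + (\<Sum>u\<in>set us. A u v)) + e))) (filter (\<lambda>w. f w \<noteq> 0) ?ws))"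
    proof (rule walk_sound[where k = kU and P = "\<lambda>_. 0" and B = "\<lambda>_. None" and q = "kW(b0 := b)"])
      show "walk (map (\<lambda>u. (kU u, cU' u)) us) l e r nA (accept T c v w ?g)
        (map (\<lambda>w. (0, None, (kW(b0 := b)) w, cW' w)) ?ws) 0 r []"
        using walk unfolding cU'(1) cols .
      show "(kW(b0 := b)) w = f w + (\<Sum>u\<in>set us. A u w)" if "w \<in> set ?ws" for w
        using that kW f0 by (auto simp: b_def)
      show "0 + beneath us u (\<lambda>v. sum (A v) (set ?ws)) + e \<le> cU' u" if "u \<in> set us" "0 < x u" for u
        using x[OF that] cU'(2)[OF that(1)] by simp
      show "l + r + beneath ?ws w (\<lambda>v. 0 + beneath us u (\<lambda>u'. A u' v)) +
         above us u (\<lambda>u'. x u' + above ?ws w (A u')) + beneath ?ws w f \<le> cU' u + cW' w"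
        if "u \<in> set us" "w \<in> set ?ws" "A u w = 1" for u w
        using cross[OF that] cU'(2)[OF that(1)] cW'[OF that(2)] by simp
      show "r + sum x (set us) + sum f (set ?ws) \<le> l"
        using t f0 dist(3) by simp
      show "0 < kU u \<and> kU u = x u + sum (A u) (set ?ws)" if "u \<in> set us" for u
        using kU[OF that] .
      show "above ?ws w (\<lambda>v. 0 + (\<Sum>u\<in>set us. A u v)) + e \<le> cW' w" if "w \<in> set ?ws" "0 < f w" for w
        using f[of w] cW'[of w] that f0 by auto
    qed (use us ws f0 A kU r nA in \<open>auto simp: N_def\<close>)
    have "filter (\<lambda>w. f w \<noteq> 0) ?ws = filter (\<lambda>w. f w \<noteq> 0) ws" using f0 by simp
    with acc have acc': "accept T c v w ?g (
      map (\<lambda>u. (x u, cU' u - (beneath us u (\<lambda>v. sum (A v) (set ?ws)) + e))) (filter (\<lambda>u. x u \<noteq> 0) us) @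
      (if r = 0 then [] else [(r, l - ((\<Sum>u\<in>set us. sum (A u) (set ?ws)) + e))]) @
      map (\<lambda>w. (f w, cW' w - (above ?ws w (\<lambda>v. \<Sum>u\<in>set us. A u v) + e))) (filter (\<lambda>w. f w \<noteq> 0) ws))"
      (is "accept T c v w ?g ?s'") by (simp only: rev.simps append_Nil add_0)
    have "below ?s ?s'"
      by (intro below_append below_mapI below_refl diff_le_mono) (use cU' cW' in auto)
    moreover obtain s'' u where u: "(s'', u) \<in> entries T" "below ?s' s''"
      "v ! (m mod M) + w ! (m' mod M) + ?g \<le> c + u ! ((m + m' + 1) mod M)"
      using accept_sound[OF acc', of M m m'] wfL wfR False M by auto
    moreover have "?V \<le> K + int (u ! ((m + m' + 1) mod M))"
      using u(3) sL(3) sR(3) c unfolding b_def by linarith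
    ultimately show ?thesis unfolding bounded_def using below_trans by blast
  qed
qed

end

section \<open>Edges of a convex polygon as periodic darts\<close>

text \<open>
  Vertices are integers, where \<open>i\<close> and \<open>i + N\<close> are the same vertex; an edge is represented by all
  darts \<open>(i, j)\<close>, \<open>(j, i + N)\<close>, \<dots> with its endpoints in this order. For the part on the vertices
  between \<open>a\<close> and \<open>b\<close>, \<open>St a b\<close> consists of the edges leaving it across the chord, \<open>In a b\<close> of the
  edges inside, and \<open>inc a b u\<close> counts the inner edges that every leaving edge at \<open>u\<close> crosses.
\<close>

locale convex_graph =
  fixes l :: nat and N :: int and E :: "(int \<times> int) set"
  assumes dart: "(i, j) \<in> E \<Longrightarrow> i + 2 \<le> j \<and> j < i + N"
    and rotate: "(i, j) \<in> E \<longleftrightarrow> (j, i + N) \<in> E"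
    and crossings: "(i, j) \<in> E \<Longrightarrow> card {(u, t) \<in> E. i < u \<and> u < j \<and> j < t \<and> t < i + N} \<le> l"
begin

definition St :: "int \<Rightarrow> int \<Rightarrow> (int \<times> int) set" where
  "St a b = {(u, t) \<in> E. a < u \<and> u < b \<and> b < t \<and> t < a + N}"

definition In :: "int \<Rightarrow> int \<Rightarrow> (int \<times> int) set" where
  "In a b = {(i, j) \<in> E. a \<le> i \<and> j \<le> b}"

definition deg :: "int \<Rightarrow> int \<Rightarrow> int \<Rightarrow> nat" where
  "deg a b u = card {t. (u, t) \<in> E \<and> b < t \<and> t < a + N}"

definition inc :: "int \<Rightarrow> int \<Rightarrow> int \<Rightarrow> nat" where
  "inc a b u = card {(i, j) \<in> E. a \<le> i \<and> i < u \<and> u < j \<and> j \<le> b}"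

definition verts :: "int \<Rightarrow> int \<Rightarrow> int list" where
  "verts a b = filter (\<lambda>u. deg a b u \<noteq> 0) [a + 1..b - 1]"

definition state :: "int \<Rightarrow> int \<Rightarrow> state" where
  "state a b = map (\<lambda>u. (deg a b u, l - inc a b u)) (verts a b)"

definition val :: "int \<Rightarrow> int \<Rightarrow> int \<Rightarrow> int" where
  "val C a b = 4 * int (card (In a b)) + 2 * int (card (St a b)) - C * (b - a - 1)"

text \<open>Each edge crossing \<open>(i, j)\<close> has exactly one dart that starts between
  \<open>i\<close> and \<open>j\<close> and ends beyond \<open>j\<close> within the period, so
  crossings of an edge are counted once.\<close>

lemma card_St_edge: "(i, j) \<in> E \<Longrightarrow> card (St i j) \<le> l"
  using crossings by (simp add: St_def)

lemma finite_darts: "finite {(u, t) \<in> E. a \<le> u \<and> u \<le> b \<and> P u t}"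
proof -
  have "{(u, t) \<in> E. a \<le> u \<and> u \<le> b \<and> P u t} \<subseteq> {a..b} \<times> {a..b + N}"
    using dart by force
  then show ?thesis by (rule finite_subset) simp
qed

lemma finite_St [simp]: "finite (St a b)"
  by (rule finite_subset[OF _ finite_darts[of a b "\<lambda>_ _. True"]]) (auto simp: St_def)

lemma finite_In [simp]: "finite (In a b)"
  by (rule finite_subset[OF _ finite_darts[of a b "\<lambda>_ _. True"]]) (use dart in \<open>force simp: In_def\<close>)

lemma finite_targets [simp]: "finite {t. (u, t) \<in> E \<and> P t}"
  by (rule finite_subset[of _ "{u..u + N}"]) (use dart in force)+

lemma finite_inner [simp]: "finite {(i, j) \<in> E. a \<le> i \<and> i < u \<and> P i j}"
  by (rule finite_subset[OF _ finite_darts[of a u "\<lambda>_ _. True"]]) auto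

lemma period: "(i, j) \<in> E \<longleftrightarrow> (i + N, j + N) \<in> E"
  using rotate by blast

lemma reverse_dart: "(w, u + N) \<in> E \<longleftrightarrow> (u, w) \<in> E"
  using rotate by blast

lemma deg_pos: "deg a b u \<noteq> 0 \<longleftrightarrow> (\<exists>t. (u, t) \<in> E \<and> b < t \<and> t < a + N)"
  by (auto simp: deg_def)

lemma set_verts: "set (verts a b) = {u. a < u \<and> u < b \<and> deg a b u \<noteq> 0}"
  by (auto simp: verts_def)

lemma sorted_verts: "sorted_wrt (<) (verts a b)"
  unfolding verts_def by (intro sorted_wrt_filter) (simp add: sorted_wrt_upto)

lemma card_darts:
  assumes "finite U" "\<And>u t. P u t \<Longrightarrow> (u, t) \<in> E \<Longrightarrow> u \<in> U"
  shows "card {(u, t) \<in> E. P u t} = (\<Sum>u\<in>U. card {t. (u, t) \<in> E \<and> P u t})"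
proof -
  have "{(u, t) \<in> E. P u t} = (SIGMA u:U. {t. (u, t) \<in> E \<and> P u t})" using assms(2) by auto
  then show ?thesis using assms(1) by (simp add: card_SigmaI)
qed

lemma card_St: "card (St a b) = (\<Sum>u\<in>{a<..<b}. deg a b u)"
proof -
  have "card (St a b) = (\<Sum>u\<in>{a<..<b}. card {t. (u, t) \<in> E \<and> (a < u \<and> u < b \<and> b < t \<and> t < a + N)})"
    unfolding St_def by (rule card_darts) auto
  also have "\<dots> = (\<Sum>u\<in>{a<..<b}. deg a b u)"
    unfolding deg_def by (intro sum.cong refl arg_cong[where f = card]) auto
  finally show ?thesis .
qed

text \<open>The inner edges passing over \<open>u\<close> all cross the edge \<open>(u, t)\<close>;
  turning their darts around injects them into its set of crossings.\<close>

lemma inc_le: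
  assumes "(u, t) \<in> St a b"
  shows "inc a b u \<le> l"
proof -
  have "inj_on (\<lambda>(i, j). (j, i + N)) {(i, j) \<in> E. a \<le> i \<and> i < u \<and> u < j \<and> j \<le> b}"
    by (auto simp: inj_on_def)
  moreover have "(\<lambda>(i, j). (j, i + N)) ` {(i, j) \<in> E. a \<le> i \<and> i < u \<and> u < j \<and> j \<le> b} \<subseteq> St u t"
    using assms by (auto simp: St_def reverse_dart)
  ultimately have "inc a b u \<le> card (St u t)"
    unfolding inc_def by (intro card_inj_on_le) auto
  then show ?thesis using card_St_edge[of u t] assms by (auto simp: St_def)
qed

end

text \<open>
  The part behind the chord \<open>a b\<close> is glued from those behind \<open>a c\<close> and \<open>c b\<close>. Mirroring the polygon
  justifies the assumption on \<open>a\<close>.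
\<close>

locale split_chord = convex_graph +
  fixes a c b :: int
  assumes ac: "a < c" and cb: "c < b" and ba: "b < a + N"
    and no_a: "\<And>w. c < w \<Longrightarrow> w < b \<Longrightarrow> (a, w) \<notin> E"
begin

section \<open>Counting identities for one gluing\<close>

definition A :: "int \<Rightarrow> int \<Rightarrow> nat" where
  "A u w = of_bool ((u, w) \<in> E)"

definition us :: "int list" where "us = verts a c"
definition ws :: "int list" where "ws = verts c b"
definition e :: nat where "e = of_bool ((a, b) \<in> E)"
text \<open>Edges from \<open>b\<close> do not leave across a chord that ends at \<open>b\<close>;
  hence the value 0 there, whatever \<open>deg\<close> says.\<close>

definition f :: "int \<Rightarrow> nat" where "f w = (if w = b then 0 else deg a b w)"

definition mass :: "(int \<Rightarrow> bool) \<Rightarrow> (int \<Rightarrow> bool) \<Rightarrow> nat" where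
  "mass Q R = card {(u, w) \<in> E. a < u \<and> u < c \<and> Q u \<and> c < w \<and> w \<le> b \<and> R w}"

lemma sorted_ws_b: "sorted_wrt (<) (ws @ [b])"
  using sorted_verts[of c b] set_verts[of c b] by (auto simp: ws_def sorted_wrt_append)

lemma in_us: "(u, t) \<in> E \<Longrightarrow> a < u \<Longrightarrow> u < c \<Longrightarrow> c < t \<Longrightarrow> t < a + N \<Longrightarrow> u \<in> set us"
  unfolding us_def set_verts mem_Collect_eq deg_pos by blast

lemma in_ws: "(w, t) \<in> E \<Longrightarrow> c < w \<Longrightarrow> w < b \<Longrightarrow> b < t \<Longrightarrow> t < c + N \<Longrightarrow> w \<in> set ws"
  unfolding ws_def set_verts mem_Collect_eq deg_pos by blast

lemma cross_in_lists:
  assumes "(u, w) \<in> E" "a < u" "u < c" "c < w" "w \<le> b"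
  shows "u \<in> set us" "w \<in> set (ws @ [b])"
proof -
  show "u \<in> set us" using assms ba in_us[of u w] by auto
  show "w \<in> set (ws @ [b])"
    using assms ba in_ws[of w "u + N"] by (cases "w = b") (auto simp: reverse_dart)
qed

lemma card_eq_sum_of_bool: "finite Z \<Longrightarrow> (\<Sum>p\<in>Z. of_bool (P p)) = card {p\<in>Z. P p}"
  by (simp add: of_bool_def sum.If_cases Int_def)

lemma mass_eq:
  "(\<Sum>u\<in>{u\<in>set us. Q u}. \<Sum>w\<in>{w\<in>set (ws @ [b]). R w}. A u w) = mass Q R"
proof -
  let ?X = "{u\<in>set us. Q u}" and ?Y = "{w\<in>set (ws @ [b]). R w}"
  have "(\<Sum>u\<in>?X. \<Sum>w\<in>?Y. A u w) = (\<Sum>p\<in>?X \<times> ?Y. of_bool (p \<in> E))"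
    unfolding A_def sum.cartesian_product by (intro sum.cong) auto
  also have "\<dots> = card {p \<in> ?X \<times> ?Y. p \<in> E}"
    by (rule card_eq_sum_of_bool) simp
  also have "{p \<in> ?X \<times> ?Y. p \<in> E} = {(u, w) \<in> E. a < u \<and> u < c \<and> Q u \<and> c < w \<and> w \<le> b \<and> R w}"
  proof (intro equalityI subsetI)
    fix p assume "p \<in> {p \<in> ?X \<times> ?Y. p \<in> E}"
    then show "p \<in> {(u, w) \<in> E. a < u \<and> u < c \<and> Q u \<and> c < w \<and> w \<le> b \<and> R w}"
      using cb by (auto simp: us_def ws_def set_verts)
  next
    fix p assume "p \<in> {(u, w) \<in> E. a < u \<and> u < c \<and> Q u \<and> c < w \<and> w \<le> b \<and> R w}"
    then show "p \<in> {p \<in> ?X \<times> ?Y. p \<in> E}" using cross_in_lists by auto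
  qed
  finally show ?thesis by (simp add: mass_def)
qed

lemma row: "(\<Sum>w\<in>{w\<in>set (ws @ [b]). R w}. A u w) = card {w. (u, w) \<in> E \<and> c < w \<and> w \<le> b \<and> R w}"
  if "a < u" "u < c"
proof -
  have "(\<Sum>w\<in>{w\<in>set (ws @ [b]). R w}. A u w) = card ({w\<in>set (ws @ [b]). R w} \<inter> {w. (u, w) \<in> E})"
    by (simp add: A_def of_bool_def sum.If_cases)
  also have "{w\<in>set (ws @ [b]). R w} \<inter> {w. (u, w) \<in> E} = {w. (u, w) \<in> E \<and> c < w \<and> w \<le> b \<and> R w}"
    using cross_in_lists(2) that cb by (auto simp: ws_def set_verts)
  finally show ?thesis .
qed

lemma column: "(\<Sum>u\<in>{u\<in>set us. Q u}. A u w) = card {u. (u, w) \<in> E \<and> a < u \<and> u < c \<and> Q u}"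
  if "c < w" "w \<le> b"
proof -
  have "(\<Sum>u\<in>{u\<in>set us. Q u}. A u w) = card ({u\<in>set us. Q u} \<inter> {u. (u, w) \<in> E})"
    by (simp add: A_def of_bool_def sum.If_cases)
  also have "{u\<in>set us. Q u} \<inter> {u. (u, w) \<in> E} = {u. (u, w) \<in> E \<and> a < u \<and> u < c \<and> Q u}"
    using cross_in_lists(1) that by (auto simp: us_def set_verts)
  finally show ?thesis .
qed

lemma row_all: "a < u \<Longrightarrow> u < c \<Longrightarrow> sum (A u) (set (ws @ [b])) = card {w. (u, w) \<in> E \<and> c < w \<and> w \<le> b}"
  using row[where R = "\<lambda>_. True"] by (simp only: simp_thms Collect_mem_eq)

lemma column_all: "c < w \<Longrightarrow> w \<le> b \<Longrightarrow> (\<Sum>u\<in>set us. A u w) = card {u. (u, w) \<in> E \<and> a < u \<and> u < c}"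
  using column[where Q = "\<lambda>_. True"] by (simp only: simp_thms Collect_mem_eq)

lemma deg_left: "a < u \<Longrightarrow> u < c \<Longrightarrow> deg a c u = deg a b u + sum (A u) (set (ws @ [b]))"
proof -
  assume u: "a < u" "u < c"
  let ?X = "{t. (u, t) \<in> E \<and> b < t \<and> t < a + N}" and ?Y = "{t. (u, t) \<in> E \<and> c < t \<and> t \<le> b}"
  have "{t. (u, t) \<in> E \<and> c < t \<and> t < a + N} = ?X \<union> ?Y" using cb ba by auto
  moreover have "card (?X \<union> ?Y) = card ?X + card ?Y"
    by (rule card_Un_disjoint) (auto simp: disjoint_iff)
  ultimately have "deg a c u = deg a b u + card ?Y" by (simp add: deg_def)
  then show ?thesis using row_all[OF u] by (simp only:)
qed

text \<open>Seen from the right part, joining edges are darts that end in the next period, between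
  \<open>a + N\<close> and \<open>c + N\<close>. The end \<open>a + N\<close> itself is excluded by
  \<open>no_a\<close>.\<close>

lemma deg_right: "c < w \<Longrightarrow> w < b \<Longrightarrow> deg c b w = f w + (\<Sum>u\<in>set us. A u w)"
proof -
  assume w: "c < w" "w < b"
  have "{t. (w, t) \<in> E \<and> b < t \<and> t < c + N} =
     {t. (w, t) \<in> E \<and> b < t \<and> t < a + N} \<union> (\<lambda>u. u + N) ` {u. (u, w) \<in> E \<and> a < u \<and> u < c}" (is "?L = ?R1 \<union> ?R2")
  proof (intro equalityI subsetI)
    fix t assume t: "t \<in> ?L"
    show "t \<in> ?R1 \<union> ?R2"
    proof (cases "t < a + N")
      case False
      have "(t - N, w) \<in> E" using t reverse_dart[of w "t - N"] by simp
      moreover from this have "t - N \<noteq> a" using no_a w by auto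
      ultimately have "t - N \<in> {u. (u, w) \<in> E \<and> a < u \<and> u < c}" using t False by auto
      then show ?thesis by (metis (no_types, lifting) UnI2 diff_add_cancel image_eqI)
    qed (use t in auto)
  qed (use ac ba in \<open>auto simp: reverse_dart\<close>)
  moreover have "card (?R1 \<union> ?R2) = card ?R1 + card ?R2"
  proof (rule card_Un_disjoint)
    show "finite ?R2" by (rule finite_imageI, rule finite_subset[of _ "{a..c}"]) auto
    show "?R1 \<inter> ?R2 = {}" by (auto simp: disjoint_iff)
  qed simp
  ultimately have "deg c b w = deg a b w + card ((\<lambda>u. u + N) ` {u. (u, w) \<in> E \<and> a < u \<and> u < c})"
    by (simp add: deg_def)
  also have "card ((\<lambda>u. u + N) ` {u. (u, w) \<in> E \<and> a < u \<and> u < c}) = card {u. (u, w) \<in> E \<and> a < u \<and> u < c}"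
    by (rule card_image) simp
  finally show ?thesis using column_all[of w] w by (simp add: f_def)
qed

lemma finite_mass [simp]: "finite {(u, w) \<in> E. a < u \<and> u < c \<and> P u w}"
  by (rule finite_subset[OF _ finite_darts[of a c "\<lambda>_ _. True"]]) auto

lemma base_eq: "{(i, j) \<in> E. i = a \<and> j = b} = (if (a, b) \<in> E then {(a, b)} else {})"
  by auto

lemma card_base: "card {(i, j) \<in> E. i = a \<and> j = b} = e"
  unfolding base_eq by (simp add: e_def)

lemma finite_base: "finite {(i, j) \<in> E. i = a \<and> j = b}"
  unfolding base_eq by simp

text \<open>After gluing, \<open>u\<close> is also covered by the joining edges that start before
  it, wherever they end, and by the base edge; \<open>no_a\<close> rules out any further edge from
  \<open>a\<close>.\<close>

lemma inc_left: "a < u \<Longrightarrow> u \<le> c \<Longrightarrow> inc a b u = inc a c u + mass (\<lambda>v. v < u) (\<lambda>_. True) + e"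
proof -
  assume u: "a < u" "u \<le> c"
  let ?X = "{(i, j) \<in> E. a \<le> i \<and> i < u \<and> u < j \<and> j \<le> c}"
  let ?Y = "{(v, w) \<in> E. a < v \<and> v < c \<and> v < u \<and> c < w \<and> w \<le> b \<and> True}"
  let ?Z = "{(i, j) \<in> E. i = a \<and> j = b}"
  have "{(i, j) \<in> E. a \<le> i \<and> i < u \<and> u < j \<and> j \<le> b} = (?X \<union> ?Y) \<union> ?Z" (is "?L = _")
  proof (intro equalityI subsetI)
    fix p assume "p \<in> ?L"
    then obtain i j where p: "p = (i, j)" "(i, j) \<in> E" "a \<le> i" "i < u" "u < j" "j \<le> b" by auto
    then show "p \<in> (?X \<union> ?Y) \<union> ?Z"
      using no_a[of j] u by (cases "i = a"; cases "j \<le> c"; cases "j = b") auto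
  qed (use u ac cb in auto)
  moreover have "card ((?X \<union> ?Y) \<union> ?Z) = card ?X + card ?Y + card ?Z"
  proof -
    have "(?X \<union> ?Y) \<inter> ?Z = {}" "?X \<inter> ?Y = {}" using ac cb by auto
    then show ?thesis using finite_base by (simp add: card_Un_disjoint)
  qed
  moreover have "card ?Z = e"
    by (rule card_base)
  ultimately show ?thesis by (simp add: inc_def mass_def)
qed

lemma inc_right: "c < w \<Longrightarrow> w < b \<Longrightarrow> inc a b w = inc c b w + mass (\<lambda>_. True) (\<lambda>v. w < v) + e"
proof -
  assume w: "c < w" "w < b"
  let ?X = "{(i, j) \<in> E. c \<le> i \<and> i < w \<and> w < j \<and> j \<le> b}"
  let ?Y = "{(u, v) \<in> E. a < u \<and> u < c \<and> True \<and> c < v \<and> v \<le> b \<and> w < v}"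
  let ?Z = "{(i, j) \<in> E. i = a \<and> j = b}"
  have "{(i, j) \<in> E. a \<le> i \<and> i < w \<and> w < j \<and> j \<le> b} = (?X \<union> ?Y) \<union> ?Z" (is "?L = _")
  proof (intro equalityI subsetI)
    fix p assume "p \<in> ?L"
    then obtain i j where p: "p = (i, j)" "(i, j) \<in> E" "a \<le> i" "i < w" "w < j" "j \<le> b" by auto
    then show "p \<in> (?X \<union> ?Y) \<union> ?Z"
      using no_a[of j] w by (cases "i = a"; cases "c \<le> i"; cases "j = b") auto
  qed (use w ac cb in auto)
  moreover have "card ((?X \<union> ?Y) \<union> ?Z) = card ?X + card ?Y + card ?Z"
  proof -
    have "(?X \<union> ?Y) \<inter> ?Z = {}" "?X \<inter> ?Y = {}" using ac cb by auto
    then show ?thesis using finite_base by (simp add: card_Un_disjoint)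
  qed
  moreover have "card ?Z = e"
    by (rule card_base)
  ultimately show ?thesis by (simp add: inc_def mass_def)
qed

lemma inc_end: "inc a c c = 0" "inc c b b = 0"
  by (auto simp: inc_def intro!: card_eq_0_iff[THEN iffD2])

text \<open>Seven disjoint families of edges cross \<open>(u, w)\<close>: edges within the left part
  over \<open>u\<close>, within the right part over \<open>w\<close>, joining edges with both ends
  before or both ends after those of \<open>(u, w)\<close>, and edges leaving from left vertices
  after \<open>u\<close>, from \<open>c\<close>, and from right vertices before
  \<open>w\<close>.\<close>

lemma crossing_bound:
  assumes uw: "(u, w) \<in> E" "a < u" "u < c" "c < w" "w \<le> b"
  shows "inc a c u + inc c b w + mass (\<lambda>v. v < u) (\<lambda>v. v < w) + mass (\<lambda>v. u < v) (\<lambda>v. w < v)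
    + (\<Sum>v\<in>{v\<in>set us. u < v}. deg a b v) + deg a b c + (\<Sum>v\<in>{v\<in>set (ws @ [b]). v < w}. f v) \<le> l"
proof -
  \<comment> \<open>Turns a dart around, so that it starts between \<open>u\<close> and
    \<open>w\<close> as \<open>St u w\<close> requires.\<close>
  let ?r = "\<lambda>(i, j). (j, i + N)"
  define S1 where "S1 = {(i, j) \<in> E. a \<le> i \<and> i < u \<and> u < j \<and> j \<le> c}"
  define S2 where "S2 = {(i, j) \<in> E. c \<le> i \<and> i < w \<and> w < j \<and> j \<le> b}"
  define S3 where "S3 = {(u', w') \<in> E. a < u' \<and> u' < c \<and> u' < u \<and> c < w' \<and> w' \<le> b \<and> w' < w}"
  define S4 where "S4 = {(u', w') \<in> E. a < u' \<and> u' < c \<and> u < u' \<and> c < w' \<and> w' \<le> b \<and> w < w'}"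
  define S5 where "S5 = {(v, t) \<in> E. u < v \<and> v < c \<and> b < t \<and> t < a + N}"
  define S6 where "S6 = {(v, t) \<in> E. v = c \<and> b < t \<and> t < a + N}"
  define S7 where "S7 = {(v, t) \<in> E. c < v \<and> v < w \<and> b < t \<and> t < a + N}"
  note S = S1_def S2_def S3_def S4_def S5_def S6_def S7_def
  have fin: "finite S1" "finite S2" "finite S3" "finite S4" "finite S5" "finite S6" "finite S7"
    unfolding S1_def S2_def S3_def S4_def S5_def S6_def S7_def
    by (auto intro!: finite_subset[OF _ finite_darts[of a b "\<lambda>_ _. True"]]) (use uw ac cb in auto)
  have sub: "?r ` S1 \<subseteq> St u w" "S2 \<subseteq> St u w" "?r ` S3 \<subseteq> St u w" "S4 \<subseteq> St u w" "S5 \<subseteq> St u w"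
      "S6 \<subseteq> St u w" "S7 \<subseteq> St u w"
    unfolding S1_def S2_def S3_def S4_def S5_def S6_def S7_def St_def using uw ac cb ba
    by (auto simp: reverse_dart)
  have "card (?r ` S1 \<union> S2 \<union> ?r ` S3 \<union> S4 \<union> S5 \<union> S6 \<union> S7) \<le> card (St u w)"
    by (intro card_mono) (use sub in auto)
  also have "\<dots> \<le> l" using card_St_edge uw(1) .
  finally have "card (?r ` S1 \<union> S2 \<union> ?r ` S3 \<union> S4 \<union> S5 \<union> S6 \<union> S7) \<le> l" .
  moreover have "card (?r ` S1 \<union> S2 \<union> ?r ` S3 \<union> S4 \<union> S5 \<union> S6 \<union> S7) =
     card (?r ` S1) + card S2 + card (?r ` S3) + card S4 + card S5 + card S6 + card S7"
  proof -
    \<comment> \<open>Enclosing each family in a rectangle of endpoint pairs reduces disjointness of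
      the families to that of the rectangles.\<close>
    have box: "?r ` S1 \<subseteq> {u<..c} \<times> {a + N..<u + N}" "S2 \<subseteq> {c..<w} \<times> {w<..b}"
      "?r ` S3 \<subseteq> {c<..<w} \<times> {a + N<..<u + N}" "S4 \<subseteq> {u<..<c} \<times> {w<..b}"
      "S5 \<subseteq> {u<..<c} \<times> {b<..<a + N}" "S6 \<subseteq> {c} \<times> {b<..<a + N}" "S7 \<subseteq> {c<..<w} \<times> {b<..<a + N}"
      unfolding S1_def S2_def S3_def S4_def S5_def S6_def S7_def using uw by auto
    have disj: "X \<inter> Y = {}" if "X \<subseteq> B" "Y \<subseteq> B'" "B \<inter> B' = {}" for X Y B B' :: "(int \<times> int) set"
      using that by blast
    have d: "?r ` S1 \<inter> S2 = {}" "?r ` S1 \<inter> ?r ` S3 = {}" "S2 \<inter> ?r ` S3 = {}"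
      "?r ` S1 \<inter> S4 = {}" "S2 \<inter> S4 = {}" "?r ` S3 \<inter> S4 = {}"
      "?r ` S1 \<inter> S5 = {}" "S2 \<inter> S5 = {}" "?r ` S3 \<inter> S5 = {}" "S4 \<inter> S5 = {}"
      "?r ` S1 \<inter> S6 = {}" "S2 \<inter> S6 = {}" "?r ` S3 \<inter> S6 = {}" "S4 \<inter> S6 = {}" "S5 \<inter> S6 = {}"
      "?r ` S1 \<inter> S7 = {}" "S2 \<inter> S7 = {}" "?r ` S3 \<inter> S7 = {}" "S4 \<inter> S7 = {}" "S5 \<inter> S7 = {}" "S6 \<inter> S7 = {}"
      by (rule disj[OF box(1) box(2)] disj[OF box(1) box(3)] disj[OF box(2) box(3)]
        disj[OF box(1) box(4)] disj[OF box(2) box(4)] disj[OF box(3) box(4)]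
        disj[OF box(1) box(5)] disj[OF box(2) box(5)] disj[OF box(3) box(5)] disj[OF box(4) box(5)]
        disj[OF box(1) box(6)] disj[OF box(2) box(6)] disj[OF box(3) box(6)] disj[OF box(4) box(6)] disj[OF box(5) box(6)]
        disj[OF box(1) box(7)] disj[OF box(2) box(7)] disj[OF box(3) box(7)] disj[OF box(4) box(7)] disj[OF box(5) box(7)] disj[OF box(6) box(7)];
        use uw ac cb ba in auto)+
    show ?thesis using fin d by (simp add: card_Un_disjoint Int_Un_distrib2)
  qed
  moreover have "card (?r ` S1) = inc a c u" "card (?r ` S3) = mass (\<lambda>v. v < u) (\<lambda>v. v < w)"
    unfolding S1_def S3_def inc_def mass_def by (auto intro!: card_image simp: inj_on_def)
  moreover have "card S2 = inc c b w" "card S4 = mass (\<lambda>v. u < v) (\<lambda>v. w < v)"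
    unfolding S2_def S4_def inc_def mass_def by auto
  moreover have "card S5 = (\<Sum>v\<in>{v\<in>set us. u < v}. deg a b v)"
  proof -
    have "card S5 = (\<Sum>v\<in>{v\<in>set us. u < v}. card {t. (v, t) \<in> E \<and> (u < v \<and> v < c \<and> b < t \<and> t < a + N)})"
      unfolding S5_def using uw cb ba
      by (intro card_darts) (use uw cb in_us in auto)
    also have "\<dots> = (\<Sum>v\<in>{v\<in>set us. u < v}. deg a b v)"
      unfolding deg_def by (intro sum.cong refl arg_cong[where f = card]) (auto simp: us_def set_verts)
    finally show ?thesis .
  qed
  moreover have "card S6 = deg a b c"
  proof -
    have "card S6 = (\<Sum>v\<in>{c}. card {t. (v, t) \<in> E \<and> (v = c \<and> b < t \<and> t < a + N)})"
      unfolding S6_def by (intro card_darts) auto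
    then show ?thesis by (simp add: deg_def)
  qed
  moreover have "card S7 = (\<Sum>v\<in>{v\<in>set (ws @ [b]). v < w}. f v)"
  proof -
    have "card S7 = (\<Sum>v\<in>{v\<in>set (ws @ [b]). v < w}. card {t. (v, t) \<in> E \<and> (c < v \<and> v < w \<and> b < t \<and> t < a + N)})"
      unfolding S7_def using uw ac
      by (intro card_darts) (use uw ac in_ws in auto)
    also have "\<dots> = (\<Sum>v\<in>{v\<in>set (ws @ [b]). v < w}. f v)"
      unfolding deg_def f_def using uw by (intro sum.cong refl) (auto simp: ws_def set_verts intro!: arg_cong[where f = card])
    finally show ?thesis .
  qed
  ultimately show ?thesis by simp
qed

lemma sum_us_deg: "(\<Sum>u\<in>{u\<in>set us. Q u}. deg a b u) = (\<Sum>u\<in>{u\<in>{a<..<c}. Q u}. deg a b u)"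
proof (rule sum.mono_neutral_left)
  show "finite {u \<in> {a<..<c}. Q u}" by (rule finite_subset[of _ "{a<..<c}"]) auto
  show "\<forall>u\<in>{u \<in> {a<..<c}. Q u} - {u \<in> set us. Q u}. deg a b u = 0"
    using deg_left by (fastforce simp: us_def set_verts)
qed (auto simp: us_def set_verts)

lemma sum_ws_f: "(\<Sum>w\<in>set ws. f w) = (\<Sum>w\<in>{c<..<b}. deg a b w)"
proof -
  have "(\<Sum>w\<in>set ws. f w) = (\<Sum>w\<in>{c<..<b}. f w)"
    by (rule sum.mono_neutral_left) (use deg_right in \<open>fastforce simp: ws_def set_verts\<close>)+
  then show ?thesis by (simp add: f_def)
qed

lemma card_St_split: "card (St a b) = (\<Sum>u\<in>set us. deg a b u) + deg a b c + (\<Sum>w\<in>set ws. f w)"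
proof -
  have "{a<..<b} = {a<..<c} \<union> {c} \<union> {c<..<b}" using ac cb by auto
  then have "card (St a b) = (\<Sum>u\<in>{a<..<c}. deg a b u) + deg a b c + (\<Sum>w\<in>{c<..<b}. deg a b w)"
    unfolding card_St by (simp add: sum.union_disjoint)
  then show ?thesis using sum_us_deg[of "\<lambda>_. True"] sum_ws_f by (simp add: greaterThanLessThan_def Int_def)
qed

lemma state_split:
  "state a b =
      map (\<lambda>u. (deg a b u, l - inc a b u)) (filter (\<lambda>u. deg a b u \<noteq> 0) us) @
      (if deg a b c = 0 then [] else [(deg a b c, l - inc a b c)]) @
      map (\<lambda>w. (f w, l - inc a b w)) (filter (\<lambda>w. f w \<noteq> 0) ws)"
proof -
  have "[a + 1..b - 1] = [a + 1..c - 1] @ [c] @ [c + 1..b - 1]"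
    using ac cb upto_split3[of "a + 1" c "b - 1"] by simp
  moreover have "filter (\<lambda>u. deg a b u \<noteq> 0) us = filter (\<lambda>u. deg a b u \<noteq> 0) [a + 1..c - 1]"
    unfolding us_def verts_def filter_filter by (intro filter_cong refl) (use deg_left in auto)
  moreover have "filter (\<lambda>w. f w \<noteq> 0) ws = filter (\<lambda>u. deg a b u \<noteq> 0) [c + 1..b - 1]"
    unfolding ws_def verts_def filter_filter
    by (intro filter_cong refl) (use deg_right in \<open>auto simp: f_def\<close>)
  moreover have "map (\<lambda>w. (f w, l - inc a b w)) (filter (\<lambda>u. deg a b u \<noteq> 0) [c + 1..b - 1]) =
     map (\<lambda>w. (deg a b w, l - inc a b w)) (filter (\<lambda>u. deg a b u \<noteq> 0) [c + 1..b - 1])"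
    by (auto simp: f_def)
  ultimately show ?thesis unfolding state_def verts_def by simp
qed

lemma card_In_split: "card (In a b) = card (In a c) + card (In c b) + mass (\<lambda>_. True) (\<lambda>_. True) + e"
proof -
  let ?Y = "{(u, v) \<in> E. a < u \<and> u < c \<and> True \<and> c < v \<and> v \<le> b \<and> True}"
  let ?Z = "{(i, j) \<in> E. i = a \<and> j = b}"
  have "In a b = In a c \<union> In c b \<union> ?Y \<union> ?Z"
  proof (intro equalityI subsetI)
    fix p assume "p \<in> In a b"
    then obtain i j where p: "p = (i, j)" "(i, j) \<in> E" "a \<le> i" "j \<le> b" by (auto simp: In_def)
    then show "p \<in> In a c \<union> In c b \<union> ?Y \<union> ?Z" using no_a[of j] by (cases "i = a") (auto simp: In_def)
  qed (use ac cb in \<open>auto simp: In_def\<close>)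
  moreover have "card (In a c \<union> In c b \<union> ?Y \<union> ?Z) = card (In a c) + card (In c b) + card ?Y + card ?Z"
  proof -
    have "(In a c \<union> In c b \<union> ?Y) \<inter> ?Z = {}" "(In a c \<union> In c b) \<inter> ?Y = {}" "In a c \<inter> In c b = {}"
      using ac cb dart by (auto simp: In_def) force
    then show ?thesis using finite_base by (simp add: card_Un_disjoint)
  qed
  moreover have "card ?Z = e"
    by (rule card_base)
  ultimately show ?thesis by (simp add: mass_def)
qed

end

section \<open>From tables to chords of a polygon\<close>

locale graph_potential = potential_table l M c C K T + convex_graph l N E
  for l M c C K T N E
begin

text \<open>Supplies the hypotheses of \<open>combine\<close> from the counting identities. The
  truncated capacities are exact where they matter: at a vertex with an edge leaving the glued part
  by \<open>inc_le\<close>, at the ends of a joining edge by \<open>crossing_bound\<close>.\<close>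

lemma step:
  assumes "split_chord l N E a d b"
    and L: "bounded (state a d) (nat (d - a - 1)) (val C a d)"
    and R: "bounded (state d b) (nat (b - d - 1)) (val C d b)"
    and t: "card (St a b) \<le> l"
  shows "bounded (state a b) (nat (b - a - 1)) (val C a b)"
proof -
  interpret split_chord l N E a d b by fact
  define x where "x = deg a b"
  define r where "r = deg a b d"
  define kU where "kU = deg a d"
  define kW where "kW = deg d b"
  define cU where "cU u = l - inc a d u" for u
  define cW where "cW w = l - inc d b w" for w
  have tot: "(\<Sum>u\<in>set us. sum (A u) (set (ws @ [b]))) = mass (\<lambda>_. True) (\<lambda>_. True)"
    using mass_eq[where Q = "\<lambda>_. True" and R = "\<lambda>_. True"] by (simp only: simp_thms Collect_mem_eq)
  have below_us: "beneath us u (\<lambda>v. sum (A v) (set (ws @ [b]))) = mass (\<lambda>v. v < u) (\<lambda>_. True)" for u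
    using mass_eq[where Q = "\<lambda>v. v < u" and R = "\<lambda>_. True"] by (simp only: simp_thms Collect_mem_eq beneath_def)
  have above_ws: "above (ws @ [b]) w (\<lambda>v. \<Sum>u\<in>set us. A u v) = mass (\<lambda>_. True) (\<lambda>v. w < v)" for w
    using mass_eq[where Q = "\<lambda>_. True" and R = "\<lambda>v. w < v"] unfolding above_def by (subst sum.swap) (simp only: simp_thms Collect_mem_eq)
  have inner: "beneath (ws @ [b]) w (\<lambda>v. beneath us u (\<lambda>u'. A u' v)) = mass (\<lambda>v. v < u) (\<lambda>v. v < w)" for u w
    using mass_eq[where Q = "\<lambda>v. v < u" and R = "\<lambda>v. v < w"] unfolding beneath_def by (subst sum.swap) simp
  have outer: "above us u (\<lambda>u'. x u' + above (ws @ [b]) w (A u')) =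
      (\<Sum>v\<in>{v\<in>set us. u < v}. deg a b v) + mass (\<lambda>v. u < v) (\<lambda>v. w < v)" for u w
    using mass_eq[where Q = "\<lambda>v. u < v" and R = "\<lambda>v. w < v"] unfolding above_def x_def by (simp add: sum.distrib)
  have us_mem: "a < u \<and> u < d \<and> 0 < deg a d u" if "u \<in> set us" for u
    using that by (simp add: us_def set_verts)
  have ws_mem: "d < w \<and> w < b \<and> 0 < deg d b w" if "w \<in> set ws" for w
    using that by (simp add: ws_def set_verts)
  have inc_le: "inc a b u \<le> l" if u: "a < u" "u < b" "0 < deg a b u" for u
  proof -
    obtain t where "(u, t) \<in> E" "b < t" "t < a + N" using u(3) deg_pos[of a b u] by auto
    then show ?thesis using u by (intro inc_le[of u t]) (simp add: St_def)
  qed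
  have res: "bounded (
      map (\<lambda>u. (x u, cU u - (beneath us u (\<lambda>v. sum (A v) (set (ws @ [b]))) + e))) (filter (\<lambda>u. x u \<noteq> 0) us) @
      (if r = 0 then [] else [(r, l - ((\<Sum>u\<in>set us. sum (A u) (set (ws @ [b]))) + e))]) @
      map (\<lambda>w. (f w, cW w - (above (ws @ [b]) w (\<lambda>v. \<Sum>u\<in>set us. A u v) + e))) (filter (\<lambda>w. f w \<noteq> 0) ws))
    (nat (d - a - 1) + nat (b - d - 1) + 1)
    (val C a d + val C d b + int (2 * (\<Sum>u\<in>set us. A u b) + 2 * r + 4 * e) - C)"
  proof (rule combine[where kU = kU and kW = kW])
    show "sorted_wrt (<) us" unfolding us_def by (rule sorted_verts)
    show "sorted_wrt (<) (ws @ [b])" by (rule sorted_ws_b)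
    show "f b = 0" by (simp add: f_def)
    show "e \<le> 1" by (simp add: e_def)
    show "bounded (map (\<lambda>u. (kU u, cU u)) us) (nat (d - a - 1)) (val C a d)"
      using L by (simp add: state_def kU_def cU_def us_def)
    show "bounded (map (\<lambda>w. (kW w, cW w)) ws) (nat (b - d - 1)) (val C d b)"
      using R by (simp add: state_def kW_def cW_def ws_def)
    show "A u w \<le> 1" for u w by (simp add: A_def)
    show "0 < kU u \<and> kU u = x u + sum (A u) (set (ws @ [b]))" if "u \<in> set us" for u
      using us_mem[OF that] deg_left[of u] unfolding kU_def x_def by auto
    show "kW w = f w + (\<Sum>u\<in>set us. A u w)" if "w \<in> set ws" for w
      using ws_mem[OF that] deg_right[of w] unfolding kW_def by auto
    show "cU u \<le> l" "cW w \<le> l" for u w by (auto simp: cU_def cW_def)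
    show "cW b = l" using inc_end by (simp add: cW_def)
    show "beneath us u (\<lambda>v. sum (A v) (set (ws @ [b]))) + e \<le> cU u" if "u \<in> set us" "0 < x u" for u
      using inc_left[of u] inc_le[of u] us_mem[OF that(1)] that(2) cb
      unfolding below_us x_def cU_def by simp
    show "r = 0 \<or> (\<Sum>u\<in>set us. sum (A u) (set (ws @ [b]))) + e \<le> l"
    proof -
      have "mass (\<lambda>v. v < d) (\<lambda>_. True) = mass (\<lambda>_. True) (\<lambda>_. True)"
        unfolding mass_def by (intro arg_cong[where f = card]) auto
      then show ?thesis
        using inc_left[of d] inc_le[of d] inc_end(1) ac cb unfolding tot r_def by fastforce
    qed
    show "l + r + beneath (ws @ [b]) w (\<lambda>v. beneath us u (\<lambda>u'. A u' v)) +
       above us u (\<lambda>u'. x u' + above (ws @ [b]) w (A u')) + beneath (ws @ [b]) w f \<le> cU u + cW w"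
      if "u \<in> set us" "w \<in> set (ws @ [b])" "A u w = 1" for u w
    proof -
      have "(u, w) \<in> E" using that(3) by (simp add: A_def of_bool_def split: if_splits)
      moreover have "d < w" "w \<le> b" using that(2) ws_mem[of w] cb by auto
      ultimately show ?thesis
        using crossing_bound[of u w] us_mem[OF that(1)]
        unfolding inner outer cU_def cW_def r_def beneath_def[of "ws @ [b]" w f] by linarith
    qed
    show "r + sum x (set us) + sum f (set ws) \<le> l"
      using t unfolding card_St_split x_def r_def by simp
    show "above (ws @ [b]) w (\<lambda>v. \<Sum>u\<in>set us. A u v) + e \<le> cW w" if "w \<in> set ws" "0 < f w" for w
    proof -
      have "0 < deg a b w" using that(2) by (simp add: f_def split: if_splits)
      then show ?thesis
        using inc_right[of w] inc_le[of w] ws_mem[OF that(1)] ac unfolding above_ws cW_def by simp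
    qed
  qed
  have "state a b =
      map (\<lambda>u. (x u, cU u - (beneath us u (\<lambda>v. sum (A v) (set (ws @ [b]))) + e))) (filter (\<lambda>u. x u \<noteq> 0) us) @
      (if r = 0 then [] else [(r, l - ((\<Sum>u\<in>set us. sum (A u) (set (ws @ [b]))) + e))]) @
      map (\<lambda>w. (f w, cW w - (above (ws @ [b]) w (\<lambda>v. \<Sum>u\<in>set us. A u v) + e))) (filter (\<lambda>w. f w \<noteq> 0) ws)"
  proof -
    have 1: "map (\<lambda>u. (deg a b u, l - inc a b u)) (filter (\<lambda>u. deg a b u \<noteq> 0) us) =
       map (\<lambda>u. (x u, cU u - (beneath us u (\<lambda>v. sum (A v) (set (ws @ [b]))) + e))) (filter (\<lambda>u. x u \<noteq> 0) us)"
      unfolding x_def below_us cU_def by (intro map_cong refl) (auto dest!: us_mem simp: inc_left)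
    have 2: "map (\<lambda>w. (f w, l - inc a b w)) (filter (\<lambda>w. f w \<noteq> 0) ws) =
       map (\<lambda>w. (f w, cW w - (above (ws @ [b]) w (\<lambda>v. \<Sum>u\<in>set us. A u v) + e))) (filter (\<lambda>w. f w \<noteq> 0) ws)"
      unfolding above_ws cW_def by (intro map_cong refl) (auto dest!: ws_mem simp: inc_right)
    have "mass (\<lambda>v. v < d) (\<lambda>_. True) = mass (\<lambda>_. True) (\<lambda>_. True)"
      unfolding mass_def by (intro arg_cong[where f = card]) auto
    then have 3: "inc a b d = (\<Sum>u\<in>set us. sum (A u) (set (ws @ [b]))) + e"
      using inc_left[of d] inc_end(1) ac unfolding tot by simp
    show ?thesis unfolding state_split 1 2 3 r_def ..
  qed
  moreover have "nat (d - a - 1) + nat (b - d - 1) + 1 = nat (b - a - 1)" using ac cb by simp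
  moreover have "val C a d + val C d b + int (2 * (\<Sum>u\<in>set us. A u b) + 2 * r + 4 * e) - C = val C a b"
  proof -
    have "set us \<subseteq> {a<..<d}" by (auto dest: us_mem)
    have "card (St a d) = (\<Sum>u\<in>set us. deg a d u)"
      unfolding card_St using us_mem
      by (intro sum.mono_neutral_right) (auto simp: us_def set_verts)
    also have "\<dots> = (\<Sum>u\<in>set us. deg a b u) + mass (\<lambda>_. True) (\<lambda>_. True)"
      unfolding tot[symmetric] sum.distrib[symmetric]
      by (intro sum.cong refl deg_left) (auto dest: us_mem)
    finally have 1: "card (St a d) = (\<Sum>u\<in>set us. deg a b u) + mass (\<lambda>_. True) (\<lambda>_. True)" .
    have "card (St d b) = (\<Sum>w\<in>set ws. deg d b w)"
      unfolding card_St using ws_mem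
      by (intro sum.mono_neutral_right) (auto simp: ws_def set_verts)
    also have "\<dots> = (\<Sum>w\<in>set ws. f w) + (\<Sum>w\<in>set ws. \<Sum>u\<in>set us. A u w)"
      unfolding sum.distrib[symmetric]
      by (intro sum.cong refl deg_right) (auto dest: ws_mem)
    finally have 2: "card (St d b) = (\<Sum>w\<in>set ws. f w) + (\<Sum>w\<in>set ws. \<Sum>u\<in>set us. A u w)" .
    have "b \<notin> set ws" by (auto dest: ws_mem)
    then have 3: "mass (\<lambda>_. True) (\<lambda>_. True) = (\<Sum>u\<in>set us. A u b) + (\<Sum>w\<in>set ws. \<Sum>u\<in>set us. A u w)"
      unfolding tot[symmetric] by (subst sum.swap) simp
    show ?thesis
      unfolding val_def card_In_split card_St_split 1 2 r_def using 3 by (simp add: algebra_simps)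
  qed
  ultimately show ?thesis using res by simp
qed

end

context convex_graph
begin

text \<open>
  Let \<open>z\<close> be a median of the starting points of the edges leaving across \<open>a b\<close>. The apex is an end of a longest
  edge or side (other than \<open>a b\<close>) over \<open>(z, z + 1)\<close>: whatever crosses the two new chords either
  crosses \<open>a b\<close> on the lighter side or crosses that edge.
\<close>

lemma apex:
  assumes ab: "a + 2 \<le> b" "b < a + N" and t: "card (St a b) \<le> l"
  shows "\<exists>c. a < c \<and> c < b \<and> card (St a c) \<le> l \<and> card (St c b) \<le> l \<and>
    ((\<forall>w. c < w \<and> w < b \<longrightarrow> (a, w) \<notin> E) \<or> (\<forall>u. a < u \<and> u < c \<longrightarrow> (u, b) \<notin> E))"
proof -
  define S where "S Q = card {(u, t) \<in> St a b. Q u}" for Q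
  have fin: "finite {(u, t) \<in> St a b. Q u}" for Q
    by (rule finite_subset[OF _ finite_St[of a b]]) auto
  have S_mono: "S Q \<le> S Q'" if "\<And>u. a < u \<Longrightarrow> u < b \<Longrightarrow> Q u \<Longrightarrow> Q' u" for Q Q'
    unfolding S_def using that by (intro card_mono[OF fin]) (auto simp: St_def)
  \<comment> \<open>For the largest \<open>z\<close> the leaving edges that start before
    \<open>z\<close> are at most as many as those after it, and at \<open>z + 1\<close> the
    comparison is reversed. Every vertex up to \<open>z\<close> or from \<open>z + 1\<close> on
    inherits the respective inequality.\<close>
  define Z where "Z = {z \<in> {a..b - 1}. z = a \<or> S (\<lambda>u. u < z) \<le> S (\<lambda>u. z < u)}"
  define z where "z = Max Z"
  have Z: "finite Z" unfolding Z_def by (rule finite_Collect_conjI) simp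
  have "a \<in> Z" using ab by (auto simp: Z_def)
  then have zZ: "z \<in> Z" unfolding z_def using Max_in[OF Z] by blast
  have z: "a \<le> z" "z < b" "z = a \<or> S (\<lambda>u. u < z) \<le> S (\<lambda>u. z < u)" using zZ by (auto simp: Z_def)
  have z1: "S (\<lambda>u. z + 1 < u) < S (\<lambda>u. u < z + 1)" if "z + 1 < b"
  proof (rule ccontr)
    assume "\<not> ?thesis"
    then have "z + 1 \<in> Z" using z that by (auto simp: Z_def)
    then show False using Max_ge[OF Z(1), of "z + 1"] by (simp add: z_def)
  qed
  \<comment> \<open>The side \<open>(z, z + 1)\<close> makes this set nonempty; without
    \<open>(a, b)\<close>, at least one end of a longest member lies strictly between
    \<open>a\<close> and \<open>b\<close>.\<close>
  define I where "I = {(x, y). a \<le> x \<and> y \<le> b \<and> (x, y) \<noteq> (a, b) \<and> x \<le> z \<and> z < y \<and> (y = x + 1 \<or> (x, y) \<in> E)}"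
  have "I \<subseteq> {a..b} \<times> {a..b}" using z by (auto simp: I_def)
  then have I: "finite I" "(z, z + 1) \<in> I" using z ab finite_subset by (fastforce, auto simp: I_def)
  define len :: "int \<times> int \<Rightarrow> int" where "len p = snd p - fst p" for p
  have "Max (len ` I) \<in> len ` I" using I by (intro Max_in) auto
  then obtain x y where xy: "(x, y) \<in> I" and "len (x, y) = Max (len ` I)" by auto
  then have max: "len p \<le> y - x" if "p \<in> I" for p
    using Max_ge[of "len ` I" "len p"] I(1) that by (auto simp: len_def)
  have xy': "a \<le> x" "y \<le> b" "(x, y) \<noteq> (a, b)" "x \<le> z" "z < y" "y = x + 1 \<or> (x, y) \<in> E"
    using xy by (auto simp: I_def)
  have maximal: "u = x \<and> w = y" if "(u, w) \<in> E" "a \<le> u" "u \<le> x" "y \<le> w" "w \<le> b" "(u, w) \<noteq> (a, b)" for u w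
  proof -
    have "(u, w) \<in> I" using that xy' by (auto simp: I_def)
    from max[OF this] show ?thesis using that by (auto simp: len_def)
  qed
  \<comment> \<open>The edges of the part that cross \<open>(x, y)\<close>, on its right and on its
    left. Maximality of \<open>(x, y)\<close> forces every inner edge crossing a new chord at
    \<open>y\<close> or \<open>x\<close> into one of these sets.\<close>
  define R where "R = {(u, t) \<in> E. x < u \<and> u < y \<and> y < t \<and> t \<le> b}"
  define L where "L = {(u, w) \<in> E. a \<le> u \<and> u < x \<and> x < w \<and> w < y}"
  have finRL: "finite R" "finite L"
    by (rule finite_subset[OF _ finite_darts[of a b "\<lambda>_ _. True"]]; use xy' in \<open>auto simp: R_def L_def\<close>)+
  have cross: "S (\<lambda>u. x < u \<and> u < y) + card R + card L \<le> l"
  proof (cases "y = x + 1")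
    case True
    have "S (\<lambda>u. x < u \<and> u < y) = card ({} :: (int \<times> int) set)"
      unfolding S_def using True by (intro arg_cong[where f = card]) auto
    moreover have "R = {}" "L = {}" using True by (auto simp: R_def L_def)
    ultimately show ?thesis by simp
  next
    case False
    then have E: "(x, y) \<in> E" using xy' by auto
    let ?S = "{(u, t) \<in> St a b. x < u \<and> u < y}" and ?L = "(\<lambda>(u, w). (w, u + N)) ` L"
    have "?S \<union> R \<union> ?L \<subseteq> St x y"
      using xy' ab by (auto simp: St_def R_def L_def reverse_dart)
    then have "card (?S \<union> R \<union> ?L) \<le> card (St x y)" by (intro card_mono) auto
    moreover have "card (?S \<union> R \<union> ?L) = card ?S + card R + card ?L"
    proof -
      have "(?S \<union> R) \<inter> ?L = {}" "?S \<inter> R = {}" using ab by (auto simp: St_def R_def L_def)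
      then show ?thesis using finRL fin[of "\<lambda>u. x < u \<and> u < y"] by (simp add: card_Un_disjoint)
    qed
    moreover have "card ?L = card L" by (rule card_image) (auto simp: inj_on_def)
    ultimately show ?thesis using card_St_edge[OF E] by (simp add: S_def)
  qed
  have F1: "card (St a y) \<le> S (\<lambda>u. u < y) + card R" if "y < b"
  proof -
    have "St a y \<subseteq> {(u, t) \<in> St a b. u < y} \<union> R"
    proof
      fix p assume "p \<in> St a y"
      then obtain u t where p: "p = (u, t)" "(u, t) \<in> E" "a < u" "u < y" "y < t" "t < a + N" by (auto simp: St_def)
      show "p \<in> {(u, t) \<in> St a b. u < y} \<union> R"
      proof (cases "t \<le> b")
        case True
        then have "x < u" using maximal[of u t] p by force
        then show ?thesis using True p by (auto simp: R_def)
      qed (use p that in \<open>auto simp: St_def\<close>)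
    qed
    then have "card (St a y) \<le> card ({(u, t) \<in> St a b. u < y} \<union> R)"
      using fin finRL by (intro card_mono) auto
    also have "\<dots> \<le> S (\<lambda>u. u < y) + card R" unfolding S_def by (rule card_Un_le)
    finally show ?thesis .
  qed
  have F2: "card (St y b) \<le> S (\<lambda>u. y < u) + card R" if "y < b"
  proof -
    have "St y b \<subseteq> {(u, t) \<in> St a b. y < u} \<union> (\<lambda>(u, w). (w, u + N)) ` R"
    proof
      fix p assume "p \<in> St y b"
      then obtain w s where p: "p = (w, s)" "(w, s) \<in> E" "y < w" "w < b" "b < s" "s < y + N" by (auto simp: St_def)
      show "p \<in> {(u, t) \<in> St a b. y < u} \<union> (\<lambda>(u, w). (w, u + N)) ` R"
      proof (cases "s < a + N")
        case False
        define u where "u = s - N"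
        have u: "(u, w) \<in> E" "a \<le> u" "u < y" using p False reverse_dart[of w u] by (auto simp: u_def)
        then have "x < u" using maximal[of u w] p by force
        then have "(u, w) \<in> R" using u p by (auto simp: R_def)
        then show ?thesis using p by (force simp: u_def)
      qed (use p xy' z in \<open>auto simp: St_def\<close>)
    qed
    then have "card (St y b) \<le> card ({(u, t) \<in> St a b. y < u} \<union> (\<lambda>(u, w). (w, u + N)) ` R)"
      using fin finRL by (intro card_mono) auto
    also have "\<dots> \<le> S (\<lambda>u. y < u) + card ((\<lambda>(u, w). (w, u + N)) ` R)" unfolding S_def by (rule card_Un_le)
    also have "card ((\<lambda>(u, w). (w, u + N)) ` R) \<le> card R" by (rule card_image_le[OF finRL(1)])
    finally show ?thesis by simp
  qed
  have G1: "card (St x b) \<le> S (\<lambda>u. x < u) + card L" if "a < x"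
  proof -
    have "St x b \<subseteq> {(u, t) \<in> St a b. x < u} \<union> (\<lambda>(u, w). (w, u + N)) ` L"
    proof
      fix p assume "p \<in> St x b"
      then obtain w s where p: "p = (w, s)" "(w, s) \<in> E" "x < w" "w < b" "b < s" "s < x + N" by (auto simp: St_def)
      show "p \<in> {(u, t) \<in> St a b. x < u} \<union> (\<lambda>(u, w). (w, u + N)) ` L"
      proof (cases "s < a + N")
        case False
        define u where "u = s - N"
        have u: "(u, w) \<in> E" "a \<le> u" "u < x" using p False reverse_dart[of w u] by (auto simp: u_def)
        then have "w < y" using maximal[of u w] p by force
        then have "(u, w) \<in> L" using u p by (auto simp: L_def)
        then show ?thesis using p by (force simp: u_def)
      qed (use p that in \<open>auto simp: St_def\<close>)
    qed
    then have "card (St x b) \<le> card ({(u, t) \<in> St a b. x < u} \<union> (\<lambda>(u, w). (w, u + N)) ` L)"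
      using fin finRL by (intro card_mono) auto
    also have "\<dots> \<le> S (\<lambda>u. x < u) + card ((\<lambda>(u, w). (w, u + N)) ` L)" unfolding S_def by (rule card_Un_le)
    also have "card ((\<lambda>(u, w). (w, u + N)) ` L) \<le> card L" using finRL by (intro card_image_le) auto
    finally show ?thesis by simp
  qed
  have G2: "card (St a x) \<le> S (\<lambda>u. u < x) + card L" if "a < x"
  proof -
    have "St a x \<subseteq> {(u, t) \<in> St a b. u < x} \<union> L"
    proof
      fix p assume "p \<in> St a x"
      then obtain u t where p: "p = (u, t)" "(u, t) \<in> E" "a < u" "u < x" "x < t" "t < a + N" by (auto simp: St_def)
      show "p \<in> {(u, t) \<in> St a b. u < x} \<union> L"
      proof (cases "t \<le> b")
        case True
        then have "t < y" using maximal[of u t] p by force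
        then show ?thesis using p by (auto simp: L_def)
      qed (use p xy' z in \<open>auto simp: St_def\<close>)
    qed
    then have "card (St a x) \<le> card ({(u, t) \<in> St a b. u < x} \<union> L)"
      using fin finRL by (intro card_mono) auto
    also have "\<dots> \<le> S (\<lambda>u. u < x) + card L" unfolding S_def by (rule card_Un_le)
    finally show ?thesis .
  qed
  have no_y: "(a, w) \<notin> E" if "y < w" "w < b" for w using maximal[of a w] xy' that by auto
  have no_x: "(u, b) \<notin> E" if "a < u" "u < x" for u using maximal[of u b] xy' that by auto
  have Sy: "S (\<lambda>u. y < u) \<le> S (\<lambda>u. u < y)" if "y < b"
  proof -
    have "S (\<lambda>u. y < u) \<le> S (\<lambda>u. z + 1 < u)" "S (\<lambda>u. u < z + 1) \<le> S (\<lambda>u. u < y)"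
      using xy' by (auto intro!: S_mono)
    then show ?thesis using z1 xy' that by linarith
  qed
  have Sx: "S (\<lambda>u. u < x) \<le> S (\<lambda>u. x < u)" if "a < x"
  proof -
    have "S (\<lambda>u. u < x) \<le> S (\<lambda>u. u < z)" "S (\<lambda>u. z < u) \<le> S (\<lambda>u. x < u)"
      using xy' by (auto intro!: S_mono)
    then show ?thesis using z xy' that by linarith
  qed
  have sum: "S (\<lambda>u. u < y) + S (\<lambda>u. x < u) \<le> card (St a b) + S (\<lambda>u. x < u \<and> u < y)"
  proof -
    let ?A = "{(u, t) \<in> St a b. u < y}" and ?B = "{(u, t) \<in> St a b. x < u}"
    have "card ?A + card ?B = card (?A \<union> ?B) + card (?A \<inter> ?B)" using fin by (intro card_Un_Int) auto
    moreover have "card (?A \<union> ?B) \<le> card (St a b)" by (intro card_mono) auto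
    moreover have "?A \<inter> ?B = {(u, t) \<in> St a b. x < u \<and> u < y}" by auto
    ultimately show ?thesis by (simp add: S_def)
  qed
  have choose_y: ?thesis if "y < b" "S (\<lambda>u. u < y) + card R \<le> l"
    using F1[OF that(1)] F2[OF that(1)] Sy[OF that(1)] that no_y xy' z by (intro exI[of _ y]) auto
  have choose_x: ?thesis if "a < x" "S (\<lambda>u. x < u) + card L \<le> l"
    using G1[OF that(1)] G2[OF that(1)] Sx[OF that(1)] that no_x xy' z by (intro exI[of _ x]) auto
  consider "x = a" "y < b" | "a < x" "y = b" | "a < x" "y < b" using xy' by force
  then show ?thesis
  proof cases
    case 1
    have "S (\<lambda>u. u < y) \<le> S (\<lambda>u. x < u \<and> u < y)" using 1 by (intro S_mono) auto
    then show ?thesis using cross 1 by (intro choose_y) auto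
  next
    case 2
    have "S (\<lambda>u. x < u) \<le> S (\<lambda>u. x < u \<and> u < y)" using 2 by (intro S_mono) auto
    then show ?thesis using cross 2 by (intro choose_x) auto
  next
    case 3
    \<comment> \<open>Averaging: leaving edges from between \<open>x\<close> and \<open>y\<close>
      are counted twice, but they cross \<open>(x, y)\<close> too. So the two sums add up to at most
      \<open>card (St a b) + l\<close>, hence to at most \<open>2 * l\<close>.\<close>
    have "S (\<lambda>u. u < y) + card R \<le> l \<or> S (\<lambda>u. x < u) + card L \<le> l"
      using sum cross t by linarith
    then show ?thesis using choose_x[OF 3(1)] choose_y[OF 3(2)] by (elim disjE)
  qed
qed

section \<open>Mirror images\<close>

definition mirror :: "(int \<times> int) set" where
  "mirror = {(i, j). (- j, - i) \<in> E}"

lemma in_mirror [simp]: "(i, j) \<in> mirror \<longleftrightarrow> (- j, - i) \<in> E"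
  by (simp add: mirror_def)

lemma mirror_reverse: "(- t, - u) \<in> E \<longleftrightarrow> (- u, N - t) \<in> E"
  using rotate[of "- t" "- u"] by (simp add: algebra_simps)

lemma mirror_graph: "convex_graph l N mirror"
proof
  show "i + 2 \<le> j \<and> j < i + N" if "(i, j) \<in> mirror" for i j
    using dart[of "- j" "- i"] that by auto
  show "(i, j) \<in> mirror \<longleftrightarrow> (j, i + N) \<in> mirror" for i j
    using period[of "- (i + N)" "- j"] rotate[of "- j" "- i"] by simp
  show "card {(u, t) \<in> mirror. i < u \<and> u < j \<and> j < t \<and> t < i + N} \<le> l" if "(i, j) \<in> mirror" for i j
  proof -
    let ?X = "{(u, t) \<in> mirror. i < u \<and> u < j \<and> j < t \<and> t < i + N}"
    have "(\<lambda>(u, t). (- u, N - t)) ` ?X \<subseteq> St (- j) (- i)"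
      by (auto simp: St_def mirror_reverse)
    moreover have "inj_on (\<lambda>(u, t). (- u, N - t)) ?X" by (auto simp: inj_on_def)
    ultimately have "card ?X \<le> card (St (- j) (- i))" by (intro card_inj_on_le) auto
    then show ?thesis using card_St_edge[of "- j" "- i"] that by auto
  qed
qed

end

lemma (in convex_graph) mirror_state:
  shows "convex_graph.state l N mirror (- b) (- a) = rev (state a b)"
    "convex_graph.val N mirror C (- b) (- a) = val C a b"
    "card (convex_graph.St N mirror (- b) (- a)) = card (St a b)"
proof -
  interpret m: convex_graph l N mirror by (rule mirror_graph)
  have deg: "m.deg (- b) (- a) (- u) = deg a b u" for u
  proof -
    have "{t. (u, t) \<in> E \<and> b < t \<and> t < a + N} = (\<lambda>t. N - t) ` {t. (- u, t) \<in> mirror \<and> - a < t \<and> t < - b + N}"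
    proof (intro equalityI subsetI)
      fix t assume "t \<in> {t. (u, t) \<in> E \<and> b < t \<and> t < a + N}"
      then have "N - t \<in> {t. (- u, t) \<in> mirror \<and> - a < t \<and> t < - b + N}"
        using mirror_reverse[of "N - t" "- u"] by auto
      then show "t \<in> (\<lambda>t. N - t) ` {t. (- u, t) \<in> mirror \<and> - a < t \<and> t < - b + N}" by (rule rev_image_eqI) simp
    qed (auto simp: mirror_reverse[of _ "- u", simplified])
    then have "deg a b u = card ((\<lambda>t. N - t) ` {t. (- u, t) \<in> mirror \<and> - a < t \<and> t < - b + N})"
      by (simp add: deg_def)
    also have "\<dots> = m.deg (- b) (- a) (- u)" unfolding m.deg_def by (rule card_image) (auto simp: inj_on_def)
    finally show ?thesis by simp
  qed
  have bij: "{(i, j) \<in> mirror. P i j} = (\<lambda>(i, j). (- j, - i)) ` {(i, j) \<in> E. P (- j) (- i)}" for P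
  proof (intro equalityI subsetI)
    fix p assume "p \<in> {(i, j) \<in> mirror. P i j}"
    then show "p \<in> (\<lambda>(i, j). (- j, - i)) ` {(i, j) \<in> E. P (- j) (- i)}"
      by (intro rev_image_eqI[of "(- snd p, - fst p)"]) auto
  qed auto
  have card_bij: "card {(i, j) \<in> mirror. P i j} = card {(i, j) \<in> E. P (- j) (- i)}" for P
    unfolding bij by (rule card_image) (auto simp: inj_on_def)
  have inc: "m.inc (- b) (- a) (- u) = inc a b u" for u
    unfolding m.inc_def inc_def card_bij by (intro arg_cong[where f = card]) auto
  have "m.verts (- b) (- a) = rev (map uminus (verts a b))"
  proof (rule strict_sorted_equal)
    show "sorted_wrt (<) (m.verts (- b) (- a))" by (rule m.sorted_verts)
    show "sorted_wrt (<) (rev (map uminus (verts a b)))"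
      using sorted_verts[of a b] by (simp add: sorted_wrt_rev sorted_wrt_map)
    show "set (m.verts (- b) (- a)) = set (rev (map uminus (verts a b)))"
    proof (intro equalityI subsetI)
      fix v assume "v \<in> set (m.verts (- b) (- a))"
      then have "- v \<in> set (verts a b)" using deg[of "- v"] by (auto simp: m.set_verts set_verts)
      then show "v \<in> set (rev (map uminus (verts a b)))" by (auto intro!: rev_image_eqI[of "- v"])
    qed (auto simp: m.set_verts set_verts deg)
  qed
  then show "m.state (- b) (- a) = rev (state a b)"
    unfolding m.state_def state_def by (simp add: rev_map deg inc comp_def)
  have "m.In (- b) (- a) = {(i, j) \<in> mirror. - b \<le> i \<and> j \<le> - a}" by (simp add: m.In_def)
  then have In: "card (m.In (- b) (- a)) = card (In a b)"
    unfolding In_def by (simp only: card_bij) (intro arg_cong[where f = card], auto)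
  show St: "card (m.St (- b) (- a)) = card (St a b)"
  proof -
    have "(\<Sum>u\<in>{- b<..<- a}. m.deg (- b) (- a) u) = (\<Sum>u\<in>uminus ` {a<..<b}. m.deg (- b) (- a) u)" by simp
    also have "\<dots> = (\<Sum>u\<in>{a<..<b}. deg a b u)" by (subst sum.reindex) (auto simp: inj_on_def deg)
    finally show ?thesis by (simp add: m.card_St card_St)
  qed
  show "m.val C (- b) (- a) = val C a b" unfolding m.val_def val_def In St by simp
qed

context graph_potential
begin

theorem bounded_chord:
  "a < b \<Longrightarrow> b < a + N \<Longrightarrow> card (St a b) \<le> l \<Longrightarrow> bounded (state a b) (nat (b - a - 1)) (val C a b)"
proof (induction "nat (b - a)" arbitrary: a b rule: less_induct)
  case less
  show ?case
  proof (cases "b = a + 1")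
    case True
    have "St a b = {}" "In a b = {}" "verts a b = []" using True dart by (auto simp: St_def In_def verts_def) force
    then show ?thesis using True bounded_side by (simp add: state_def val_def)
  next
    case False
    then have "a + 2 \<le> b" using less.prems by simp
    from apex[OF this less.prems(2,3)] obtain d where d: "a < d" "d < b" "card (St a d) \<le> l" "card (St d b) \<le> l"
      and free: "(\<forall>w. d < w \<and> w < b \<longrightarrow> (a, w) \<notin> E) \<or> (\<forall>u. a < u \<and> u < d \<longrightarrow> (u, b) \<notin> E)" by blast
    have L: "bounded (state a d) (nat (d - a - 1)) (val C a d)" using less d by (intro less.hyps) auto
    have R: "bounded (state d b) (nat (b - d - 1)) (val C d b)" using less d by (intro less.hyps) auto
    from free show ?thesis
    proof
      assume "\<forall>w. d < w \<and> w < b \<longrightarrow> (a, w) \<notin> E"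
      then have "split_chord l N E a d b" using d less.prems by unfold_locales auto
      from step[OF this L R less.prems(3)] show ?thesis .
    next
      \<comment> \<open>Reflection exchanges the ends of the chord, so that the missing edges at
        \<open>b\<close> become the missing edges at the first end.\<close>
      assume no: "\<forall>u. a < u \<and> u < d \<longrightarrow> (u, b) \<notin> E"
      interpret m: convex_graph l N mirror by (rule mirror_graph)
      interpret mp: graph_potential l M c C K T N mirror ..
      have "split_chord l N mirror (- b) (- d) (- a)"
        using d less.prems no by unfold_locales auto
      moreover have "bounded (m.state (- b) (- d)) (nat (- d - - b - 1)) (m.val C (- b) (- d))"
        using bounded_rev[OF R] by (simp add: mirror_state algebra_simps)
      moreover have "bounded (m.state (- d) (- a)) (nat (- a - - d - 1)) (m.val C (- d) (- a))"
        using bounded_rev[OF L] by (simp add: mirror_state algebra_simps)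
      moreover have "card (m.St (- b) (- a)) \<le> l" using less.prems(3) by (simp add: mirror_state)
      ultimately have "bounded (m.state (- b) (- a)) (nat (- a - - b - 1)) (m.val C (- b) (- a))"
        by (rule mp.step)
      from bounded_rev[OF this] show ?thesis by (simp add: mirror_state algebra_simps)
    qed
  qed
qed

end

section \<open>Upper bounds\<close>

definition interleave :: "nat \<times> nat \<Rightarrow> nat \<times> nat \<Rightarrow> bool" where
  "interleave e f \<longleftrightarrow> fst e < fst f \<and> fst f < snd e \<and> snd e < snd f \<or>
     fst f < fst e \<and> fst e < snd f \<and> snd f < snd e"

definition chords :: "nat \<Rightarrow> (nat \<times> nat) set" where
  "chords n = {(i, j). i + 2 \<le> j \<and> j < n \<and> (i, j) \<noteq> (0, n - 1)}"

definition limited :: "nat \<Rightarrow> nat \<Rightarrow> (nat \<times> nat) set \<Rightarrow> bool" where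
  "limited l n G \<longleftrightarrow> G \<subseteq> chords n \<and> (\<forall>e\<in>G. card {f \<in> G. interleave e f} \<le> l)"

lemma finite_chords [simp]: "finite (chords n)"
  by (rule finite_subset[of _ "{..<n} \<times> {..<n}"]) (auto simp: chords_def)

lemma limited_finite: "limited l n G \<Longrightarrow> finite G"
  using finite_subset[OF _ finite_chords] by (auto simp: limited_def)

text \<open>Recovers the period of a translated label from an inequality; used in both directions,
  it pins down which translate of a dart is meant.\<close>

lemma period_le:
  fixes N :: int
  assumes "a + r * N < b + s * N" "b - a \<le> k * N" "0 < N"
  shows "r < s + k"
proof -
  have "r * N < (s + k) * N" using assms(1,2) by (simp add: algebra_simps)
  then show ?thesis using assms(3) by simp
qed

text \<open>
  The period is \<open>n + 1\<close>: an additional vertex turns the side \<open>(0, n - 1)\<close> into a chord behind which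
  the whole polygon lies.
\<close>

definition darts :: "nat \<Rightarrow> (nat \<times> nat) set \<Rightarrow> (int \<times> int) set" where
  "darts n G = {(i, j). \<exists>p q t. (p, q) \<in> G \<and>
     (i = int p + t * (int n + 1) \<and> j = int q + t * (int n + 1) \<or>
      i = int q + t * (int n + 1) \<and> j = int p + (t + 1) * (int n + 1))}"

lemma darts_cases:
  assumes "(i, j) \<in> darts n G"
  obtains (same) p q t where "(p, q) \<in> G" "i = int p + t * (int n + 1)" "j = int q + t * (int n + 1)"
  | (reverse) p q t where "(p, q) \<in> G" "i = int q + t * (int n + 1)" "j = int p + (t + 1) * (int n + 1)"
  using assms unfolding darts_def by blast

lemma darts_same: "(p, q) \<in> G \<Longrightarrow> (int p + t * (int n + 1), int q + t * (int n + 1)) \<in> darts n G"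
  unfolding darts_def by blast

lemma darts_next: "(p, q) \<in> G \<Longrightarrow> (int q + t * (int n + 1), int p + (t + 1) * (int n + 1)) \<in> darts n G"
  unfolding darts_def by blast

text \<open>The side \<open>(0, n - 1)\<close> may be inserted as an edge because no diagonal
  crosses it. It costs nothing and later sharpens the bound by one edge.\<close>

lemma darts_graph:
  assumes G: "limited l n G" and n: "3 \<le> n"
  shows "convex_graph l (int n + 1) (darts n (insert (0, n - 1) G))"
proof
  let ?N = "int n + 1" and ?G = "insert (0, n - 1) G"
  have edge: "p + 2 \<le> q" "q < n" if "(p, q) \<in> ?G" for p q
    using that G n by (auto simp: limited_def chords_def)
  show "i + 2 \<le> j \<and> j < i + ?N" if "(i, j) \<in> darts n ?G" for i j
    using that by (cases rule: darts_cases) (use edge in \<open>force simp: algebra_simps\<close>)+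
  show "(i, j) \<in> darts n ?G \<longleftrightarrow> (j, i + ?N) \<in> darts n ?G" for i j
  proof
    assume "(i, j) \<in> darts n ?G"
    then show "(j, i + ?N) \<in> darts n ?G"
    proof (cases rule: darts_cases)
      case (same p q t)
      then show ?thesis using darts_next[of p q ?G t n] by (simp add: algebra_simps)
    next
      case (reverse p q t)
      then show ?thesis using darts_same[of p q ?G "t + 1" n] by (simp add: algebra_simps)
    qed
  next
    assume "(j, i + ?N) \<in> darts n ?G"
    then show "(i, j) \<in> darts n ?G"
    proof (cases rule: darts_cases)
      case (same p q t)
      then have "i = int q + (t - 1) * ?N" "j = int p + (t - 1 + 1) * ?N" by (auto simp: algebra_simps)
      then show ?thesis using darts_next[OF same(1), of "t - 1" n] by (simp only:)
    next
      case (reverse p q t)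
      then show ?thesis using darts_same[of p q ?G t n] by (simp add: algebra_simps)
    qed
  qed
  have few: "card (h ` {f \<in> ?G. interleave e f}) \<le> l" if "e \<in> ?G" for e and h :: "nat \<times> nat \<Rightarrow> int \<times> int"
  proof -
    have fin: "finite G" using G by (rule limited_finite)
    have free: "\<not> interleave f (0, n - 1)" "\<not> interleave (0, n - 1) f" if "f \<in> ?G" for f
      using edge[of "fst f" "snd f"] that by (cases f; auto simp: interleave_def)+
    have "card {f \<in> ?G. interleave e f} \<le> l"
    proof (cases "e \<in> G")
      case True
      then have "{f \<in> ?G. interleave e f} = {f \<in> G. interleave e f}" using free(1)[of e] by blast
      then show ?thesis using G True by (simp add: limited_def)
    next
      case False
      then have "e = (0, n - 1)" using that by blast
      then have "{f \<in> ?G. interleave e f} = {}" using free(2) by blast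
      then show ?thesis by (simp only: card.empty)
    qed
    moreover have "card (h ` {f \<in> ?G. interleave e f}) \<le> card {f \<in> ?G. interleave e f}"
      using fin by (intro card_image_le) auto
    ultimately show ?thesis by linarith
  qed
  have fin: "finite {f \<in> ?G. interleave e f}" for e using limited_finite[OF G] by auto
  show "card {(u, t) \<in> darts n ?G. i < u \<and> u < j \<and> j < t \<and> t < i + ?N} \<le> l" (is "card ?X \<le> l")
    if "(i, j) \<in> darts n ?G" for i j
    using that
  proof (cases rule: darts_cases)
    case (same p q s)
    \<comment> \<open>Selects, for a crossing edge, its unique dart that starts between
      \<open>i\<close> and \<open>j\<close>.\<close>
    let ?h = "\<lambda>(a, b). if p < a then (int a + s * ?N, int b + s * ?N) else (int b + s * ?N, int a + (s + 1) * ?N)"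
    have "?X \<subseteq> ?h ` {f \<in> ?G. interleave (p, q) f}"
    proof safe
      fix u t assume ut: "(u, t) \<in> darts n ?G" "i < u" "u < j" "j < t" "t < i + ?N"
      note pq = edge[OF same(1)]
      from ut(1) show "(u, t) \<in> ?h ` {f \<in> ?G. interleave (p, q) f}"
      proof (cases rule: darts_cases)
        case (same a b r)
        note ab = edge[OF same(1)]
        have "r < s + 1" "s < r + 1"
          using period_le[of "int a" r ?N "int q" s 1] period_le[of "int p" s ?N "int a" r 1] ut same pq ab
            \<open>i = _\<close> \<open>j = _\<close> by auto
        then have "r = s" by simp
        then have "p < a" "a < q" "q < b" using ut same \<open>i = _\<close> \<open>j = _\<close> by auto
        then show ?thesis using same \<open>r = s\<close> by (intro image_eqI[of _ _ "(a, b)"]) (auto simp: interleave_def)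
      next
        case (reverse a b r)
        note ab = edge[OF reverse(1)]
        have "r < s + 1" "s < r + 1"
          using period_le[of "int b" r ?N "int q" s 1] period_le[of "int p" s ?N "int b" r 1] ut reverse pq ab
            \<open>i = _\<close> \<open>j = _\<close> by auto
        then have "r = s" by simp
        then have "p < b" "b < q" "a < p" using ut reverse \<open>i = _\<close> \<open>j = _\<close> by (auto simp: algebra_simps)
        then show ?thesis using reverse \<open>r = s\<close> by (intro image_eqI[of _ _ "(a, b)"]) (auto simp: interleave_def)
      qed
    qed
    then have "card ?X \<le> card (?h ` {f \<in> ?G. interleave (p, q) f})" using fin by (intro card_mono) auto
    then show ?thesis using few[OF same(1), of ?h] by linarith
  next
    case (reverse p q s)
    let ?h = "\<lambda>(a, b). if p < a then (int b + s * ?N, int a + (s + 1) * ?N)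
      else (int a + (s + 1) * ?N, int b + (s + 1) * ?N)"
    have "?X \<subseteq> ?h ` {f \<in> ?G. interleave (p, q) f}"
    proof safe
      fix u t assume ut: "(u, t) \<in> darts n ?G" "i < u" "u < j" "j < t" "t < i + ?N"
      note pq = edge[OF reverse(1)]
      from ut(1) show "(u, t) \<in> ?h ` {f \<in> ?G. interleave (p, q) f}"
      proof (cases rule: darts_cases)
        case (same a b r)
        note ab = edge[OF same(1)]
        have "r < (s + 1) + 1" "s < r + 1"
          using period_le[of "int a" r ?N "int p" "s + 1" 1] period_le[of "int q" s ?N "int a" r 1] ut same pq ab
            \<open>i = _\<close> \<open>j = _\<close> by auto
        then consider "r = s" | "r = s + 1" by linarith
        then have r: "r = s + 1" using ut same pq ab \<open>i = _\<close> \<open>j = _\<close> by cases (auto simp: algebra_simps)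
        then have "a < p" "p < b" "b < q" using ut same \<open>i = _\<close> \<open>j = _\<close> by (auto simp: algebra_simps)
        then show ?thesis using same r by (intro image_eqI[of _ _ "(a, b)"]) (auto simp: interleave_def)
      next
        case (reverse a b r)
        note ab = edge[OF reverse(1)]
        have "r < (s + 1) + 1" "s < r + 1"
          using period_le[of "int b" r ?N "int p" "s + 1" 1] period_le[of "int q" s ?N "int b" r 1] ut reverse pq ab
            \<open>i = _\<close> \<open>j = _\<close> by auto
        then consider "r = s" | "r = s + 1" by linarith
        then have r: "r = s" using ut reverse pq ab \<open>i = _\<close> \<open>j = _\<close> by cases (auto simp: algebra_simps)
        then have "p < a" "a < q" "q < b" using ut reverse \<open>i = _\<close> \<open>j = _\<close> by (auto simp: algebra_simps)
        then show ?thesis using reverse r by (intro image_eqI[of _ _ "(a, b)"]) (auto simp: interleave_def)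
      qed
    qed
    then have "card ?X \<le> card (?h ` {f \<in> ?G. interleave (p, q) f})" using fin by (intro card_mono) auto
    then show ?thesis using few[OF reverse(1), of ?h] by linarith
  qed
qed

text \<open>The whole polygon is the part behind \<open>(0, n - 1)\<close>. The additional vertex
  has no edges, so nothing leaves, the state is empty, and only inner edges remain in the potential;
  the \<open>+ 1\<close> is the inserted side.\<close>

lemma (in potential_table) card_limited:
  assumes G: "limited l n G" and n: "3 \<le> n"
  shows "\<exists>v. ([], v) \<in> entries T \<and> 4 * (int (card G) + 1) \<le> C * int (n - 2) + K + int (v ! ((n - 2) mod M))"
proof -
  let ?G = "insert (0, n - 1) G" and ?b = "int (n - 1)"
  define B where "B = darts n ?G"
  interpret convex_graph l "int n + 1" B unfolding B_def using assms by (rule darts_graph)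
  interpret graph_potential l M c C K T "int n + 1" B ..
  have edge: "p + 2 \<le> q" "q < n" if "(p, q) \<in> ?G" for p q
    using that G n by (auto simp: limited_def chords_def)
  have no_end: "(u, t) \<notin> B" if "?b < t" "t < int n + 1" for u t
  proof
    assume "(u, t) \<in> B"
    then have "(u, t) \<in> darts n ?G" by (simp only: B_def)
    then show False
    proof (cases rule: darts_cases)
      case (same p q r)
      have "r < 0 + 1" "-1 < r"
        using period_le[of "int q" r "int n + 1" "0" 1 0] period_le[of "-1" "0" "int n + 1" "int q" r 1] same that edge[OF same(1)] n
        by auto
      then have "r = 0" by simp
      then show False using same that edge[OF same(1)] by auto
    next
      case (reverse p q r)
      have "r + 1 < 1" "-1 < r + 1"
        using period_le[of "int p" "r + 1" "int n + 1" "0" 1 0] period_le[of "-1" "0" "int n + 1" "int p" "r + 1" 1] reverse that edge[OF reverse(1)] n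
        by auto
      then have "r + 1 = 0" by simp
      then have "t = int p" using reverse by simp
      then show False using that edge[OF reverse(1)] by auto
    qed
  qed
  have St: "St 0 ?b = {}" and deg: "deg 0 ?b u = 0" for u
    using no_end by (auto simp: St_def deg_def)
  have "bounded (state 0 ?b) (nat (?b - 0 - 1)) (val C 0 ?b)"
    using n St by (intro bounded_chord) auto
  moreover have "state 0 ?b = []" by (simp only: state_def verts_def deg) simp
  ultimately have "bounded [] (n - 2) (4 * int (card (In 0 ?b)) - C * int (n - 2))"
    using n St by (simp add: val_def nat_diff_distrib of_nat_diff)
  then obtain s v where v: "(s, v) \<in> entries T" "below [] s"
    "4 * int (card (In 0 ?b)) - C * int (n - 2) \<le> K + int (v ! ((n - 2) mod M))"
    unfolding bounded_def by auto
  have "s = []" using v(2) by (cases s) auto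
  have "card ((\<lambda>(p, q). (int p, int q)) ` ?G) \<le> card (In 0 ?b)"
  proof (rule card_mono)
    have "(int p, int q) \<in> In 0 ?b" if "(p, q) \<in> ?G" for p q
    proof -
      have "(int p, int q) \<in> B" "q < n"
        using darts_same[OF that, of 0 n] edge[OF that] by (simp_all add: B_def)
      then show ?thesis by (simp add: In_def)
    qed
    then show "(\<lambda>(p, q). (int p, int q)) ` ?G \<subseteq> In 0 ?b" by (intro image_subsetI) (simp only: case_prod_beta prod.collapse)
  qed simp
  moreover have "card ((\<lambda>(p, q). (int p, int q)) ` ?G) = card ?G" by (rule card_image) (auto simp: inj_on_def)
  moreover have "card ?G = card G + 1"
    using limited_finite[OF G] G by (subst card_insert_disjoint) (auto simp: limited_def chords_def)
  ultimately show ?thesis using v \<open>s = []\<close> by (intro exI[of _ v]) auto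
qed

text \<open>Executable form of the conditions on a table. A list of positive numbers with sum at
  most \<open>l\<close> has length and entries at most \<open>l\<close>, so
  \<open>List.n_lists\<close> enumerates all candidates for the default entries.\<close>

definition closed_table :: "nat \<Rightarrow> nat \<Rightarrow> table \<Rightarrow> bool" where
  "closed_table l M T \<longleftrightarrow>
    (let es = concat (map (\<lambda>(hi, k, es). es) T) in
     list_all (\<lambda>(hi, k, es). list_all (\<lambda>(s, v). k = stubs s \<and> length v = M \<and> list_all (\<lambda>x. x \<le> hi) v) es) T \<and>
     list_all (\<lambda>(s, v). List.member es (rev s, v)) es \<and>
     list_all (\<lambda>ks. sum_list ks \<le> l \<longrightarrow> list_ex (\<lambda>(s, v). s = map (\<lambda>k. (k, l)) ks) es)
       (concat (map (\<lambda>n. List.n_lists n [1..<Suc l]) [0..<Suc l])))"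

lemma length_le_sum_list:
  fixes ks :: "nat list"
  assumes "\<forall>k\<in>set ks. 0 < k"
  shows "length ks \<le> sum_list ks"
  using assms by (induction ks) (auto simp: Suc_le_eq intro: add_less_le_mono)

lemma potential_tableI:
  assumes "int c = C - K" "0 < M" "check T l c (accept T c) T" and closed: "closed_table l M T"
    and side: "\<exists>v. ([], v) \<in> entries T \<and> 0 \<le> K + int (v ! 0)"
  shows "potential_table l M c C K T"
proof
  have entries: "entries T = set (concat (map (\<lambda>(hi, k, es). es) T))"
    by (auto simp: entries_def)
  show "k = stubs s \<and> length v = M \<and> (\<forall>x\<in>set v. x \<le> hi)"
    if "(hi, k, es) \<in> set T" "(s, v) \<in> set es" for hi k es s v
    using closed that unfolding closed_table_def Let_def list_all_iff by fast
  show "(rev s, v) \<in> entries T" if "(s, v) \<in> entries T" for s v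
    using closed that unfolding closed_table_def Let_def list_all_iff entries List.member_iff by fast
  show "map (\<lambda>k. (k, l)) ks \<in> fst ` entries T" if ks: "\<forall>k\<in>set ks. 0 < k" "sum_list ks \<le> l" for ks
  proof -
    have all: "\<forall>ks\<in>set (concat (map (\<lambda>n. List.n_lists n [1..<Suc l]) [0..<Suc l])).
        sum_list ks \<le> l \<longrightarrow> list_ex (\<lambda>(s, v). s = map (\<lambda>k. (k, l)) ks) (concat (map (\<lambda>(hi, k, es). es) T))"
      using closed unfolding closed_table_def Let_def list_all_iff by (elim conjE)
    have "set ks \<subseteq> set [1..<Suc l]"
    proof
      fix k assume "k \<in> set ks"
      then have "0 < k" "k \<le> l" using member_le_sum_list[of k ks] ks by auto
      then show "k \<in> set [1..<Suc l]" by auto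
    qed
    then have "ks \<in> set (List.n_lists (length ks) [1..<Suc l])" by (simp only: set_n_lists mem_Collect_eq simp_thms)
    moreover have "length ks \<in> set [0..<Suc l]" using length_le_sum_list[OF ks(1)] ks(2) by auto
    ultimately have "ks \<in> set (concat (map (\<lambda>n. List.n_lists n [1..<Suc l]) [0..<Suc l]))"
      unfolding set_concat set_map by blast
    then have "list_ex (\<lambda>(s, v). s = map (\<lambda>k. (k, l)) ks) (concat (map (\<lambda>(hi, k, es). es) T))"
      using all ks(2) by (blast dest: bspec)
    then show ?thesis unfolding entries list_ex_iff by force
  qed
qed (rule assms)+

section \<open>Upper bounds for at most four crossings per edge\<close>

definition table0 :: table where "table0 = [(0, 0, [([], [0])])]"

lemma check_table0: "check table0 0 4 (accept table0 4) table0" by code_simp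

lemma closed_table0: "closed_table 0 1 table0" by code_simp
lemma closed_table1: "closed_table 1 2 table1" by code_simp
lemma closed_table2: "closed_table 2 3 table2" by code_simp
lemma closed_table3: "closed_table 3 4 table3" by code_simp
lemma closed_table4: "closed_table 4 4 table4" by code_simp

lemma root_table0: "([], v) \<in> entries table0 \<longleftrightarrow> v = [0]" by (auto simp: entries_def table0_def)
lemma root_table1: "([], v) \<in> entries table1 \<longleftrightarrow> v = [2, 0]" by (auto simp: entries_def table1_def)
lemma root_table2: "([], v) \<in> entries table2 \<longleftrightarrow> v = [4, 0, 0]" by (auto simp: entries_def table2_def)
lemma root_table3: "([], v) \<in> entries table3 \<longleftrightarrow> v = [5, 1, 1, 2]" by (auto simp: entries_def table3_def)
lemma root_table4: "([], v) \<in> entries table4 \<longleftrightarrow> v = [6, 4, 2, 2]" by (auto simp: entries_def table4_def)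

text \<open>The maximum for \<open>m + 2\<close> vertices, increased by one for an inserted side.
  For \<open>l = 4\<close> the formula is too large for the triangle and the quadrilateral, whence
  the restriction to at least five vertices below.\<close>

definition extremal :: "nat \<Rightarrow> nat \<Rightarrow> nat" where
  "extremal l m =
    (if l = 0 then m else if l = 1 then 3 * m div 2 else if l = 2 then 2 * m - of_bool (\<not> 3 dvd m)
     else if l = 3 then 9 * (m div 4) + (m mod 4) * (m mod 4 + 1) div 2 else 2 * m + 2 * (m div 4))"

text \<open>Dividing the table bound by 4 and rounding down gives the closed form in every residue
  class.\<close>

lemma card_limited_le:
  assumes "limited l n G" "3 \<le> n" "l \<le> 4"
  shows "card G + 1 \<le> extremal l (n - 2)"
proof -
  let ?m = "n - 2"
  consider "l = 0" | "l = 1" | "l = 2" | "l = 3" | "l = 4" using assms(3) by linarith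
  then show ?thesis
  proof cases
    case 1
    interpret potential_table 0 1 4 4 0 table0
      by (rule potential_tableI[OF _ _ check_table0 closed_table0]) (auto simp: root_table0)
    show ?thesis using card_limited[of n G] assms 1 by (auto simp: extremal_def root_table0)
  next
    case 2
    interpret potential_table 1 2 8 6 "-2" table1
      by (rule potential_tableI[OF _ _ check_table1[unfolded accept1_def] closed_table1]) (auto simp: root_table1)
    have "4 * (int (card G) + 1) \<le> 6 * int ?m - 2 + int ([2, 0] ! (?m mod 2))"
      using card_limited[of n G] assms 2 by (auto simp: root_table1)
    moreover have "?m mod 2 = 0 \<or> ?m mod 2 = 1" by linarith
    ultimately have "2 * (card G + 1) \<le> 3 * ?m" by auto
    then show ?thesis using 2 by (simp add: extremal_def)
  next
    case 3
    interpret potential_table 2 3 12 8 "-4" table2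
      by (rule potential_tableI[OF _ _ check_table2[unfolded accept2_def] closed_table2]) (auto simp: root_table2)
    have "4 * (int (card G) + 1) \<le> 8 * int ?m - 4 + int ([4, 0, 0] ! (?m mod 3))"
      using card_limited[of n G] assms 3 by (auto simp: root_table2)
    moreover have "?m mod 3 = 0 \<or> ?m mod 3 = 1 \<or> ?m mod 3 = 2" by linarith
    ultimately show ?thesis using 3 by (auto simp: extremal_def dvd_eq_mod_eq_0)
  next
    case 4
    interpret potential_table 3 4 14 9 "-5" table3
      by (rule potential_tableI[OF _ _ check_table3[unfolded accept3_def] closed_table3]) (auto simp: root_table3)
    have "4 * (int (card G) + 1) \<le> 9 * int ?m - 5 + int ([5, 1, 1, 2] ! (?m mod 4))"
      using card_limited[of n G] assms 4 by (auto simp: root_table3)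
    moreover have "?m mod 4 = 0 \<or> ?m mod 4 = 1 \<or> ?m mod 4 = 2 \<or> ?m mod 4 = 3" by linarith
    moreover have "?m = 4 * (?m div 4) + ?m mod 4" by simp
    ultimately show ?thesis using 4 unfolding extremal_def by (elim disjE; simp)
  next
    case 5
    interpret potential_table 4 4 16 10 "-6" table4
      by (rule potential_tableI[OF _ _ check_table4[unfolded accept4_def] closed_table4]) (auto simp: root_table4)
    have "4 * (int (card G) + 1) \<le> 10 * int ?m - 6 + int ([6, 4, 2, 2] ! (?m mod 4))"
      using card_limited[of n G] assms 5 by (auto simp: root_table4)
    moreover have "?m mod 4 = 0 \<or> ?m mod 4 = 1 \<or> ?m mod 4 = 2 \<or> ?m mod 4 = 3" by linarith
    moreover have "?m = 4 * (?m div 4) + ?m mod 4" by simp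
    ultimately show ?thesis using 5 unfolding extremal_def by (elim disjE; simp)
  qed
qed

section \<open>Lower bounds\<close>

definition attained :: "nat \<Rightarrow> nat \<Rightarrow> nat \<Rightarrow> bool" where
  "attained l n c \<longleftrightarrow> (\<exists>G. limited l n G \<and> card G = c)"

lemma attainedI:
  assumes "distinct xs" "list_all (\<lambda>(i, j). i + 2 \<le> j \<and> j < n \<and> (i, j) \<noteq> (0, n - 1)) xs"
    "list_all (\<lambda>e. length (filter (interleave e) xs) \<le> l) xs" "length xs = c"
  shows "attained l n c"
proof -
  have "card {f \<in> set xs. interleave e f} = length (filter (interleave e) xs)" for e
    using assms(1) by (simp flip: set_filter add: distinct_card)
  then show ?thesis
    using assms unfolding attained_def limited_def list_all_iff
    by (intro exI[of _ "set xs"]) (auto simp: chords_def distinct_card)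
qed

text \<open>The side along which the polygons are glued becomes a diagonal crossed by nothing: this
  is the \<open>+ 1\<close>.\<close>

lemma attained_glue:
  assumes "attained l n c" "attained l (s + 2) d" and n: "3 \<le> n" and s: "1 \<le> s"
  shows "attained l (n + s) (c + 1 + d)"
proof -
  obtain G H where G: "limited l n G" "card G = c" and H: "limited l (s + 2) H" "card H = d"
    using assms by (auto simp: attained_def)
  \<comment> \<open>Fixes 0 and sends 1 to \<open>n - 1\<close>: the side of the second polygon
    between 0 and 1 is identified with the side \<open>(0, n - 1)\<close> of the first.\<close>
  define h where "h i = (if i = 0 then 0 else i + (n - 2))" for i :: nat
  define k where "k = (\<lambda>(i, j). (h i, h j))"
  have h_less: "h i < h j \<longleftrightarrow> i < j" for i j using n by (auto simp: h_def)
  have h_eq: "h i = h j \<longleftrightarrow> i = j" for i j using n by (auto simp: h_def)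
  have "inj k" by (auto simp: inj_on_def k_def h_eq)
  have k: "interleave (k e) (k f) \<longleftrightarrow> interleave e f" for e f
    by (cases e; cases f) (simp add: interleave_def k_def h_less)
  let ?b = "(0, n - 1)" and ?U = "insert (0, n - 1) (G \<union> k ` H)"
  have inG: "i + 2 \<le> j" "j < n" "(i, j) \<noteq> ?b" if "(i, j) \<in> G" for i j
    using that G by (auto simp: limited_def chords_def)
  have inH: "(i = 0 \<or> n - 1 \<le> i) \<and> n \<le> j \<and> i + 2 \<le> j \<and> j < n + s \<and> (i, j) \<noteq> (0, n + s - 1)" if ij: "(i, j) \<in> k ` H" for i j
  proof -
    obtain a b where ab: "(a, b) \<in> H" "i = h a" "j = h b" using ij by (auto simp: k_def)
    then have "(a, b) \<in> chords (s + 2)" using H by (auto simp: limited_def)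
    then have "a + 2 \<le> b" "b < s + 2" "\<not> (a = 0 \<and> b = s + 1)" by (auto simp: chords_def)
    then show ?thesis using n ab by (cases "a = 0") (auto simp: h_def)
  qed
  have fin: "finite G" "finite H" using G H by (auto intro: limited_finite)
  have "limited l (n + s) ?U"
    unfolding limited_def
  proof (intro conjI ballI subsetI)
    fix e assume "e \<in> ?U"
    then show "e \<in> chords (n + s)"
      using inG[of "fst e" "snd e"] inH[of "fst e" "snd e"] n s by (cases e) (auto simp: chords_def)
  next
    fix e assume e: "e \<in> ?U"
    then consider "e = ?b" | "e \<in> G" | e' where "e = k e'" "e' \<in> H" by auto
    then show "card {f \<in> ?U. interleave e f} \<le> l"
    proof cases
      case 1
      have "\<not> interleave e f" if "f \<in> ?U" for f
        using that inG[of "fst f" "snd f"] inH[of "fst f" "snd f"] 1 by (cases f) (auto simp: interleave_def)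
      then have "{f \<in> ?U. interleave e f} = {}" by blast
      then show ?thesis by (simp only: card.empty)
    next
      case 2
      have "\<not> interleave e f" if "f \<in> insert ?b (k ` H)" for f
        using that inG[of "fst e" "snd e"] inH[of "fst f" "snd f"] 2 by (cases f; cases e) (auto simp: interleave_def)
      then have "{f \<in> ?U. interleave e f} = {f \<in> G. interleave e f}" by blast
      then show ?thesis using G 2 by (simp add: limited_def)
    next
      case 3
      have "\<not> interleave e f" if "f \<in> insert ?b G" for f
        using that inG[of "fst f" "snd f"] inH[of "fst e" "snd e"] 3 by (cases f; cases e) (auto simp: interleave_def)
      then have "{f \<in> ?U. interleave e f} = k ` {f \<in> H. interleave e' f}" using 3 k by blast
      then have "card {f \<in> ?U. interleave e f} \<le> card {f \<in> H. interleave e' f}"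
        using fin by (simp add: card_image_le)
      also have "\<dots> \<le> l" using H 3 by (simp add: limited_def)
      finally show ?thesis .
    qed
  qed
  moreover have "card ?U = c + 1 + d"
  proof -
    have "snd e < n" if "e \<in> G" for e using inG[of "fst e" "snd e"] that by simp
    moreover have "n \<le> snd e" if "e \<in> k ` H" for e using inH[of "fst e" "snd e"] that by simp
    ultimately have "G \<inter> k ` H = {}" "(0, n - 1) \<notin> k ` H" using n by fastforce+
    moreover have "(0, n - 1) \<notin> G" using inG(3) by blast
    moreover have "card (k ` H) = d" using \<open>inj k\<close> H by (simp add: card_image inj_on_subset)
    ultimately show ?thesis using fin G by (simp add: card_Un_disjoint)
  qed
  ultimately show ?thesis by (auto simp: attained_def)
qed

lemma attained_periodic:
  assumes base: "\<And>n. b \<le> n \<Longrightarrow> n < b + s \<Longrightarrow> attained l n (f n)"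
    and d: "attained l (s + 2) d" and f: "\<And>n. b \<le> n \<Longrightarrow> f (n + s) = f n + 1 + d"
    and b: "3 \<le> b" and s: "1 \<le> s"
  shows "b \<le> n \<Longrightarrow> attained l n (f n)"
proof (induction n rule: less_induct)
  case (less n)
  show ?case
  proof (cases "n < b + s")
    case False
    then have "attained l (n - s) (f (n - s))" using less s by auto
    from attained_glue[OF this d] False b s f[of "n - s"] show ?thesis by simp
  qed (use base less in blast)
qed

lemma attained_extremal:
  assumes "l \<le> 4" "5 \<le> n"
  shows "attained l n (extremal l (n - 2) - 1)"
proof -
  have triangle: "attained l 3 0" for l by (rule attainedI[of "[]"]) auto
  have square: "attained l 4 2" if "1 \<le> l" for l
    by (rule attainedI[of "[(0, 2), (1, 3)]"]) (use that in \<open>auto simp: interleave_def\<close>)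
  have pentagon: "attained l 5 5" if "2 \<le> l" for l
    by (rule attainedI[of "[(0, 2), (1, 3), (2, 4), (0, 3), (1, 4)]"]) (use that in \<open>auto simp: interleave_def\<close>)
  \<comment> \<open>In the full hexagon the long diagonals are crossed four times and the short ones
    three times. Leaving out the long diagonal \<open>(2, 5)\<close> relieves the other two long
    ones.\<close>
  have hexagon: "attained 3 6 8"
    by (rule attainedI[of "[(0, 2), (1, 3), (2, 4), (3, 5), (0, 4), (1, 5), (0, 3), (1, 4)]"]) code_simp+
  have complete_hexagon: "attained 4 6 9"
    by (rule attainedI[of "[(0, 2), (1, 3), (2, 4), (3, 5), (0, 4), (1, 5), (0, 3), (1, 4), (2, 5)]"]) code_simp+
  have heptagon: "attained 4 7 11"
    by (rule attainedI[of "[(0, 2), (0, 4), (0, 5), (1, 3), (1, 4), (1, 6), (2, 4), (2, 5), (2, 6), (3, 5), (4, 6)]"])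
      code_simp+
  have octagon: "attained 4 8 13"
    by (rule attainedI[of "[(0, 2), (0, 3), (0, 4), (0, 6), (1, 3), (1, 4), (1, 6), (1, 7), (2, 4), (3, 5),
      (3, 6), (4, 6), (5, 7)]"]) code_simp+
  consider "l = 0" | "l = 1" | "l = 2" | "l = 3" | "l = 4" using assms by linarith
  then show ?thesis
  proof cases
    case 1
    have "attained 0 n (extremal 0 (n - 2) - 1)"
    proof (rule attained_periodic[where b = 3 and s = 1 and d = 0])
      fix n :: nat
      show "attained 0 n (extremal 0 (n - 2) - 1)" if range: "3 \<le> n" "n < 3 + 1"
      proof -
        have "n = 3" using range by linarith
        then show ?thesis using triangle by (simp add: extremal_def)
      qed
      show "attained 0 (1 + 2) 0" using triangle[of 0] by (simp add: numeral_3_eq_3)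
    qed (use assms in \<open>auto simp: extremal_def\<close>)
    then show ?thesis using 1 by simp
  next
    case 2
    have "attained 1 n (extremal 1 (n - 2) - 1)"
    proof (rule attained_periodic[of 3 2])
      fix n :: nat
      show "attained 1 n (extremal 1 (n - 2) - 1)" if range: "3 \<le> n" "n < 3 + 2"
      proof -
        consider "n = 3" | "n = 4" using range by linarith
        then show ?thesis using triangle square by cases (simp_all add: extremal_def)
      qed
      show "extremal 1 (n + 2 - 2) - 1 = extremal 1 (n - 2) - 1 + 1 + 2" if "3 \<le> n"
        using that by (auto simp: extremal_def)
    qed (use square assms in auto)
    then show ?thesis using 2 by simp
  next
    case 3
    have "attained 2 n (extremal 2 (n - 2) - 1)"
    proof (rule attained_periodic[of 3 3])
      fix n :: nat
      show "attained 2 n (extremal 2 (n - 2) - 1)" if range: "3 \<le> n" "n < 3 + 3"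
      proof -
        consider "n = 3" | "n = 4" | "n = 5" using range by linarith
        then show ?thesis using triangle square pentagon by cases (simp_all add: extremal_def)
      qed
      show "extremal 2 (n + 3 - 2) - 1 = extremal 2 (n - 2) - 1 + 1 + 5" if "3 \<le> n"
      proof -
        have "3 dvd n + 1 \<longleftrightarrow> 3 dvd n - 2" using that by presburger
        then show ?thesis using that by (auto simp: extremal_def)
      qed
    qed (use pentagon assms in auto)
    then show ?thesis using 3 by simp
  next
    case 4
    have "attained 3 n (extremal 3 (n - 2) - 1)"
    proof (rule attained_periodic[of 3 4])
      fix n :: nat
      show "attained 3 n (extremal 3 (n - 2) - 1)" if range: "3 \<le> n" "n < 3 + 4"
      proof -
        consider "n = 3" | "n = 4" | "n = 5" | "n = 6" using range by linarith
        then show ?thesis using triangle square pentagon hexagon by cases (simp_all add: extremal_def)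
      qed
      show "extremal 3 (n + 4 - 2) - 1 = extremal 3 (n - 2) - 1 + 1 + 8" if "3 \<le> n"
      proof -
        have "n + 4 - 2 = (n - 2) + 4" using that by simp
        moreover have "extremal 3 (m + 4) = extremal 3 m + 9" for m
        proof -
          have "(m + 4) div 4 = m div 4 + 1" "(m + 4) mod 4 = m mod 4" by presburger+
          then show ?thesis by (simp only: extremal_def) simp
        qed
        moreover have "0 < extremal 3 (n - 2)"
        proof -
          define m where "m = n - 2"
          have m: "0 < m" using \<open>3 \<le> n\<close> by (simp add: m_def)
          have "4 * (m div 4) + m mod 4 = m" "m mod 4 < 4" by simp_all
          then have "0 < m div 4 \<or> m mod 4 = 1 \<or> m mod 4 = 2 \<or> m mod 4 = 3" using m by linarith
          then show ?thesis unfolding m_def[symmetric] by (elim disjE) (simp_all add: extremal_def)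
        qed
        ultimately have "extremal 3 (n + 4 - 2) = extremal 3 (n - 2) + 9" "0 < extremal 3 (n - 2)" by (simp_all only:)
        then show ?thesis by linarith
      qed
    qed (use hexagon assms in auto)
    then show ?thesis using 4 by simp
  next
    case 5
    have "attained 4 n (extremal 4 (n - 2) - 1)"
    \<comment> \<open>The repeated piece is the hexagon with all nine diagonals. The base cases are
      the polygons with five to eight vertices because the formula is not attained below
      five.\<close>
    proof (rule attained_periodic[of 5 4])
      fix n :: nat
      show "attained 4 n (extremal 4 (n - 2) - 1)" if range: "5 \<le> n" "n < 5 + 4"
      proof -
        consider "n = 5" | "n = 6" | "n = 7" | "n = 8" using range by linarith
        then show ?thesis using pentagon complete_hexagon heptagon octagon by cases (simp_all add: extremal_def)
      qed
      show "extremal 4 (n + 4 - 2) - 1 = extremal 4 (n - 2) - 1 + 1 + 9" if "5 \<le> n"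
      proof -
        have "n + 4 - 2 = (n - 2) + 4" using that by simp
        moreover have "extremal 4 (m + 4) = extremal 4 m + 10" for m
        proof -
          have "(m + 4) div 4 = m div 4 + 1" by presburger
          then show ?thesis by (simp only: extremal_def) simp
        qed
        moreover have "0 < extremal 4 (n - 2)" using that by (simp add: extremal_def)
        ultimately have "extremal 4 (n + 4 - 2) = extremal 4 (n - 2) + 10" "0 < extremal 4 (n - 2)" by (simp_all only:)
        then show ?thesis by linarith
      qed
    qed (use complete_hexagon assms in auto)
    then show ?thesis using 5 by simp
  qed
qed

section \<open>Convex polygons in the plane\<close>

text \<open>Twice the signed area of the triangle, positive for counterclockwise order.\<close>

definition orient :: "real^2 \<Rightarrow> real^2 \<Rightarrow> real^2 \<Rightarrow> real" where
  "orient p q r = (q $ 1 - p $ 1) * (r $ 2 - p $ 2) - (q $ 2 - p $ 2) * (r $ 1 - p $ 1)"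

lemma orient_cyclic: "orient q r p = orient p q r"
  by (simp add: orient_def algebra_simps)

lemma orient_swap: "orient q p r = - orient p q r"
  by (simp add: orient_def algebra_simps)

lemma orient_degenerate [simp]: "orient p q p = 0" "orient p q q = 0"
  by (simp_all add: orient_def)

lemma orient_combination:
  "u + v = 1 \<Longrightarrow> orient p q (u *\<^sub>R r + v *\<^sub>R s) = u * orient p q r + v * orient p q s"
proof -
  assume "u + v = 1"
  then have u: "u = 1 - v" by simp
  show ?thesis unfolding u orient_def by (simp add: algebra_simps)
qed

lemma convex_orient: "convex {r. 0 < orient p q r}" "convex {r. 0 < - orient p q r}"
proof -
  have "0 < u * x + v * y" if "0 \<le> u" "0 \<le> v" "u + v = 1" "0 < x" "0 < y" for u v x y :: real
  proof (cases "u = 0")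
    case False
    then show ?thesis using that by (intro add_pos_nonneg) auto
  qed (use that in simp)
  then show gt: "convex {r. 0 < orient p q r}" for p q
    by (auto intro!: convexI simp: orient_combination)
  show "convex {r. 0 < - orient p q r}"
    using gt[of q p] by (simp add: orient_swap[of q p])
qed

lemma affine_orient: "affine {r. orient p q r = 0}"
  by (auto simp: affine_def orient_combination)

text \<open>The affine dependence of four points, arranged so that both sides are the same multiple
  of the intersection of the lines \<open>a b\<close> and \<open>c d\<close>.\<close>

lemma four_point_identity:
  "orient c b d *\<^sub>R a + orient a c d *\<^sub>R b = orient a b d *\<^sub>R c + orient a c b *\<^sub>R d"
  "orient c b d + orient a c d = orient a b d + orient a c b"
  by (simp_all add: orient_def vec_eq_iff forall_2 algebra_simps)

text \<open>Cramer's rule: the barycentric coordinates of \<open>r\<close> in the triangle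
  \<open>a q s\<close> are ratios of areas.\<close>

lemma barycentric_identity:
  "orient a q s *\<^sub>R r = orient r q s *\<^sub>R a + orient a r s *\<^sub>R q + orient a q r *\<^sub>R s"
  "orient a q s = orient r q s + orient a r s + orient a q r"
  by (simp_all add: orient_def vec_eq_iff forall_2 algebra_simps)

lemma normalize_open_segment:
  fixes x y z :: "real^2"
  assumes "0 < s" "0 < t" "(s + t) *\<^sub>R z = s *\<^sub>R x + t *\<^sub>R y" "x \<noteq> y"
  shows "z \<in> open_segment x y"
proof -
  have "z = (1 / (s + t)) *\<^sub>R ((s + t) *\<^sub>R z)" using assms(1,2) by simp
  also have "\<dots> = (s / (s + t)) *\<^sub>R x + (t / (s + t)) *\<^sub>R y"
    unfolding assms(3) by (simp add: scaleR_add_right)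
  also have "s / (s + t) = 1 - t / (s + t)" using assms by (simp add: field_simps)
  finally show ?thesis
    unfolding in_segment using assms by (intro conjI exI[of _ "t / (s + t)"]) auto
qed

lemma ccw_crossing:
  assumes "0 < orient a c b" "0 < orient a c d" "0 < orient a b d" "0 < orient c b d"
  shows "open_segment a b \<inter> open_segment c d \<noteq> {}"
proof -
  define s where "s = orient c b d + orient a c d"
  define z where "z = (1 / s) *\<^sub>R (orient c b d *\<^sub>R a + orient a c d *\<^sub>R b)"
  have "0 < s" using assms by (simp add: s_def)
  then have z: "s *\<^sub>R z = orient c b d *\<^sub>R a + orient a c d *\<^sub>R b" by (simp add: z_def)
  have "a \<noteq> b" "c \<noteq> d" using assms by (auto simp: orient_def)
  then have "z \<in> open_segment a b" "z \<in> open_segment c d"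
    using normalize_open_segment[of "orient c b d" "orient a c d" z a b] z
      normalize_open_segment[of "orient a b d" "orient a c b" z c d] assms
    unfolding four_point_identity s_def by (simp_all add: four_point_identity)
  then show ?thesis by blast
qed

locale labelled_polygon =
  fixes n :: nat and P :: "(real^2) set" and p :: "nat \<Rightarrow> real^2"
  assumes bij: "bij_betw p {..<n} P"
    and ccw: "i < j \<Longrightarrow> j < k \<Longrightarrow> k < n \<Longrightarrow> 0 < orient (p i) (p j) (p k)"
begin

section \<open>Crossings and sides in terms of vertex labels\<close>

definition edge :: "nat \<times> nat \<Rightarrow> (real^2) set" where
  "edge e = {p (fst e), p (snd e)}"

definition pairs :: "(nat \<times> nat) set" where
  "pairs = {(i, j). i < j \<and> j < n}"

lemma p_eq: "i < n \<Longrightarrow> j < n \<Longrightarrow> p i = p j \<longleftrightarrow> i = j"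
  using bij by (auto simp: bij_betw_def inj_on_def)

lemma p_in: "i < n \<Longrightarrow> p i \<in> P"
  using bij by (auto simp: bij_betw_def)

lemma chords_subset_pairs: "chords n \<subseteq> pairs"
  by (auto simp: chords_def pairs_def)

lemma inj_edge: "inj_on edge pairs"
  by (auto simp: inj_on_def edge_def pairs_def doubleton_eq_iff p_eq)

lemma complete_edges_eq: "complete_edges P = edge ` pairs"
proof (intro equalityI subsetI)
  fix e assume "e \<in> complete_edges P"
  then obtain x y where e: "e = {x, y}" "x \<noteq> y" "x \<in> P" "y \<in> P"
    by (auto simp: complete_edges_def card_2_iff)
  have "P = p ` {..<n}" using bij by (simp add: bij_betw_def)
  then obtain i j where "x = p i" "y = p j" "i < n" "j < n" using e by auto
  then show "e \<in> edge ` pairs"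
    using e by (cases i j rule: linorder_cases)
      (auto simp: edge_def pairs_def intro!: image_eqI[of _ _ "(min i j, max i j)"])
qed (auto simp: edge_def pairs_def complete_edges_def card_insert_if p_eq p_in)

lemma orient_inside: "i < k \<Longrightarrow> k < j \<Longrightarrow> j < n \<Longrightarrow> orient (p i) (p j) (p k) < 0"
  using ccw[of i k j] orient_cyclic[of "p i" "p j" "p k"] orient_swap[of "p k" "p i" "p j"]
    orient_cyclic[of "p k" "p i" "p j"] by (simp add: orient_def algebra_simps)

lemma orient_outside:
  "i < j \<Longrightarrow> j < n \<Longrightarrow> k < n \<Longrightarrow> k < i \<or> j < k \<Longrightarrow> 0 < orient (p i) (p j) (p k)"
  using ccw[of k i j] ccw[of i j k] by (auto simp: orient_cyclic[of "p i" "p j" "p k"])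

text \<open>The sign of \<open>orient (p a) (p b)\<close> at a vertex tells whether its label lies
  between \<open>a\<close> and \<open>b\<close>. At a crossing point this affine function vanishes,
  so the ends of the other segment have opposite signs unless both lie on the line.\<close>

lemma crosses_iff:
  assumes "e \<in> pairs" "f \<in> pairs"
  shows "crosses (edge e) (edge f) \<longleftrightarrow> interleave e f"
proof -
  obtain a b c d where ef: "e = (a, b)" "f = (c, d)" and ab: "a < b" "b < n" and cd: "c < d" "d < n"
    using assms by (auto simp: pairs_def)
  have ne: "p a \<noteq> p b" "p c \<noteq> p d" using ab cd by (simp_all add: p_eq)
  have cross: "crosses (edge e) (edge f) \<longleftrightarrow>
      edge e \<noteq> edge f \<and> open_segment (p a) (p b) \<inter> open_segment (p c) (p d) \<noteq> {}"
    unfolding crosses_def ef edge_def fst_conv snd_conv segment_convex_hull[symmetric] rel_interior_closed_segment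
    using ne by auto
  have neq: "edge e \<noteq> edge f \<longleftrightarrow> e \<noteq> f" using inj_edge assms by (auto simp: inj_on_def)
  show ?thesis
  proof
    assume "interleave e f"
    then consider "a < c" "c < b" "b < d" | "c < a" "a < d" "d < b" by (auto simp: interleave_def ef)
    then have "open_segment (p a) (p b) \<inter> open_segment (p c) (p d) \<noteq> {}"
    proof cases
      case 1
      then show ?thesis using ab cd by (intro ccw_crossing ccw) auto
    next
      case 2
      then have "open_segment (p c) (p d) \<inter> open_segment (p a) (p b) \<noteq> {}"
        using ab cd by (intro ccw_crossing ccw) auto
      then show ?thesis by blast
    qed
    moreover have "e \<noteq> f" using \<open>interleave e f\<close> by (auto simp: interleave_def)
    ultimately show "crosses (edge e) (edge f)" using cross neq by blast
  next
    assume "crosses (edge e) (edge f)"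
    then obtain z where "e \<noteq> f" and z: "z \<in> open_segment (p a) (p b)" "z \<in> open_segment (p c) (p d)"
      using cross neq by blast
    let ?o = "\<lambda>x. orient (p a) (p b) x"
    obtain u where u: "0 < u" "u < 1" "z = (1 - u) *\<^sub>R p a + u *\<^sub>R p b" using z(1) by (auto simp: in_segment)
    obtain v where v: "0 < v" "v < 1" "z = (1 - v) *\<^sub>R p c + v *\<^sub>R p d" using z(2) by (auto simp: in_segment)
    have "?o z = 0" unfolding u(3) by (simp add: orient_combination)
    then have 0: "(1 - v) * ?o (p c) + v * ?o (p d) = 0" unfolding v(3) by (simp add: orient_combination)
    have sign: "x = a \<and> ?o (p x) = 0 \<or> x = b \<and> ?o (p x) = 0 \<or> a < x \<and> x < b \<and> ?o (p x) < 0 \<or>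
        (x < a \<or> b < x) \<and> 0 < ?o (p x)" if "x < n" for x
    proof -
      consider "x = a" | "x = b" | "a < x" "x < b" | "x < a \<or> b < x" by linarith
      then show ?thesis
        using orient_inside[of a x b] orient_outside[of a b x] ab that by cases simp_all
    qed
    define r where "r = v / (1 - v)"
    have r: "0 < r" using v by (simp add: r_def)
    have "?o (p c) = - (r * ?o (p d))" using 0 v(1,2) by (simp add: r_def field_simps)
    then have opposite: "0 < ?o (p c) \<Longrightarrow> ?o (p d) < 0" "?o (p c) < 0 \<Longrightarrow> 0 < ?o (p d)"
      "?o (p c) = 0 \<Longrightarrow> ?o (p d) = 0"
      using r by (auto simp: mult_less_0_iff zero_less_mult_iff)
    have "c < n" using cd by simp
    from sign[OF this] show "interleave e f"
    proof (elim disjE conjE)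
      assume "c = a" "?o (p c) = 0"
      then have "d = a \<or> d = b" using opposite(3) sign[OF cd(2)] by fastforce
      then show ?thesis using \<open>c = a\<close> cd \<open>e \<noteq> f\<close> ef by auto
    next
      assume "c = b" "?o (p c) = 0"
      then have "d = a \<or> d = b" using opposite(3) sign[OF cd(2)] by fastforce
      then show ?thesis using \<open>c = b\<close> cd ab by auto
    next
      assume c: "a < c" "c < b" "?o (p c) < 0"
      then have "d < a \<or> b < d" using opposite(2) sign[OF cd(2)] by fastforce
      then show ?thesis using c cd by (auto simp: interleave_def ef)
    next
      assume c: "c < a" "0 < ?o (p c)"
      then have "a < d \<and> d < b" using opposite(1) sign[OF cd(2)] by fastforce
      then show ?thesis using c cd by (auto simp: interleave_def ef)
    next
      assume c: "b < c" "0 < ?o (p c)"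
      then have "a < d \<and> d < b" using opposite(1) sign[OF cd(2)] by fastforce
      then show ?thesis using c cd by auto
    qed
  qed
qed

text \<open>All other vertices lie strictly on one side of the line through a polygon side, so their
  hull misses that line, which is the criterion for a face.\<close>

lemma side_edge:
  assumes e: "e \<in> pairs" "e \<notin> chords n"
  shows "(convex hull edge e) edge_of (convex hull P)"
proof -
  obtain a b where ab: "e = (a, b)" "a < b" "b < n" using e by (auto simp: pairs_def)
  have P: "P = p ` {..<n}" using bij by (simp add: bij_betw_def)
  have "b = a + 1 \<or> a = 0 \<and> b = n - 1" using e ab by (auto simp: chords_def)
  then have "P - {p a, p b} \<subseteq> {r. 0 < orient (p a) (p b) r} \<or> P - {p a, p b} \<subseteq> {r. 0 < - orient (p a) (p b) r}"
  proof
    assume "b = a + 1"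
    then have "0 < orient (p a) (p b) (p k)" if "k < n" "k \<noteq> a" "k \<noteq> b" for k
      using that ab by (intro orient_outside) auto
    then show ?thesis unfolding P by auto
  next
    assume "a = 0 \<and> b = n - 1"
    then have "0 < - orient (p a) (p b) (p k)" if "k < n" "k \<noteq> a" "k \<noteq> b" for k
      using that ab orient_inside[of a k b] by simp
    then show ?thesis unfolding P by auto
  qed
  then have "convex hull (P - {p a, p b}) \<subseteq> {r. orient (p a) (p b) r \<noteq> 0}"
    using hull_minimal[of "P - {p a, p b}" "{r. 0 < orient (p a) (p b) r}" convex]
      hull_minimal[of "P - {p a, p b}" "{r. 0 < - orient (p a) (p b) r}" convex] convex_orient by fastforce
  moreover have "affine hull {p a, p b} \<subseteq> {r. orient (p a) (p b) r = 0}"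
    by (rule hull_minimal) (auto simp: affine_orient)
  ultimately have "convex hull {p a, p b} face_of convex hull P"
    using ab P by (intro face_of_convex_hulls) (auto simp: p_in)
  moreover have "aff_dim (convex hull {p a, p b}) = 1"
    using ab p_eq[of a b] by (simp add: aff_dim_convex_hull aff_dim_2)
  ultimately show ?thesis by (simp add: edge_of_def ab edge_def)
qed

text \<open>Some segment with end \<open>p (a + 1)\<close> crosses the diagonal. A face containing
  an inner point of a segment contains its ends, but \<open>p (a + 1)\<close> does not lie on the
  line through the diagonal.\<close>

lemma chord_not_edge:
  assumes e: "e \<in> chords n"
  shows "\<not> (convex hull edge e) edge_of (convex hull P)"
proof
  assume "(convex hull edge e) edge_of (convex hull P)"
  then have face: "(convex hull edge e) face_of (convex hull P)" by (simp add: edge_of_def)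
  obtain a b where ab: "e = (a, b)" "a + 2 \<le> b" "b < n" using e by (auto simp: chords_def)
  then have "0 < a \<or> b + 1 < n" using e by (auto simp: chords_def)
  define f where "f = (if 0 < a then (0, a + 1) else (a + 1, n - 1))"
  have f: "f \<in> pairs" "interleave e f" using ab \<open>0 < a \<or> b + 1 < n\<close> by (auto simp: f_def pairs_def interleave_def)
  then have "crosses (edge e) (edge f)" using e chords_subset_pairs crosses_iff by blast
  moreover have "p (fst f) \<noteq> p (snd f)" using f(1) by (auto simp: pairs_def p_eq)
  ultimately have "rel_interior (convex hull edge f) = open_segment (p (fst f)) (p (snd f))"
    by (simp add: edge_def rel_interior_closed_segment flip: segment_convex_hull)
  with \<open>crosses (edge e) (edge f)\<close> obtain z
    where z: "z \<in> convex hull edge e" "z \<in> open_segment (p (fst f)) (p (snd f))"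
    using rel_interior_subset[of "convex hull edge e"] by (auto simp: crosses_def)
  have "p (fst f) \<in> convex hull P" "p (snd f) \<in> convex hull P"
    using f(1) by (auto simp: pairs_def intro!: hull_inc p_in)
  then have "p (fst f) \<in> convex hull edge e" "p (snd f) \<in> convex hull edge e"
    using face z unfolding face_of_def by blast+
  then have "p (a + 1) \<in> convex hull edge e" by (auto simp: f_def split: if_splits)
  moreover have "convex hull edge e \<subseteq> {r. orient (p a) (p b) r = 0}"
    by (rule hull_minimal) (auto simp: affine_orient affine_imp_convex edge_def ab)
  ultimately show False using orient_inside[of a "a + 1" b] ab by auto
qed

lemma diagonals_eq: "diagonals P = edge ` chords n"
  unfolding diagonals_def complete_edges_eq using side_edge chord_not_edge chords_subset_pairs by blast

lemma card_crossings:
  assumes G: "G \<subseteq> chords n" and e: "e \<in> G"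
  shows "card {f \<in> edge ` G. crosses (edge e) f} = card {f \<in> G. interleave e f}"
proof -
  have "{f \<in> edge ` G. crosses (edge e) f} = edge ` {f \<in> G. interleave e f}"
    using crosses_iff G e chords_subset_pairs by blast
  moreover have "inj_on edge {f \<in> G. interleave e f}"
    by (rule inj_on_subset[OF inj_edge]) (use G chords_subset_pairs in blast)
  ultimately show ?thesis by (simp add: card_image)
qed

lemma limited_edges_iff:
  "(\<exists>G\<subseteq>diagonals P. (\<forall>e\<in>G. card {f \<in> G. crosses e f} \<le> l) \<and> card G = c) \<longleftrightarrow>
   (\<exists>G. limited l n G \<and> card G = c)"
proof
  assume "\<exists>G\<subseteq>diagonals P. (\<forall>e\<in>G. card {f \<in> G. crosses e f} \<le> l) \<and> card G = c"
  then obtain G where G: "G \<subseteq> edge ` chords n" "\<forall>e\<in>G. card {f \<in> G. crosses e f} \<le> l" "card G = c"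
    unfolding diagonals_eq by blast
  then obtain H where H: "H \<subseteq> chords n" "G = edge ` H" by (auto simp: subset_image_iff)
  have "card H = c" using G(3) H inj_on_subset[OF inj_edge] chords_subset_pairs by (auto simp: card_image)
  moreover have "limited l n H" using G(2) H card_crossings[OF H(1)] by (auto simp: limited_def)
  ultimately show "\<exists>G. limited l n G \<and> card G = c" by blast
next
  assume "\<exists>G. limited l n G \<and> card G = c"
  then obtain G where G: "limited l n G" "card G = c" by blast
  then have "G \<subseteq> chords n" by (simp add: limited_def)
  then have "card (edge ` G) = c" using G inj_on_subset[OF inj_edge] chords_subset_pairs by (auto simp: card_image)
  moreover have "\<forall>e\<in>edge ` G. card {f \<in> edge ` G. crosses e f} \<le> l"
    using G card_crossings[OF \<open>G \<subseteq> chords n\<close>] by (auto simp: limited_def)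
  ultimately show "\<exists>G\<subseteq>diagonals P. (\<forall>e\<in>G. card {f \<in> G. crosses e f} \<le> l) \<and> card G = c"
    using \<open>G \<subseteq> chords n\<close> unfolding diagonals_eq by (intro exI[of _ "edge ` G"]) auto
qed

lemma card_diagonals:
  assumes "3 \<le> n"
  shows "2 * card (diagonals P) = n * (n - 3)"
proof -
  have "card (diagonals P) = card (chords n)"
    unfolding diagonals_eq using inj_on_subset[OF inj_edge chords_subset_pairs] by (rule card_image)
  moreover have "2 * card (chords n) = n * (n - 3)"
  proof -
    \<comment> \<open>Together with the side \<open>(0, n - 1)\<close>, the chords with larger end
      \<open>j\<close> start at exactly the labels below \<open>j - 1\<close>, which makes the count
      uniform in \<open>j\<close>.\<close>
    have "chords n \<union> {(0, n - 1)} = (SIGMA j:{..<n}. {..<j - 1})\<inverse>" using assms by (force simp: chords_def)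
    then have "card (chords n \<union> {(0, n - 1)}) = (\<Sum>j<n. j - 1)" by (simp add: card_SigmaI)
    moreover have "card (chords n \<union> {(0, n - 1)}) = card (chords n) + 1"
      using card_insert_disjoint[OF finite_chords, of "(0, n - 1)" n] by (simp add: chords_def)
    moreover have "2 * (\<Sum>j<n. j - 1) = n * (n - 3) + 2"
      using assms
    proof (induction n rule: dec_induct)
      case (step m)
      then obtain k where k: "m = k + 3" by (metis add.commute le_Suc_ex)
      have "2 * (\<Sum>j<Suc m. j - 1) = 2 * (\<Sum>j<m. j - 1) + 2 * (m - 1)" by simp
      also have "\<dots> = (m * (m - 3) + 2) + 2 * (m - 1)" using step by simp
      also have "\<dots> = Suc m * (Suc m - 3) + 2" by (simp add: k algebra_simps)
      finally show ?case .
    qed (simp add: eval_nat_numeral)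
    ultimately show ?thesis by simp
  qed
  ultimately show ?thesis by simp
qed

end

text \<open>
  A functional \<open>w\<close> separating a vertex \<open>a\<close> from the others turns the slope \<open>key\<close> of the lines
  through \<open>a\<close> into a linear order on the other vertices.
\<close>

lemma polygon_labelling:
  assumes P: "convex_polygon n P" and n: "0 < n"
  obtains p where "labelled_polygon n P p"
proof -
  have fin: "finite P" "card P = n" and extreme: "x \<notin> convex hull (P - {x})" if "x \<in> P" for x
    using P that by (auto simp: convex_polygon_def)
  have outside: False if "x \<in> P" "x \<in> convex hull S" "S \<subseteq> P - {x}" for x S
    using extreme[OF that(1)] hull_mono[OF that(3)] that(2) by blast
  have fin: "finite P" "card P = n" using P by (auto simp: convex_polygon_def)
  then obtain a where a: "a \<in> P" using n by fastforce
  define A where "A = P - {a}"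
  have "closed (convex hull A)"
    using fin by (simp add: A_def finite_imp_compact_convex_hull compact_imp_closed)
  then obtain w b where wb: "w \<bullet> a < b" "\<And>x. x \<in> convex hull A \<Longrightarrow> b < w \<bullet> x"
    using separating_hyperplane_closed_point[of "convex hull A" a] extreme[OF a] by (auto simp: A_def)
  have w: "0 < w \<bullet> (x - a)" if "x \<in> A" for x
    using wb(1) wb(2)[OF hull_inc[OF that]] by (simp add: inner_diff_right)
  define key where "key x = (w $ 1 * (x $ 2 - a $ 2) - w $ 2 * (x $ 1 - a $ 1)) / (w \<bullet> (x - a))" for x
  have inner: "w \<bullet> (x - a) = w $ 1 * (x $ 1 - a $ 1) + w $ 2 * (x $ 2 - a $ 2)" for x
    by (simp add: inner_vec_def sum_2)
  have key: "(w \<bullet> w) * orient a x y = (w \<bullet> (x - a)) * (w \<bullet> (y - a)) * (key y - key x)"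
    if "x \<in> A" "y \<in> A" for x y
  proof -
    have num: "(w \<bullet> (z - a)) * key z = w $ 1 * (z $ 2 - a $ 2) - w $ 2 * (z $ 1 - a $ 1)" if "z \<in> A" for z
      using w[OF that] by (simp add: key_def)
    have "(w \<bullet> (x - a)) * (w \<bullet> (y - a)) * (key y - key x) =
      (w \<bullet> (x - a)) * ((w \<bullet> (y - a)) * key y) - (w \<bullet> (y - a)) * ((w \<bullet> (x - a)) * key x)"
      by algebra
    also have "\<dots> = (w \<bullet> (x - a)) * (w $ 1 * (y $ 2 - a $ 2) - w $ 2 * (y $ 1 - a $ 1)) -
      (w \<bullet> (y - a)) * (w $ 1 * (x $ 2 - a $ 2) - w $ 2 * (x $ 1 - a $ 1))"
      unfolding num[OF that(1)] num[OF that(2)] ..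
    also have "\<dots> = (w \<bullet> w) * orient a x y"
      unfolding inner by (simp add: inner_vec_def sum_2 orient_def algebra_simps)
    finally show ?thesis by simp
  qed
  \<comment> \<open>Two points with the same slope lie on one ray from \<open>a\<close>; the nearer
    one would then lie on the segment from \<open>a\<close> to the other and not be a
    vertex.\<close>
  have between: False if "x \<in> A" "y \<in> A" "x \<noteq> y" "key x = key y" "w \<bullet> (x - a) \<le> w \<bullet> (y - a)" for x y
  proof -
    define t where "t = w \<bullet> (x - a) / (w \<bullet> (y - a))"
    have t: "0 \<le> t" "t \<le> 1" using w[OF that(1)] w[OF that(2)] that(5) by (auto simp: t_def)
    have "w \<noteq> 0" using w[OF that(1)] by auto
    then have "orient a x y = 0" using key[OF that(1,2)] that(4) by simp
    then have "(x $ 1 - a $ 1) * (y $ 2 - a $ 2) = (x $ 2 - a $ 2) * (y $ 1 - a $ 1)"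
      by (simp add: orient_def)
    then have "(w \<bullet> (y - a)) *\<^sub>R (x - a) = (w \<bullet> (x - a)) *\<^sub>R (y - a)"
      unfolding inner vec_eq_iff forall_2 vector_scaleR_component vector_minus_component real_scaleR_def
      by (intro conjI; algebra)
    then have "(1 / (w \<bullet> (y - a))) *\<^sub>R ((w \<bullet> (y - a)) *\<^sub>R (x - a)) = t *\<^sub>R (y - a)"
      by (simp add: t_def)
    then have "x - a = t *\<^sub>R (y - a)" using w[OF that(2)] by simp
    then have "x = (1 - t) *\<^sub>R a + t *\<^sub>R y" by (simp add: algebra_simps)
    then have "x \<in> convex hull {a, y}"
      unfolding convex_hull_2 using t by (intro CollectI exI[of _ "1 - t"] exI[of _ t]) auto
    then show False using outside[of x "{a, y}"] that a by (auto simp: A_def)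
  qed
  have inj: "inj_on key A"
  proof (rule inj_onI, rule ccontr)
    fix x y assume "x \<in> A" "y \<in> A" "key x = key y" "x \<noteq> y"
    then show False using between[of x y] between[of y x] by force
  qed
  have pos: "0 < orient a x y \<longleftrightarrow> key x < key y" if "x \<in> A" "y \<in> A" for x y
  proof -
    have "0 < w \<bullet> w" using w[OF that(1)] by auto
    have "0 < (w \<bullet> w) * orient a x y \<longleftrightarrow> 0 < key y - key x"
      unfolding key[OF that]
      using mult_less_cancel_left_pos[OF mult_pos_pos[OF w[OF that(1)] w[OF that(2)]], of 0 "key y - key x"]
      by (simp only: mult_zero_right)
    then show ?thesis using \<open>0 < w \<bullet> w\<close> by (simp add: zero_less_mult_iff)
  qed
  \<comment> \<open>If the turn at \<open>y\<close> were not strictly to the left, all barycentric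
    coordinates of \<open>y\<close> in the triangle \<open>a x z\<close> would be nonnegative and
    \<open>y\<close> would not be a vertex.\<close>
  have triple: "0 < orient x y z" if "x \<in> A" "y \<in> A" "z \<in> A" "key x < key y" "key y < key z" for x y z
  proof (rule ccontr)
    assume "\<not> 0 < orient x y z"
    then have 1: "0 \<le> orient y x z" by (simp add: orient_swap[of y x z])
    have 2: "0 < orient a x y" "0 < orient a y z" "0 < orient a x z" using pos that by auto
    have "y = (orient y x z / orient a x z) *\<^sub>R a + (orient a y z / orient a x z) *\<^sub>R x + (orient a x y / orient a x z) *\<^sub>R z"
    proof -
      have "y = (1 / orient a x z) *\<^sub>R (orient a x z *\<^sub>R y)" using 2 by simp
      then show ?thesis unfolding barycentric_identity(1)[of a x z y] by (simp add: scaleR_add_right)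
    qed
    moreover have "orient y x z / orient a x z + orient a y z / orient a x z + orient a x y / orient a x z = 1"
      using 2 barycentric_identity(2)[of a x z y] by (simp flip: add_divide_distrib)
    ultimately have "y \<in> convex hull {a, x, z}"
      unfolding convex_hull_3 using 1 2 by (auto intro!: exI divide_nonneg_pos)
    then show False using outside[of y "{a, x, z}"] that a by (auto simp: A_def)
  qed
  define ks where "ks = sorted_list_of_set (key ` A)"
  have ks: "sorted_wrt (<) ks" "set ks = key ` A" "length ks = n - 1"
    using fin a inj by (auto simp: ks_def A_def card_image)
  define q where "q i = inv_into A key (ks ! i)" for i
  have q: "q i \<in> A" "key (q i) = ks ! i" if "i < n - 1" for i
    using that ks nth_mem[of i ks] by (auto simp: q_def inv_into_into f_inv_into_f)
  define p where "p i = (case i of 0 \<Rightarrow> a | Suc j \<Rightarrow> q j)" for i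
  have less: "key (q i) < key (q j)" if "i < j" "j < n - 1" for i j
    using that q[of i] q[of j] ks sorted_wrt_nth_less[OF ks(1), of i j] by auto
  have "p ` {..<n} \<subseteq> P" using q a by (auto simp: p_def A_def split: nat.split) 
  moreover have "inj_on p {..<n}"
  proof (rule linorder_inj_onI')
    fix i j assume ij: "i \<in> {..<n}" "j \<in> {..<n}" "i < j"
    then have "j - 1 < n - 1" by auto
    then show "p i \<noteq> p j"
      using ij less[of "i - 1" "j - 1"] q[OF \<open>j - 1 < n - 1\<close>] by (auto simp: p_def A_def split: nat.split)
  qed
  ultimately have "bij_betw p {..<n} P"
    using fin by (simp add: bij_betw_def card_subset_eq card_image)
  moreover have "0 < orient (p i) (p j) (p k)" if ijk: "i < j" "j < k" "k < n" for i j k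
  proof (cases i)
    case 0
    then show ?thesis using that pos[of "q (j - 1)" "q (k - 1)"] q[of "j - 1"] q[of "k - 1"] less[of "j - 1" "k - 1"]
      by (auto simp: p_def split: nat.split)
  next
    case (Suc i')
    then show ?thesis
      using that triple[of "q i'" "q (j - 1)" "q (k - 1)"] q[of i'] q[of "j - 1"] q[of "k - 1"]
        less[of "j - 1" "k - 1"] less[of i' "j - 1"]
      by (auto simp: p_def split: nat.split)
  qed
  ultimately have "labelled_polygon n P p" by unfold_locales
  then show thesis by (rule that)
qed

text \<open>Points on a parabola: \<open>v i\<close> is normal to the tangent at \<open>p i\<close>,
  and its inner product with \<open>p j\<close> exceeds that with \<open>p i\<close> by the square
  of \<open>j - i\<close>.\<close>

lemma convex_polygon_exists: "\<exists>P. convex_polygon n P"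
proof -
  define p :: "nat \<Rightarrow> real^2" where "p i = vector [real i, (real i)\<^sup>2]" for i
  have p: "p i $ 1 = real i" "p i $ 2 = (real i)\<^sup>2" for i by (simp_all add: p_def)
  define v :: "nat \<Rightarrow> real^2" where "v i = vector [- 2 * real i, 1]" for i
  have v: "v i $ 1 = - 2 * real i" "v i $ 2 = 1" for i by (simp_all add: v_def)
  have inj: "inj p" by (metis injI of_nat_eq_iff p(1))
  have "p i \<notin> convex hull (p ` {..<n} - {p i})" for i
  proof
    assume "p i \<in> convex hull (p ` {..<n} - {p i})"
    moreover have "convex hull (p ` {..<n} - {p i}) \<subseteq> {x. - (real i)\<^sup>2 < x \<bullet> v i}"
    proof (rule hull_minimal)
      show "p ` {..<n} - {p i} \<subseteq> {x. - (real i)\<^sup>2 < x \<bullet> v i}"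
      proof safe
        fix j assume "p j \<noteq> p i"
        then have "0 < (real j - real i)\<^sup>2" by auto
        then show "- (real i)\<^sup>2 < p j \<bullet> v i"
          by (simp add: inner_vec_def sum_2 p v power2_eq_square algebra_simps)
      qed
      show "convex {x. - (real i)\<^sup>2 < x \<bullet> v i}"
        using convex_halfspace_gt[of "- (real i)\<^sup>2" "v i"] by (simp add: inner_commute)
    qed
    ultimately show False by (auto simp: inner_vec_def sum_2 p v power2_eq_square)
  qed
  then have "convex_polygon n (p ` {..<n})"
    using inj by (auto simp: convex_polygon_def card_image inj_on_subset)
  then show ?thesis by blast
qed

section \<open>Book crossing numbers\<close>

text \<open>For \<open>Suc m\<close>, a set of more than \<open>b m\<close> elements has one with at
  least \<open>Suc m\<close> crossings, all of which disappear with it; once there are at most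
  \<open>b m\<close> elements, the bound for \<open>m\<close> is enough.\<close>

lemma crossing_lemma:
  fixes R :: "'a \<Rightarrow> 'a \<Rightarrow> bool"
  assumes irrefl: "\<And>x. \<not> R x x" and U: "finite U"
    and bound: "\<And>l H. H \<subseteq> U \<Longrightarrow> \<forall>e\<in>H. card {f \<in> H. R e f} \<le> l \<Longrightarrow> card H \<le> b l"
  shows "G \<subseteq> U \<Longrightarrow> m * card G \<le> card {{e, f} | e f. e \<in> G \<and> f \<in> G \<and> R e f} + (\<Sum>l<m. b l)"
proof (induction m arbitrary: G)
  case (Suc m)
  define X where "X G = {{e, f} | e f. e \<in> G \<and> f \<in> G \<and> R e f}" for G
  have "finite G" using Suc.prems U by (rule finite_subset)
  then have "Suc m * card G \<le> card (X G) + (\<Sum>l<Suc m. b l)"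
    using Suc.prems
  proof (induction G rule: finite_psubset_induct)
    case (psubset G)
    have finX: "finite (X G)" if "finite G" for G
      by (rule finite_subset[of _ "Pow G"]) (use that in \<open>auto simp: X_def\<close>)
    show ?case
    proof (cases "card G \<le> b m")
      case True
      then show ?thesis using Suc.IH[OF psubset.prems] by (simp add: X_def)
    next
      case False
      then obtain e where e: "e \<in> G" "Suc m \<le> card {f \<in> G. R e f}"
        using bound[OF psubset.prems, of m] by (meson not_less_eq_eq)
      let ?H = "G - {e}" and ?F = "(\<lambda>f. {e, f}) ` {f \<in> G. R e f}"
      have "Suc m * card ?H \<le> card (X ?H) + (\<Sum>l<Suc m. b l)"
        using psubset.prems e by (intro psubset.IH) auto
      moreover have "card ?F = card {f \<in> G. R e f}"
        by (rule card_image) (auto simp: inj_on_def doubleton_eq_iff)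
      moreover have "card (X ?H) + card ?F = card (X ?H \<union> ?F)"
      proof (rule card_Un_disjoint[symmetric])
        have "e \<notin> x" if "x \<in> X ?H" for x using that by (auto simp: X_def)
        then show "X ?H \<inter> ?F = {}" by blast
      qed (use psubset.hyps finX in auto)
      moreover have "card (X ?H \<union> ?F) \<le> card (X G)"
      proof (rule card_mono)
        show "X ?H \<union> ?F \<subseteq> X G" unfolding X_def using e(1) by blast
      qed (use psubset.hyps finX in auto)
      moreover have "card G = card ?H + 1" 
        using card_Suc_Diff1[OF psubset.hyps(1) e(1)] by (simp only: Suc_eq_plus1)
      moreover from this have "Suc m * card G = Suc m * card ?H + Suc m"
        by (simp only: add_mult_distrib2 mult_1_right)
      ultimately show ?thesis using e(2) by linarith
    qed
  qed
  then show ?case by (simp add: X_def)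
qed simp

section \<open>From edge maxima to book drawings\<close>

lemma complete_edges_subset: "complete_edges P \<subseteq> Pow P"
  by (auto simp: complete_edges_def)

lemma diagonals_subset: "diagonals P \<subseteq> complete_edges P"
  by (auto simp: diagonals_def)

lemma card_le_max_edges:
  assumes P: "convex_polygon n P" and G: "G \<subseteq> diagonals P" "\<forall>e\<in>G. card {f \<in> G. crosses e f} \<le> l"
  shows "card G \<le> max_edges l n"
proof -
  \<comment> \<open>A crude bound whose purpose is finiteness of the set under \<open>Max\<close>:
    edges are subsets of the vertex set.\<close>
  have le: "card G \<le> 2 ^ n" if "convex_polygon n P" "G \<subseteq> diagonals P" for G P
  proof -
    have "G \<subseteq> Pow P" using that(2) diagonals_subset complete_edges_subset by blast
    then have "card G \<le> card (Pow P)" using that(1) by (intro card_mono) (auto simp: convex_polygon_def)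
    then show ?thesis using that(1) by (simp add: card_Pow convex_polygon_def)
  qed
  let ?S = "{card G | G P. convex_polygon n P \<and> G \<subseteq> diagonals P \<and> (\<forall>e\<in>G. card {f \<in> G. crosses e f} \<le> l)}"
  have "?S \<subseteq> {..2 ^ n}"
  proof
    fix c assume "c \<in> ?S"
    then obtain G P where "c = card G" "convex_polygon n P" "G \<subseteq> diagonals P" by blast
    then show "c \<in> {..2 ^ n}" using le by simp
  qed
  then have "finite ?S" by (rule finite_subset) simp
  moreover have "card G \<in> ?S" using assms by (intro CollectI exI[of _ G] exI[of _ P] conjI refl)
  ultimately show ?thesis unfolding max_edges_def by (rule Max_ge)
qed

lemma max_edges_eq:
  assumes "l \<le> 4" "5 \<le> n"
  shows "max_edges l n = extremal l (n - 2) - 1"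
  unfolding max_edges_def
proof (rule Max_eqI)
  let ?S = "{card G | G P. convex_polygon n P \<and> G \<subseteq> diagonals P \<and> (\<forall>e\<in>G. card {f \<in> G. crosses e f} \<le> l)}"
  have le: "c \<le> extremal l (n - 2) - 1" if c: "c \<in> ?S" for c
  proof -
    obtain G P where P: "convex_polygon n P"
      and G: "G \<subseteq> diagonals P" "\<forall>e\<in>G. card {f \<in> G. crosses e f} \<le> l" "card G = c"
      using c by blast
    obtain p where "labelled_polygon n P p" using polygon_labelling[OF P] assms by auto
    then interpret labelled_polygon n P p .
    obtain H where "limited l n H" "card H = c" using limited_edges_iff G by blast
    then show ?thesis using card_limited_le[of l n H] assms by simp
  qed
  then show "finite ?S" by (intro finite_subset[of ?S "{..extremal l (n - 2) - 1}"]) auto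
  show "c \<le> extremal l (n - 2) - 1" if "c \<in> ?S" for c using le[OF that] .
  obtain P where P: "convex_polygon n P" using convex_polygon_exists by blast
  obtain p where "labelled_polygon n P p" using polygon_labelling[OF P] assms by auto
  then interpret labelled_polygon n P p .
  have "\<exists>G\<subseteq>diagonals P. (\<forall>e\<in>G. card {f \<in> G. crosses e f} \<le> l) \<and> card G = extremal l (n - 2) - 1"
    using attained_extremal[OF assms] unfolding limited_edges_iff attained_def .
  then obtain G where "G \<subseteq> diagonals P" "\<forall>e\<in>G. card {f \<in> G. crosses e f} \<le> l"
    "card G = extremal l (n - 2) - 1" by blast
  then show "extremal l (n - 2) - 1 \<in> ?S" using P by (intro CollectI exI[of _ G] exI[of _ P]) simp
qed

lemma book_crossing_bound:
  assumes n: "3 \<le> n" and k: "0 < k"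
  shows "L k n m \<le> real (book_crossing_number_complete k n)"
proof -
  let ?S = "{monochromatic_crossings P c | P c. convex_polygon n P \<and> c ` complete_edges P \<subseteq> {..<k}}"
  obtain P0 where "convex_polygon n P0" using convex_polygon_exists by blast
  \<comment> \<open>Some drawing exists, so the infimum of natural numbers is attained and an
    optimal drawing can be fixed.\<close>
  then have "monochromatic_crossings P0 (\<lambda>_. 0) \<in> ?S" using k by blast
  then have "Inf ?S \<in> ?S" by (intro Inf_nat_def1) blast
  then obtain P c where P: "convex_polygon n P" and c: "c ` complete_edges P \<subseteq> {..<k}"
    and eq: "book_crossing_number_complete k n = monochromatic_crossings P c"
    unfolding book_crossing_number_complete_def by blast
  obtain p where "labelled_polygon n P p" using polygon_labelling[OF P] n by auto
  then interpret labelled_polygon n P p .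
  have fin: "finite (complete_edges P)"
    using P by (intro finite_subset[OF complete_edges_subset]) (simp add: convex_polygon_def)
  have finD: "finite (diagonals P)" using diagonals_subset fin by (rule finite_subset)
  \<comment> \<open>The colour classes are restricted to diagonals, since \<open>max_edges\<close>
    speaks about these; crossings among them are some of all monochromatic crossings.\<close>
  define G where "G i = {e \<in> diagonals P. c e = i}" for i
  define X where "X i = {{e, f} | e f. e \<in> G i \<and> f \<in> G i \<and> crosses e f}" for i
  define Y where "Y = {{e, f} | e f. e \<in> complete_edges P \<and> f \<in> complete_edges P \<and> crosses e f \<and> c e = c f}"
  have finG: "finite (G i)" for i using finD by (simp add: G_def)
  have finY: "finite Y" by (rule finite_subset[of _ "Pow (complete_edges P)"]) (use fin in \<open>auto simp: Y_def\<close>)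
  have XY: "X i \<subseteq> Y" for i
  proof
    fix x assume "x \<in> X i"
    then obtain e f where ef: "x = {e, f}" "e \<in> G i" "f \<in> G i" "crosses e f" by (auto simp: X_def)
    then have "e \<in> complete_edges P" "f \<in> complete_edges P" "c e = c f"
      using diagonals_subset by (auto simp: G_def)
    then show "x \<in> Y" using ef unfolding Y_def by blast
  qed
  have "diagonals P = (\<Union>i<k. G i)" using c diagonals_subset unfolding G_def by blast
  also have "card \<dots> = (\<Sum>i<k. card (G i))"
  proof (rule card_UN_disjoint)
    show "\<forall>i\<in>{..<k}. finite (G i)" using finG by blast
    show "\<forall>i\<in>{..<k}. \<forall>j\<in>{..<k}. i \<noteq> j \<longrightarrow> G i \<inter> G j = {}" unfolding G_def by blast
  qed simp
  finally have "m * card (diagonals P) = (\<Sum>i<k. m * card (G i))" by (simp add: sum_distrib_left)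
  also have "\<dots> \<le> (\<Sum>i<k. card (X i) + (\<Sum>l<m. max_edges l n))"
  proof (rule sum_mono)
    fix i
    show "m * card (G i) \<le> card (X i) + (\<Sum>l<m. max_edges l n)"
      unfolding X_def
    proof (rule crossing_lemma[where U = "diagonals P"])
      show "card H \<le> max_edges l n" if "H \<subseteq> diagonals P" "\<forall>e\<in>H. card {f \<in> H. crosses e f} \<le> l" for l H
        using card_le_max_edges[OF P that] .
    qed (auto simp: crosses_def finD G_def)
  qed
  also have "\<dots> = (\<Sum>i<k. card (X i)) + k * (\<Sum>l<m. max_edges l n)"
    by (simp add: sum.distrib)
  also have "(\<Sum>i<k. card (X i)) = card (\<Union>i<k. X i)"
  proof (rule card_UN_disjoint[symmetric])
    show "\<forall>i\<in>{..<k}. finite (X i)" using finite_subset[OF XY finY] by blast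
    \<comment> \<open>A crossing pair of class \<open>i\<close> carries the colour \<open>i\<close>,
      so pairs from different classes are different.\<close>
    have image: "c ` x = {i}" if "x \<in> X i" for x i using that by (auto simp: X_def G_def)
    have "i = j" if "x \<in> X i" "x \<in> X j" for x i j using image[OF that(1)] image[OF that(2)] by simp
    then show "\<forall>i\<in>{..<k}. \<forall>j\<in>{..<k}. i \<noteq> j \<longrightarrow> X i \<inter> X j = {}" by blast
  qed simp
  also have "\<dots> \<le> card Y" using XY finY by (intro card_mono) auto
  also have "card Y = book_crossing_number_complete k n"
    unfolding eq monochromatic_crossings_def Y_def ..
  finally have "m * card (diagonals P) \<le> book_crossing_number_complete k n + k * (\<Sum>l<m. max_edges l n)"
    by simp
  then have "real (m * card (diagonals P)) \<le> real (book_crossing_number_complete k n + k * (\<Sum>l<m. max_edges l n))"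
    by (simp only: of_nat_le_iff)
  then have "real m * real (card (diagonals P)) \<le>
      real (book_crossing_number_complete k n) + real k * (\<Sum>l<m. real (max_edges l n))"
    by simp
  moreover have "real (card (diagonals P)) = real n * (real n - 3) / 2"
  proof -
    have "real (2 * card (diagonals P)) = real (n * (n - 3))" using card_diagonals[OF n] by (simp only:)
    then show ?thesis using n by (simp add: of_nat_diff)
  qed
  ultimately show ?thesis unfolding L_def by (simp add: algebra_simps)
qed

section \<open>Closed forms of the edge maxima\<close>

lemma real_max_edges:
  assumes "l \<le> 4" "5 \<le> n"
  shows "real (max_edges l n) = real (extremal l (n - 2)) - 1"
proof -
  have "limited l n {}" by (simp add: limited_def)
  then have "1 \<le> extremal l (n - 2)" using card_limited_le[of l n "{}"] assms by simp
  then show ?thesis using max_edges_eq[OF assms] by (simp add: of_nat_diff)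
qed

lemma max_edges_0: "5 \<le> n \<Longrightarrow> real (max_edges 0 n) = real n - 3"
  by (simp add: real_max_edges extremal_def of_nat_diff)

lemma max_edges_1:
  assumes n: "5 \<le> n"
  shows "real (max_edges 1 n) = 3/2 * (real n - 3) + \<delta>\<^sub>1 n"
proof (cases "even n")
  case True
  then obtain j where j: "n = 2 * j" by blast
  then have "3 * (n - 2) div 2 = 3 * (j - 1)" by simp
  then have "real (max_edges 1 n) = 3 * (real j - 1) - 1" using n j by (simp add: real_max_edges extremal_def of_nat_diff)
  then show ?thesis using j by (simp add: \<delta>\<^sub>1_def field_simps)
next
  case False
  then obtain j where j: "n = 2 * j + 1" by (elim oddE)
  then have "n - 2 = 2 * (j - 1) + 1" using n by simp
  then have "3 * (n - 2) div 2 = 3 * (j - 1) + 1" by simp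
  then have "real (max_edges 1 n) = 3 * (real j - 1)" using n j by (simp add: real_max_edges extremal_def of_nat_diff)
  then show ?thesis using j by (simp add: \<delta>\<^sub>1_def field_simps)
qed

lemma max_edges_2:
  assumes n: "5 \<le> n"
  shows "real (max_edges 2 n) = 2 * (real n - 3) + \<delta>\<^sub>2 n"
proof -
  have "3 dvd n - 2 \<longleftrightarrow> n mod 3 = 2" using n by presburger
  then show ?thesis using n by (simp add: real_max_edges extremal_def \<delta>\<^sub>2_def of_nat_diff)
qed

lemma mod_four_cases:
  fixes n :: nat
  assumes "5 \<le> n"
  obtains j where "(n - 2) div 4 = j" "(n - 2) mod 4 = 0" "n mod 4 = 2" "real n = 4 * real j + 2"
    | j where "(n - 2) div 4 = j" "(n - 2) mod 4 = 1" "n mod 4 = 3" "real n = 4 * real j + 3"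
    | j where "(n - 2) div 4 = j" "(n - 2) mod 4 = 2" "n mod 4 = 0" "real n = 4 * real j + 4"
    | j where "(n - 2) div 4 = j" "(n - 2) mod 4 = 3" "n mod 4 = 1" "real n = 4 * real j + 5"
proof -
  define m where "m = n - 2"
  define j where "j = m div 4"
  have D: "(n - 2) div 4 = j" and M: "(n - 2) mod 4 = m mod 4" by (simp_all only: j_def m_def)
  have nm: "n = m + 2" using assms by (simp add: m_def)
  have "4 * j + m mod 4 = m" by (simp add: j_def)
  then have "real (4 * j + m mod 4) = real m" by (simp only:)
  then have rn: "real n = 4 * real j + real (m mod 4) + 2" using nm by simp
  have nmod: "n mod 4 = (m mod 4 + 2) mod 4" unfolding nm by (simp only: mod_add_left_eq)
  have "m mod 4 = 0 \<or> m mod 4 = 1 \<or> m mod 4 = 2 \<or> m mod 4 = 3" by linarith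
  then show thesis
  proof (elim disjE, goal_cases)
    case 1
    show ?case by (rule that(1)[OF D]) (simp_all add: M 1 nmod rn)
  next
    case 2
    show ?case by (rule that(2)[OF D]) (simp_all add: M 2 nmod rn)
  next
    case 3
    show ?case by (rule that(3)[OF D]) (simp_all add: M 3 nmod rn)
  next
    case 4
    show ?case by (rule that(4)[OF D]) (simp_all add: M 4 nmod rn)
  qed
qed

lemma max_edges_3:
  assumes n: "5 \<le> n"
  shows "real (max_edges 3 n) = 9/4 * (real n - 3) + \<delta>\<^sub>3 n"
  by (cases rule: mod_four_cases[OF n]) (use n in \<open>simp_all add: real_max_edges extremal_def \<delta>\<^sub>3_def of_nat_diff field_simps\<close>)

lemma max_edges_4:
  assumes n: "5 \<le> n"
  shows "real (max_edges 4 n) = 5/2 * (real n - 3) + \<delta>\<^sub>4 n"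
  by (cases rule: mod_four_cases[OF n]) (use n in \<open>simp_all add: real_max_edges extremal_def \<delta>\<^sub>4_def of_nat_diff field_simps\<close>)

theorem theorem8:
  fixes k n :: nat
  assumes "k \<ge> 3" and "n > 2 * k"
  shows
    "if 2 * k < n \<and> n \<le> 3 * k then
       real (book_crossing_number_complete k n) \<ge> L k n 1 \<and>
       L k n 1 = 1/2 * (real n - 3) * (real n - 2 * real k)
     else if 3 * k < n \<and> n \<le> 4 * k then
       real (book_crossing_number_complete k n) \<ge> L k n 2 \<and>
       L k n 2 = (real n - 3) * (real n - 5/2 * real k) - real k * \<delta>\<^sub>1 n
     else if 4 * k < n \<and> int n \<le> \<lfloor>9/2 * real k\<rfloor> + \<beta> k n then
       real (book_crossing_number_complete k n) \<ge> L k n 3 \<and>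
       L k n 3 = 3/2 * (real n - 3) * (real n - 3 * real k) - real k * (\<delta>\<^sub>1 n + \<delta>\<^sub>2 n)
     else if \<lfloor>9/2 * real k\<rfloor> + \<beta> k n < int n \<and> n \<le> 5 * k then
       real (book_crossing_number_complete k n) \<ge> L k n 4 \<and>
       L k n 4 = 2 * (real n - 3) * (real n - 27/8 * real k)
                 - real k * (\<delta>\<^sub>1 n + \<delta>\<^sub>2 n + \<delta>\<^sub>3 n)
     else
       real (book_crossing_number_complete k n) \<ge> L k n 5 \<and>
       L k n 5 = 5/2 * (real n - 3) * (real n - 37/10 * real k)
                 - real k * (\<delta>\<^sub>1 n + \<delta>\<^sub>2 n + \<delta>\<^sub>3 n + \<delta>\<^sub>4 n)"
proof -
  have n: "5 \<le> n" "3 \<le> n" "0 < k" using assms by auto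
  have sum_of: "(\<Sum>l<1. f l) = f 0" "(\<Sum>l<2. f l) = f 0 + f 1" "(\<Sum>l<3. f l) = f 0 + f 1 + f 2"
    "(\<Sum>l<4. f l) = f 0 + f 1 + f 2 + f 3" "(\<Sum>l<5. f l) = f 0 + f 1 + f 2 + f 3 + f 4" for f :: "nat \<Rightarrow> real"
    by (simp_all add: eval_nat_numeral)
  \<comment> \<open>The slopes 1, 3/2, 2, 9/4, 5/2 add up to 1, 5/2, 9/2, 27/4, 37/4. Divided by
    \<open>m / 2\<close>, they give the factors 2, 5/2, 3, 27/8, 37/10 of \<open>k\<close> in the
    claim.\<close>
  have sums: "(\<Sum>l<1. real (max_edges l n)) = real n - 3"
    "(\<Sum>l<2. real (max_edges l n)) = 5/2 * (real n - 3) + \<delta>\<^sub>1 n"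
    "(\<Sum>l<3. real (max_edges l n)) = 9/2 * (real n - 3) + (\<delta>\<^sub>1 n + \<delta>\<^sub>2 n)"
    "(\<Sum>l<4. real (max_edges l n)) = 27/4 * (real n - 3) + (\<delta>\<^sub>1 n + \<delta>\<^sub>2 n + \<delta>\<^sub>3 n)"
    "(\<Sum>l<5. real (max_edges l n)) = 37/4 * (real n - 3) + (\<delta>\<^sub>1 n + \<delta>\<^sub>2 n + \<delta>\<^sub>3 n + \<delta>\<^sub>4 n)"
    unfolding sum_of max_edges_0[OF n(1)] max_edges_1[OF n(1)] max_edges_2[OF n(1)] max_edges_3[OF n(1)]
      max_edges_4[OF n(1)] by (simp_all add: field_simps)
  have L1: "L k n 1 \<le> real (book_crossing_number_complete k n) \<and>
      L k n 1 = 1/2 * (real n - 3) * (real n - 2 * real k)"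
    by (intro conjI book_crossing_bound n) (simp add: L_def sums max_edges_0[OF n(1)] field_simps)
  have L2: "L k n 2 \<le> real (book_crossing_number_complete k n) \<and>
      L k n 2 = (real n - 3) * (real n - 5/2 * real k) - real k * \<delta>\<^sub>1 n"
    by (intro conjI book_crossing_bound n) (simp add: L_def sums max_edges_0[OF n(1)] field_simps)
  have L3: "L k n 3 \<le> real (book_crossing_number_complete k n) \<and>
      L k n 3 = 3/2 * (real n - 3) * (real n - 3 * real k) - real k * (\<delta>\<^sub>1 n + \<delta>\<^sub>2 n)"
    by (intro conjI book_crossing_bound n) (simp add: L_def sums max_edges_0[OF n(1)] field_simps)
  have L4: "L k n 4 \<le> real (book_crossing_number_complete k n) \<and>
      L k n 4 = 2 * (real n - 3) * (real n - 27/8 * real k)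
      - real k * (\<delta>\<^sub>1 n + \<delta>\<^sub>2 n + \<delta>\<^sub>3 n)"
    by (intro conjI book_crossing_bound n) (simp add: L_def sums max_edges_0[OF n(1)] field_simps)
  have L5: "L k n 5 \<le> real (book_crossing_number_complete k n) \<and>
      L k n 5 = 5/2 * (real n - 3) * (real n - 37/10 * real k)
      - real k * (\<delta>\<^sub>1 n + \<delta>\<^sub>2 n + \<delta>\<^sub>3 n + \<delta>\<^sub>4 n)"
    by (intro conjI book_crossing_bound n) (simp add: L_def sums max_edges_0[OF n(1)] field_simps)
  have branch: "if c then A else B" if A B for c A B using that by simp
  show ?thesis by (rule branch[OF L1 branch[OF L2 branch[OF L3 branch[OF L4 L5]]]])
qed

end
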